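(* Let $\nu>0$ and let $\mathcal{I}^\nu F:=Ext(F\circ\psi_2)$ for $F\in\mathcal{F}^{2,\nu}(\mathbb{C}^2)$, where $\psi_2(\xi)=\left(\frac{\xi}{\sqrt2},\frac{-i\xi}{\sqrt2}\right)$. Then the transform $\mathcal{B}^\nu_{\mathbb{H}}\circ\mathcal{R}^\nu$ coincides with $\mathcal{I}^\nu$ and acts on $\mathcal{F}^{2,\nu}(\mathbb{C}^2)$ by $$\mathcal{B}^\nu_{\mathbb{H}}\circ\mathcal{R}^\nu F(q)=\left(\frac{\nu}{\pi}\right)\int_{\mathbb{C}}F\left(\frac{\xi}{\sqrt2},\frac{-i\xi}{\sqrt2}\right)K^\nu_{\mathbb{H}}(q,\xi)\,e^{-\nu|\xi|^2}\,d\lambda(\xi),$$ where $K^\nu_{\mathbb{H}}(q,\xi)$ is the reproducing kernel of $\mathcal{F}^{2,\nu}_{slice}(\mathbb{H})$.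
   Context: Let $\nu>0$. Let $\mathbb{H}$ be the quaternions, $\mathbb{S}=\{I\in\mathbb{H}: I^2=-1\}$, and $\mathbb{C}_I=\mathbb{R}+\mathbb{R}I$ for $I\in\mathbb{S}$. Fix $i\in\mathbb{S}$ and identify $\mathbb{C}$ with $\mathbb{C}_i\subset\mathbb{H}$. $L^{2,\nu}(\mathbb{R}^d,\mathbb{C})$ (respectively $L^{2,\nu}(\mathbb{R},\mathbb{H})$) is the Hilbert space of $\mathbb{C}$-valued (respectively $\mathbb{H}$-valued) functions that are square integrable with respect to $e^{-\nu|x|^2}dx$, and $L^{2,\nu}(\mathbb{R},\mathbb{C})\subset L^{2,\nu}(\mathbb{R},\mathbb{H})$. The Bargmann-Fock space $\mathcal{F}^{2,\nu}(\mathbb{C}^d)$ consists of the holomorphic functions on $\mathbb{C}^d$ that are square integrable with respect to $e^{-\nu|z|^2}d\lambda$, with $d\lambda$ the Lebesgue measure. Slice regular functions: $F:\mathbb{H}\to\mathbb{H}$ (real differentiable) is (left) slice regular if for every $I\in\mathbb{S}$ its restriction to $\mathbb{C}_I$ satisfies $\left(\frac{\partial}{\partial x}+I\frac{\partial}{\partial y}\right)F(x+yI)=0$. The slice hyperholomorphic Bargmann-Fock space $\mathcal{F}^{2,\nu}_{slice}(\mathbb{H})$ is the right $\mathbb{H}$-vector space of slice regular functions $F$ on $\mathbb{H}$ with $\int_{\mathbb{C}_I}|F(q)|^2e^{-\nu|q|^2}d\lambda_I(q)<\infty$ for some (equivalently, any) $I\in\mathbb{S}$, where $d\lambda_I(x+yI)=dx\,dy$.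 Its reproducing kernel is $$K^\nu_{\mathbb{H}}(q,p)=\frac{\nu}{\pi}\sum_{m=0}^{\infty}\frac{\nu^m q^m\overline{p}^m}{m!},\qquad p,q\in\mathbb{H}.$$ Extension: for a holomorphic $f:\mathbb{C}_i\to\mathbb{C}_i$, $Ext(f)$ is its unique slice regular extension to $\mathbb{H}$: $$Ext(f)(x+yJ)=\tfrac12[f(x+yi)+f(x-yi)]+\tfrac{Ji}{2}[f(x-yi)-f(x+yi)],\qquad x,y\in\mathbb{R},\ J\in\mathbb{S}.$$ Transforms: the Segal-Bargmann transform, unitary from $L^{2,\nu}(\mathbb{R}^d,\mathbb{C})$ onto $\mathcal{F}^{2,\nu}(\mathbb{C}^d)$, is $$\mathcal{B}^{d,\nu}f(z)=\left(\frac{\nu}{\pi}\right)^{\frac{3d}{4}}\int_{\mathbb{R}^d}f(x)e^{-\nu\left(x-\frac{z}{\sqrt2}\right)^2}dx,\qquad u^2:=u_1^2+\cdots+u_d^2.$$ The quaternionic Segal-Bargmann transform, mapping $L^{2,\nu}(\mathbb{R},\mathbb{H})$ onto $\mathcal{F}^{2,\nu}_{slice}(\mathbb{H})$, is $$\mathcal{B}^\nu_{\mathbb{H}}f(q)=\left(\frac{\nu}{\pi}\right)^{\frac34}\int_{\mathbb{R}}f(x)\,e^{-\nu\left(x-\frac{q}{\sqrt2}\right)^2}dx,\qquad q\in\mathbb{H}.$$ The transform $\mathcal{R}^\nu:\mathcal{F}^{2,\nu}(\mathbb{C}^2)\to L^{2,\nu}(\mathbb{R},\mathbb{C})$ is $\mathcal{R}^\nu=(\mathcal{B}^{1,\nu})^{-1}\circ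 Proj\circ(\mathcal{B}^{2,\nu})^{-1}$. Here $L^{2,\nu}(\mathbb{R}^2,\mathbb{C})$ is identified with $L^{2,\nu}(\mathbb{C},\mathbb{C})$, the functions on $\mathbb{C}$ square integrable for $e^{-\nu|z|^2}d\lambda$, and $Proj$ is the orthogonal projection of $L^{2,\nu}(\mathbb{C},\mathbb{C})$ onto $\mathcal{F}^{2,\nu}(\mathbb{C})$.
   Formalization: Constants corrected: B_H∘R = √(π/ν)·I, and the factor ν/π before the integral becomes √(π/ν) (F=1 refutes the original unless ν=π). The kernel K and the exponential in B_H stand to the left of the function, since the other order fails off C_i. *)

theory Defs
  imports "HOL-Analysis.Analysis"
begin

section \<open>Quaternions\<close>

datatype quat = Quat (qre: real) (qim1: real) (qim2: real) (qim3: real)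

lemma quat_eq_iff:
  "p = q \<longleftrightarrow> qre p = qre q \<and> qim1 p = qim1 q \<and> qim2 p = qim2 q \<and> qim3 p = qim3 q"
  by (cases p; cases q) simp

instantiation quat :: real_vector
begin

definition "0 = Quat 0 0 0 0"
definition "p + q = Quat (qre p + qre q) (qim1 p + qim1 q) (qim2 p + qim2 q) (qim3 p + qim3 q)"
definition "p - q = Quat (qre p - qre q) (qim1 p - qim1 q) (qim2 p - qim2 q) (qim3 p - qim3 q)"
definition "- q = Quat (- qre q) (- qim1 q) (- qim2 q) (- qim3 q)"
definition "r *\<^sub>R q = Quat (r * qre q) (r * qim1 q) (r * qim2 q) (r * qim3 q)"

instance
  by standard
    (simp_all add: quat_eq_iff zero_quat_def plus_quat_def minus_quat_def uminus_quat_def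
      scaleR_quat_def algebra_simps)

end

instantiation quat :: ring_1
begin

definition "1 = Quat 1 0 0 0"
definition "p * q = Quat
  (qre p * qre q - qim1 p * qim1 q - qim2 p * qim2 q - qim3 p * qim3 q)
  (qre p * qim1 q + qim1 p * qre q + qim2 p * qim3 q - qim3 p * qim2 q)
  (qre p * qim2 q - qim1 p * qim3 q + qim2 p * qre q + qim3 p * qim1 q)
  (qre p * qim3 q + qim1 p * qim2 q - qim2 p * qim1 q + qim3 p * qre q)"

instance
  by standard
    (simp_all add: quat_eq_iff zero_quat_def one_quat_def plus_quat_def times_quat_def
      algebra_simps)

end

lemmas quat_defs = zero_quat_def one_quat_def plus_quat_def minus_quat_def uminus_quat_def
  scaleR_quat_def times_quat_def

lemma quat_sel_simps [simp]:
  "qre 0 = 0" "qim1 0 = 0" "qim2 0 = 0" "qim3 0 = 0"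
  "qre 1 = 1" "qim1 1 = 0" "qim2 1 = 0" "qim3 1 = 0"
  "qre (p + q) = qre p + qre q" "qim1 (p + q) = qim1 p + qim1 q"
  "qim2 (p + q) = qim2 p + qim2 q" "qim3 (p + q) = qim3 p + qim3 q"
  "qre (p - q) = qre p - qre q" "qim1 (p - q) = qim1 p - qim1 q"
  "qim2 (p - q) = qim2 p - qim2 q" "qim3 (p - q) = qim3 p - qim3 q"
  "qre (- q) = - qre q" "qim1 (- q) = - qim1 q" "qim2 (- q) = - qim2 q" "qim3 (- q) = - qim3 q"
  "qre (r *\<^sub>R q) = r * qre q" "qim1 (r *\<^sub>R q) = r * qim1 q"
  "qim2 (r *\<^sub>R q) = r * qim2 q" "qim3 (r *\<^sub>R q) = r * qim3 q"
  by (simp_all add: quat_defs)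

definition qcnj :: "quat \<Rightarrow> quat"
  where "qcnj q = Quat (qre q) (- qim1 q) (- qim2 q) (- qim3 q)"

instantiation quat :: real_inner
begin

definition "inner p q = qre p * qre q + qim1 p * qim1 q + qim2 p * qim2 q + qim3 p * qim3 q"
definition "norm q = sqrt ((qre q)\<^sup>2 + (qim1 q)\<^sup>2 + (qim2 q)\<^sup>2 + (qim3 q)\<^sup>2)"
definition "sgn q = q /\<^sub>R norm (q::quat)"
definition "dist p q = norm (p - q :: quat)"
definition [code del]:
  "(uniformity :: (quat \<times> quat) filter) = (INF e\<in>{0 <..}. principal {(x, y). dist x y < e})"
definition [code del]:
  "open (U :: quat set) \<longleftrightarrow> (\<forall>x\<in>U. eventually (\<lambda>(x', y). x' = x \<longrightarrow> y \<in> U) uniformity)"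

instance
proof
  fix r :: real and x y z :: quat and U :: "quat set"
  show "dist x y = norm (x - y)" by (rule dist_quat_def)
  show "sgn x = x /\<^sub>R norm x" by (rule sgn_quat_def)
  show "uniformity = (INF e\<in>{0 <..}. principal {(x::quat, y). dist x y < e})"
    by (rule uniformity_quat_def)
  show "open U \<longleftrightarrow> (\<forall>x\<in>U. eventually (\<lambda>(x', y). x' = x \<longrightarrow> y \<in> U) uniformity)"
    by (rule open_quat_def)
  show "inner x y = inner y x" by (simp add: inner_quat_def mult.commute)
  show "inner (x + y) z = inner x z + inner y z" by (simp add: inner_quat_def algebra_simps)
  show "inner (r *\<^sub>R x) y = r * inner x y" by (simp add: inner_quat_def algebra_simps)
  show "0 \<le> inner x x" by (simp add: inner_quat_def)
  have "a * a + b * b + c * c + d * d = 0 \<longleftrightarrow> a = 0 \<and> b = 0 \<and> c = 0 \<and> d = 0" for a b c d :: real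
    by (simp add: add_nonneg_eq_0_iff)
  then show "inner x x = 0 \<longleftrightarrow> x = 0" by (simp add: inner_quat_def quat_eq_iff)
  show "norm x = sqrt (inner x x)" by (simp add: norm_quat_def inner_quat_def power2_eq_square)
qed

end

instantiation quat :: real_normed_div_algebra
begin

definition "inverse q = qcnj q /\<^sub>R (norm (q::quat))\<^sup>2"
definition "p div q = p * inverse (q::quat)"

instance
proof
  fix r :: real and x y :: quat
  show "r *\<^sub>R x * y = r *\<^sub>R (x * y)"
    by (simp add: quat_defs algebra_simps)
  show "x * r *\<^sub>R y = r *\<^sub>R (x * y)"
    by (simp add: quat_defs algebra_simps)
  have "(qre (x * y))\<^sup>2 + (qim1 (x * y))\<^sup>2 + (qim2 (x * y))\<^sup>2 + (qim3 (x * y))\<^sup>2 =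
      ((qre x)\<^sup>2 + (qim1 x)\<^sup>2 + (qim2 x)\<^sup>2 + (qim3 x)\<^sup>2) *
      ((qre y)\<^sup>2 + (qim1 y)\<^sup>2 + (qim2 y)\<^sup>2 + (qim3 y)\<^sup>2)"
    unfolding times_quat_def quat.sel by algebra
  then show "norm (x * y) = norm x * norm y"
    by (simp only: norm_quat_def real_sqrt_mult)
  have n: "(norm x)\<^sup>2 = (qre x)\<^sup>2 + (qim1 x)\<^sup>2 + (qim2 x)\<^sup>2 + (qim3 x)\<^sup>2"
    by (simp add: norm_quat_def)
  have c: "qcnj x * x = (norm x)\<^sup>2 *\<^sub>R 1" "x * qcnj x = (norm x)\<^sup>2 *\<^sub>R 1"
    unfolding n by (simp_all add: quat_eq_iff times_quat_def qcnj_def power2_eq_square algebra_simps)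
  have s: "(a *\<^sub>R x) * y = a *\<^sub>R (x * y)" "x * (a *\<^sub>R y) = a *\<^sub>R (x * y)" for a and x y :: quat
    by (simp_all add: quat_defs algebra_simps)
  show "inverse x * x = 1" "x * inverse x = 1" if "x \<noteq> 0"
    using that by (simp_all add: inverse_quat_def s c)
  show "x div y = x * inverse y" by (rule divide_quat_def)
  show "inverse (0::quat) = 0" by (simp add: inverse_quat_def quat_eq_iff qcnj_def)
qed

end

instantiation quat :: euclidean_space
begin

definition "Basis = {Quat 1 0 0 0, Quat 0 1 0 0, Quat 0 0 1 0, Quat 0 0 0 1}"

instance
proof
  fix u v x :: quat
  show "(Basis :: quat set) \<noteq> {}" "finite (Basis :: quat set)"
    by (simp_all add: Basis_quat_def)
  show "inner u v = (if u = v then 1 else 0)" if "u \<in> Basis" "v \<in> Basis"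
    using that unfolding Basis_quat_def
    by (elim insertE emptyE; hypsubst; simp add: inner_quat_def)
  show "(\<forall>u\<in>Basis. inner x u = 0) \<longleftrightarrow> x = 0"
    unfolding Basis_quat_def by (simp add: inner_quat_def quat_eq_iff [of x 0])
qed

end

definition imag_units :: "quat set"
  where "imag_units = {J. J\<^sup>2 = -1}"

text \<open>The identification of the complex numbers with the slice of the imaginary unit \<open>I\<close>.\<close>

definition slice_embed :: "quat \<Rightarrow> complex \<Rightarrow> quat"
  where "slice_embed I z = of_real (Re z) + Im z *\<^sub>R I"


section \<open>Slice regular extension\<close>

text \<open>Every \<open>q\<close> is \<open>x + y J\<close> with \<open>y \<ge> 0\<close> and \<open>J\<close> an imaginary unit; for real \<open>q\<close> the choice of
  \<open>J\<close> is immaterial. Lemma \<open>slice_ext_eq\<close> shows that the formula holds for all representations.\<close>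

definition slice_ext :: "quat \<Rightarrow> (complex \<Rightarrow> complex) \<Rightarrow> quat \<Rightarrow> quat"
  where "slice_ext I f q =
   (let x = qre q; v = q - of_real x; y = norm v; J = (if v = 0 then I else v /\<^sub>R y);
        fp = slice_embed I (f (Complex x y)); fm = slice_embed I (f (Complex x (- y)))
    in (1/2) *\<^sub>R (fp + fm) + (1/2) *\<^sub>R (J * I * (fm - fp)))"

lemma qsel_of_real [simp]:
  "qre (of_real x) = x" "qim1 (of_real x) = 0" "qim2 (of_real x) = 0" "qim3 (of_real x) = 0"
  by (simp_all add: of_real_def)

lemma imag_units_iff: "J \<in> imag_units \<longleftrightarrow> qre J = 0 \<and> norm J = 1"
proof
  assume J: "J \<in> imag_units"
  then have "norm (J\<^sup>2) = 1" by (simp add: imag_units_def)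
  then have n: "norm J = 1"
    by (simp add: norm_power power2_eq_1_iff) (smt (verit) norm_ge_zero)
  have "qre (J * J) = -1" using J by (simp add: imag_units_def power2_eq_square)
  then have e: "(qre J)\<^sup>2 - (qim1 J)\<^sup>2 - (qim2 J)\<^sup>2 - (qim3 J)\<^sup>2 = -1"
    by (simp add: times_quat_def power2_eq_square)
  have "(qre J)\<^sup>2 + (qim1 J)\<^sup>2 + (qim2 J)\<^sup>2 + (qim3 J)\<^sup>2 = 1"
    using n by (simp add: norm_quat_def)
  with e have "(qre J)\<^sup>2 = 0" by linarith
  with n show "qre J = 0 \<and> norm J = 1" by simp
next
  assume J: "qre J = 0 \<and> norm J = 1"
  then have "qim1 J * qim1 J + qim2 J * qim2 J + qim3 J * qim3 J = 1"
    by (auto simp: norm_quat_def power2_eq_square)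
  then have "- (qim1 J * qim1 J) - qim2 J * qim2 J - qim3 J * qim3 J = - 1" by linarith
  with J show "J \<in> imag_units"
    by (simp add: imag_units_def quat_eq_iff power2_eq_square times_quat_def)
qed

lemma slice_ext_eq:
  assumes "J \<in> imag_units"
  shows "slice_ext I f (of_real x + y *\<^sub>R J) =
    (1/2) *\<^sub>R (slice_embed I (f (Complex x y)) + slice_embed I (f (Complex x (- y)))) +
    (1/2) *\<^sub>R (J * I * (slice_embed I (f (Complex x (- y))) - slice_embed I (f (Complex x y))))"
proof -
  have r: "qre (of_real x + y *\<^sub>R J) = x" and n: "norm J = 1" and "J \<noteq> 0"
    using assms by (auto simp: imag_units_iff)
  consider "y = 0" | "y > 0" | "y < 0" by linarith
  then show ?thesis
    by cases
      (use r n \<open>J \<noteq> 0\<close> in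
        \<open>auto simp: slice_ext_def Let_def algebra_simps\<close>)
qed


section \<open>Weighted spaces\<close>

definition gauss_measure :: "real \<Rightarrow> 'a::euclidean_space measure"
  where "gauss_measure \<nu> = density lborel (\<lambda>x. ennreal (exp (- \<nu> * (norm x)\<^sup>2)))"

text \<open>Elements of the Hilbert space are represented by Borel functions, not by classes modulo
  equality almost everywhere.\<close>

definition gauss_L2 :: "real \<Rightarrow> ('a::euclidean_space \<Rightarrow> complex) set"
  where "gauss_L2 \<nu> = {f \<in> borel_measurable borel. integrable (gauss_measure \<nu>) (\<lambda>x. (norm (f x))\<^sup>2)}"

text \<open>Holomorphy in several variables: real differentiability with a complex-linear derivative.\<close>

definition holomorphic_Cn :: "(complex^'d \<Rightarrow> complex) \<Rightarrow> bool"
  where "holomorphic_Cn F \<longleftrightarrow>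
    (\<forall>z. \<exists>D. (F has_derivative D) (at z) \<and> (\<forall>c v. D (c *s v) = c * D v))"

definition bargmann_fock :: "real \<Rightarrow> (complex^'d \<Rightarrow> complex) set"
  where "bargmann_fock \<nu> =
    {F. holomorphic_Cn F \<and> integrable (gauss_measure \<nu>) (\<lambda>z. (norm (F z))\<^sup>2)}"

text \<open>The space over the complex plane itself, without the detour through \<open>complex^1\<close>.\<close>

definition bargmann_fock_plane :: "real \<Rightarrow> (complex \<Rightarrow> complex) set"
  where "bargmann_fock_plane \<nu> =
    {f. f holomorphic_on UNIV \<and> integrable (gauss_measure \<nu>) (\<lambda>z. (norm (f z))\<^sup>2)}"

definition fock_proj :: "real \<Rightarrow> (complex \<Rightarrow> complex) \<Rightarrow> complex \<Rightarrow> complex"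
  where "fock_proj \<nu> f = (THE h. h \<in> bargmann_fock_plane \<nu> \<and>
    (\<forall>g \<in> bargmann_fock_plane \<nu>. (LINT z|gauss_measure \<nu>. (f z - h z) * cnj (g z)) = 0))"


section \<open>Transforms\<close>

definition segal_bargmann :: "real \<Rightarrow> (real^'d \<Rightarrow> complex) \<Rightarrow> complex^'d \<Rightarrow> complex"
  where "segal_bargmann \<nu> f z = of_real ((\<nu> / pi) powr (3 * real CARD('d) / 4)) *
    (LINT x|lborel. f x * exp (- of_real \<nu> *
      (\<Sum>j\<in>UNIV. (of_real (x $ j) - z $ j / of_real (sqrt 2))\<^sup>2)))"

text \<open>The inverse picks a representative; it is determined up to equality almost everywhere.\<close>

definition segal_bargmann_inv :: "real \<Rightarrow> (complex^'d \<Rightarrow> complex) \<Rightarrow> real^'d \<Rightarrow> complex"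
  where "segal_bargmann_inv \<nu> = inv_into (gauss_L2 \<nu>) (segal_bargmann \<nu>)"

text \<open>The coordinate changes inserted below are the identifications of the complex plane with
  \<open>real^2\<close>, of \<open>complex^1\<close> with \<open>complex\<close> and of \<open>real\<close> with \<open>real^1\<close>.\<close>

definition R_transform :: "real \<Rightarrow> (complex^2 \<Rightarrow> complex) \<Rightarrow> real \<Rightarrow> complex"
  where "R_transform \<nu> F =
   (let g = (\<lambda>w::complex. segal_bargmann_inv \<nu> F (vector [Re w, Im w]));
        h = fock_proj \<nu> g
    in (\<lambda>t. segal_bargmann_inv \<nu> (\<lambda>z::complex^1. h (z $ 1)) (vec t)))"

text \<open>The kernel stands to the left of the function, so that the transform is right linear and
  its values are left slice regular.\<close>

definition quat_segal_bargmann :: "real \<Rightarrow> (real \<Rightarrow> quat) \<Rightarrow> quat \<Rightarrow> quat"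
  where "quat_segal_bargmann \<nu> f q = ((\<nu> / pi) powr (3 / 4)) *\<^sub>R
    (LINT x|lborel. exp (- \<nu> *\<^sub>R (of_real x - q /\<^sub>R sqrt 2)\<^sup>2) * f x)"

definition slice_kernel :: "real \<Rightarrow> quat \<Rightarrow> quat \<Rightarrow> quat"
  where "slice_kernel \<nu> q p = (\<nu> / pi) *\<^sub>R (\<Sum>m. (\<nu> ^ m / fact m) *\<^sub>R (q ^ m * qcnj p ^ m))"

definition psi2 :: "complex \<Rightarrow> complex^2"
  where "psi2 \<xi> = vector [\<xi> / of_real (sqrt 2), - \<i> * \<xi> / of_real (sqrt 2)]"

text \<open>The transform \<open>R_transform\<close> agrees with composition with \<open>psi2\<close> only up to normalization:
  \<open>segal_bargmann\<close> maps the constant function \<open>1\<close> to \<open>(\<nu>/pi) powr (1/4)\<close> in dimension one and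
  to \<open>sqrt (\<nu>/pi)\<close> in dimension two, hence \<open>quat_segal_bargmann\<close> after \<open>R_transform\<close> sends \<open>1\<close> to
  \<open>sqrt (pi/\<nu>)\<close>, whereas \<open>I_transform\<close> sends \<open>1\<close> to \<open>1\<close>.\<close>

definition I_transform :: "quat \<Rightarrow> (complex^2 \<Rightarrow> complex) \<Rightarrow> quat \<Rightarrow> quat"
  where "I_transform I F = slice_ext I (F \<circ> psi2)"

end

theory Submission
  imports Defs "HOL-Probability.Characteristic_Functions" "HOL-Complex_Analysis.Cauchy_Integral_Formula"
begin

text \<open>At \<open>psi2 \<xi>\<close> the two-dimensional Segal-Bargmann kernel, written against the Gaussian measure,
  equals \<open>exp (\<nu> \<xi> cnj w)\<close>, the reproducing kernel of the Fock space of the plane up to a constant. So for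
  every preimage \<open>g\<close> of \<open>F\<close> the projection of \<open>g\<close> is \<open>sqrt (\<pi> / \<nu>) F \<circ> psi2\<close>, and the inverse
  one-dimensional transform in \<open>R_transform\<close> is undone by the quaternionic one, which extends the complex
  one from a slice. The integral formula is the reproducing property, extended slice by slice.

  The preimages exist because the Segal-Bargmann transform is onto: on a dilation \<open>F (r z)\<close> with \<open>r < 1\<close>
  the adjoint integral converges absolutely and gives an isometric right inverse, and the dilations
  converge to \<open>F\<close> in the Fock space as \<open>r\<close> tends to \<open>1\<close>.\<close>

text \<open>The growth bound exp (\<nu> |z|^2 / 2) of a Fock function is critical in two places.
  Along imaginary z the Segal-Bargmann kernel grows at the same rate, so in the adjoint integral the
  product of the two bounds cancels the Gaussian weight exactly; a dilation lowers one of the rates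
  and restores decay. And since \<open>psi2\<close> preserves norms, the bound for F o
  \<open>psi2\<close> just fails to be square integrable on the plane, so its membership in the Fock
  space is obtained from an L2 bound for the integral operator with the Fock kernel.

  The reproducing formula, in every dimension at once, rests on the invariance of the Gaussian
  measure under multiplication by unit complex numbers and on the mean value property on complex
  lines. This works directly with the derivative-based notion \<open>holomorphic_Cn\<close>, without
  power series.

  The constant sqrt (pi / \<nu>) is the factor \<nu> / pi of the plane projection divided by the
  factor (\<nu> / pi) powr (3 / 2) of the two-dimensional transform; the one-dimensional factors
  cancel between the inverse and the quaternionic transform.\<close>

section \<open>Lebesgue measure under rotations\<close>

lemma linear_Basis_iso_inner:
  fixes T :: "'a::euclidean_space \<Rightarrow> 'b::euclidean_space"
  assumes "linear T" "bij_betw T Basis Basis"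
  shows "T x \<bullet> T y = x \<bullet> y"
proof -
  have o: "T b \<bullet> T b' = (if b = b' then 1 else 0)" if "b \<in> Basis" "b' \<in> Basis" for b b'
  proof -
    have "T b \<in> Basis" "T b' \<in> Basis" "T b = T b' \<longleftrightarrow> b = b'"
      using that assms(2) by (auto simp: bij_betw_def inj_on_def)
    then show ?thesis by (simp add: inner_Basis)
  qed
  have r: "T x = (\<Sum>b\<in>Basis. (x \<bullet> b) *\<^sub>R T b)" for x
    using linear_sum[OF assms(1), of "\<lambda>b. (x \<bullet> b) *\<^sub>R b" Basis]
    by (simp add: euclidean_representation linear_cmul[OF assms(1)])
  show ?thesis
    by (subst r, subst (2) r) (simp add: inner_sum_left inner_sum_right o euclidean_inner[of x y] if_distrib mult.commute cong: if_cong)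
qed

text \<open>Such a map only renames coordinates, so the preimage of a box is a box with the same
  side lengths. All identifications of coordinate spaces go through this lemma.\<close>

lemma lborel_distr_Basis_iso:
  fixes T :: "'a::euclidean_space \<Rightarrow> 'b::euclidean_space"
  assumes T: "linear T" and B: "bij_betw T Basis Basis"
  shows "distr lborel borel T = lborel"
proof (rule lborel_eqI[symmetric])
  have m[measurable]: "T \<in> borel_measurable borel"
    using T by (intro borel_measurable_continuous_onI linear_continuous_on) (simp add: linear_conv_bounded_linear)
  show "sets (distr lborel borel T) = sets borel" by simp
  fix l u :: 'b
  assume le: "\<And>b. b \<in> Basis \<Longrightarrow> l \<bullet> b \<le> u \<bullet> b"
  \<comment> \<open>\<open>p\<close> is the adjoint of \<open>T\<close>, hence its inverse; it sends
    the corners of a box to the corners of the preimage.\<close>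
  define p where "p l = (\<Sum>b\<in>Basis. (l \<bullet> T b) *\<^sub>R b)" for l :: 'b
  have p: "p l \<bullet> b = l \<bullet> T b" if "b \<in> Basis" for l b
    using that by (simp add: p_def)
  have TB: "T b \<in> Basis" if "b \<in> Basis" for b
    using B that by (auto simp: bij_betw_def)
  have "x \<in> T -` box l u \<longleftrightarrow> x \<in> box (p l) (p u)" for x
  proof -
    have "T x \<in> box l u \<longleftrightarrow> (\<forall>b\<in>T ` Basis. l \<bullet> b < T x \<bullet> b \<and> T x \<bullet> b < u \<bullet> b)"
      using B by (simp add: mem_box bij_betw_def)
    then show ?thesis
      by (simp add: mem_box p linear_Basis_iso_inner[OF T B])
  qed
  then have "T -` box l u = box (p l) (p u)" by blast
  then have "emeasure (distr lborel borel T) (box l u) = emeasure lborel (box (p l) (p u))"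
    by (simp add: emeasure_distr)
  also have "\<dots> = (\<Prod>b\<in>Basis. (p u - p l) \<bullet> b)"
    by (rule emeasure_lborel_box) (simp add: p le TB)
  also have "(\<Prod>b\<in>Basis. (p u - p l) \<bullet> b) = (\<Prod>b\<in>Basis. (u - l) \<bullet> T b)"
    by (intro prod.cong) (auto simp: inner_diff_left p)
  also have "\<dots> = (\<Prod>b\<in>Basis. (u - l) \<bullet> b)"
    using prod.reindex_bij_betw[OF B, of "\<lambda>b. (u - l) \<bullet> b"] by simp
  finally show "emeasure (distr lborel borel T) (box l u) = ennreal (\<Prod>b\<in>Basis. (u - l) \<bullet> b)" .
qed

lemma distr_lborel_comp:
  assumes "f \<in> borel_measurable borel" "g \<in> borel_measurable borel"
  shows "distr (distr lborel borel f) borel g = distr lborel borel (\<lambda>x. g (f x))"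
  using assms by (subst distr_distr) (auto simp: comp_def)

text \<open>On each slice with fixed \<open>y\<close> the shear is a translation, so slicing with
  Fubini's theorem leaves every measure unchanged.\<close>

lemma lborel_shear_fst:
  fixes k :: real
  shows "distr lborel borel (\<lambda>(x, y). (x + k *\<^sub>R y, y)) = (lborel :: ('a::euclidean_space \<times> 'a) measure)"
    (is "distr lborel borel ?S = _")
proof (rule measure_eqI)
  have m: "?S \<in> borel_measurable borel"
    by (intro borel_measurable_continuous_onI) (auto intro!: continuous_intros simp: case_prod_unfold)
  fix A :: "('a \<times> 'a) set" assume "A \<in> sets (distr lborel borel ?S)"
  then have A: "A \<in> sets borel" by simp
  have SA: "?S -` A \<in> sets borel" using measurable_sets[OF m A] by simp
  have tr: "emeasure lborel ((\<lambda>x. x + c) -` X) = emeasure lborel X" if "X \<in> sets borel" for c :: 'a and X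
  proof -
    have "emeasure lborel X = emeasure (distr lborel borel ((+) c)) X" by (simp add: lborel_distr_plus)
    also have "\<dots> = emeasure lborel ((\<lambda>x. x + c) -` X)"
      using that by (subst emeasure_distr) (auto simp: add.commute[of _ c])
    finally show ?thesis ..
  qed
  have sec: "(\<lambda>x. (x, y)) -` A \<in> sets borel" for y
  proof -
    have "(\<lambda>x::'a. (x, y)) \<in> borel_measurable borel"
      by (intro borel_measurable_continuous_onI continuous_intros)
    from measurable_sets[OF this A] show ?thesis by simp
  qed
  have "emeasure (distr lborel borel ?S) A = emeasure lborel (?S -` A)"
    using m A by (subst emeasure_distr) auto
  also have "\<dots> = (\<integral>\<^sup>+y. emeasure lborel ((\<lambda>x. (x, y)) -` (?S -` A)) \<partial>lborel)"
    using SA by (subst lborel_prod[symmetric], subst lborel_pair.emeasure_pair_measure_alt2)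
      (simp_all only: sets_lborel borel_prod sets_pair_measure_cong[OF sets_lborel sets_lborel])
  also have "\<dots> = (\<integral>\<^sup>+y. emeasure lborel ((\<lambda>x. (x, y)) -` A) \<partial>lborel)"
  proof (intro nn_integral_cong)
    fix y :: 'a
    have "(\<lambda>x. (x, y)) -` (?S -` A) = (\<lambda>x. x + k *\<^sub>R y) -` ((\<lambda>x. (x, y)) -` A)" by auto
    then show "emeasure lborel ((\<lambda>x. (x, y)) -` (?S -` A)) = emeasure lborel ((\<lambda>x. (x, y)) -` A)"
      using tr[OF sec] by simp
  qed
  also have "\<dots> = emeasure lborel A"
    using A by (subst lborel_prod[symmetric], subst lborel_pair.emeasure_pair_measure_alt2)
      (simp_all only: sets_lborel borel_prod sets_pair_measure_cong[OF sets_lborel sets_lborel])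
  finally show "emeasure (distr lborel borel ?S) A = emeasure lborel A" .
qed simp

lemma lborel_prod_swap:
  "distr lborel borel (\<lambda>(x, y). (y, x)) = (lborel :: ('a::euclidean_space \<times> 'b::euclidean_space) measure)"
proof -
  have b: "bij_betw (\<lambda>(x, y). (y, x)) (Basis :: ('b \<times> 'a) set) (Basis :: ('a \<times> 'b) set)"
    by (rule bij_betwI[where g = "\<lambda>(x, y). (y, x)"]) (auto simp: Basis_prod_def)
  have l: "linear (\<lambda>(x :: 'b, y :: 'a). (y, x))"
    by (rule linearI) (auto simp: case_prod_unfold)
  show ?thesis using lborel_distr_Basis_iso[OF l b] .
qed

lemma lborel_shear_snd:
  fixes k :: real
  shows "distr lborel borel (\<lambda>(x, y). (x, y + k *\<^sub>R x)) = (lborel :: ('a::euclidean_space \<times> 'a) measure)"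
proof -
  let ?w = "\<lambda>(x :: 'a, y :: 'a). (y, x)" and ?s = "\<lambda>(x :: 'a, y). (x + k *\<^sub>R y, y)"
  have [measurable]: "?w \<in> borel_measurable borel" "?s \<in> borel_measurable borel"
    by (intro borel_measurable_continuous_onI; auto intro!: continuous_intros simp: case_prod_unfold)+
  have "lborel = distr (distr (distr lborel borel ?w) borel ?s) borel ?w"
    by (simp add: lborel_prod_swap lborel_shear_fst)
  also have "\<dots> = distr lborel borel (\<lambda>(x, y). (x, y + k *\<^sub>R x))"
    by (subst distr_distr, simp, simp, subst distr_distr, simp, simp)
       (intro distr_cong; auto)
  finally show ?thesis ..
qed

text \<open>Separating real and imaginary parts turns multiplication by p + \<i> q into a rotation
  of the pair (x, y), which shears of the product space can express.\<close>

lemma complex_vec_lborel: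
  "distr lborel borel (\<lambda>(x, y). \<chi> j. Complex (x $ j) (y $ j)) = (lborel :: (complex^'d::finite) measure)"
proof -
  let ?T = "\<lambda>(x :: real^'d, y :: real^'d). (\<chi> j. Complex (x $ j) (y $ j)) :: complex^'d"
  have l: "linear ?T"
    by (rule linearI) (auto simp: vec_eq_iff complex_eq_iff)
  have e: "?T (axis j 1, 0) = axis j 1" "?T (0, axis j 1) = axis j \<i>" for j
    by (auto simp: vec_eq_iff complex_eq_iff axis_def)
  have inj: "inj ?T"
    by (auto simp: inj_def vec_eq_iff)
  have "?T ` Basis = Basis"
  proof -
    have "?T ` Basis = ?T ` ((\<lambda>j. (axis j 1, 0)) ` UNIV \<union> (\<lambda>j. (0, axis j 1)) ` UNIV)"
      by (rule arg_cong[of _ _ "(`) ?T"]) (auto simp: Basis_prod_def Basis_vec_def)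
    also have "\<dots> = (\<lambda>j. axis j 1) ` UNIV \<union> (\<lambda>j. axis j \<i>) ` UNIV"
      unfolding image_Un image_image e ..
    also have "\<dots> = (Basis :: (complex^'d) set)"
      by (auto simp: Basis_vec_def Basis_complex_def)
    finally show ?thesis .
  qed
  then have "bij_betw ?T Basis Basis"
    using inj by (auto simp: bij_betw_def intro: inj_on_subset)
  from lborel_distr_Basis_iso[OF l this] show ?thesis .
qed

text \<open>A rotation is a product of three shears, except the rotation by \<open>-1\<close>, which is the square
  of the rotation by \<open>\<i>\<close>.\<close>

lemma lborel_complex_rotation:
  fixes c :: complex
  assumes c: "norm c = 1"
  shows "distr lborel borel ((*s) c) = (lborel :: (complex^'d::finite) measure)"
proof -
  have cm[measurable]: "((*s) c :: complex^'d \<Rightarrow> _) \<in> borel_measurable borel" for c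
  proof (intro borel_measurable_continuous_onI)
    have "((*s) c :: complex^'d \<Rightarrow> _) = (\<lambda>z. \<chi> j. c * z $ j)"
      by (auto simp: vec_eq_iff)
    then show "continuous_on UNIV ((*s) c :: complex^'d \<Rightarrow> _)"
      by (auto intro!: continuous_intros)
  qed
  have *: "distr lborel borel ((*s) c) = (lborel :: (complex^'d) measure)"
    if c: "norm c = 1" "c \<noteq> -1" for c
  proof -
    define p q where "p = Re c" and "q = Im c"
    have pq: "p\<^sup>2 + q\<^sup>2 = 1" using c(1) by (simp add: p_def q_def cmod_def)
    have "p \<noteq> -1"
    proof
      assume "p = -1"
      with pq have "q = 0" by simp
      with \<open>p = -1\<close> c(2) show False by (simp add: p_def q_def complex_eq_iff)
    qed
    \<comment> \<open>For c = exp (\<i> \<theta>) this is tan (\<theta> / 2). The rotation is the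
      shear by \<open>-k\<close>, then by \<open>q\<close> = sin \<theta> in the other direction,
      then by \<open>-k\<close> again.\<close>
    define k where "k = q / (1 + p)"
    have k1: "k * q = 1 - p" and k2: "k * (1 + p) = q"
      using \<open>p \<noteq> -1\<close> pq unfolding k_def
      by (auto simp: field_simps power2_eq_square)
    let ?s = "\<lambda>(x :: real^'d, y). (x + (-k) *\<^sub>R y, y)" and ?t = "\<lambda>(x :: real^'d, y). (x, y + q *\<^sub>R x)"
    let ?T = "\<lambda>(x :: real^'d, y :: real^'d). (\<chi> j. Complex (x $ j) (y $ j)) :: complex^'d"
    have [measurable]: "?s \<in> borel_measurable borel" "?t \<in> borel_measurable borel"
      by (intro borel_measurable_continuous_onI; auto intro!: continuous_intros simp: case_prod_unfold)+
    have [measurable]: "?T \<in> borel_measurable borel"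
      unfolding Complex_eq case_prod_unfold
      by (intro borel_measurable_continuous_onI) (auto intro!: continuous_intros)
    have eq: "(*s) c (?T x) = ?T (?s (?t (?s x)))" for x
    proof -
      obtain a b where x: "x = (a, b)" by force
      have re: "p * u - q * v = (u + (-k) * v) + (-k) * (v + q * (u + (-k) * v))"
        and im: "p * v + q * u = v + q * (u + (-k) * v)" for u v
      proof -
        have "v + q * (u + (-k) * v) = v + q * u - (k * q) * v" by (simp add: algebra_simps)
        then show im: "p * v + q * u = v + q * (u + (-k) * v)" by (simp add: k1 algebra_simps)
        have "(u + (-k) * v) + (-k) * (p * v + q * u) = u - (k * (1 + p)) * v - (k * q) * u"
          by (simp add: algebra_simps)
        then show "p * u - q * v = (u + (-k) * v) + (-k) * (v + q * (u + (-k) * v))"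
          unfolding im[symmetric] k1 k2 by (simp add: algebra_simps)
      qed
      show ?thesis unfolding x
        by (auto simp: vec_eq_iff complex_eq_iff p_def[symmetric] q_def[symmetric]) (use re im in auto)
    qed
    have "distr lborel borel ((*s) c) = distr (distr lborel borel ?T) borel ((*s) c)"
      by (simp add: complex_vec_lborel)
    also have "\<dots> = distr lborel borel (\<lambda>x. ?T (?s (?t (?s x))))"
      by (subst distr_distr, simp, simp) (intro distr_cong; auto simp: eq)
    also have "\<dots> = distr (distr (distr (distr lborel borel ?s) borel ?t) borel ?s) borel ?T"
      by (subst distr_lborel_comp, measurable, subst distr_lborel_comp, measurable, subst distr_lborel_comp, measurable)
    also have "\<dots> = lborel"
      by (simp only: lborel_shear_fst lborel_shear_snd complex_vec_lborel)
    finally show ?thesis .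
  qed
  show ?thesis
  proof (cases "c = -1")
    case True
    have "lborel = distr (distr lborel borel ((*s) \<i>)) borel ((*s) \<i> :: complex^'d \<Rightarrow> _)"
      by (simp add: * complex_eq_iff)
    also have "\<dots> = distr lborel borel ((*s) c)"
      by (subst distr_distr, simp, simp) (intro distr_cong; auto simp: True vec_eq_iff)
    finally show ?thesis ..
  qed (use * c in auto)
qed

section \<open>Gaussian integrals and square integrable functions\<close>

lemma sets_gauss_measure [simp, measurable_cong]: "sets (gauss_measure \<nu>) = sets borel"
  by (simp add: gauss_measure_def)

lemma space_gauss_measure [simp]: "space (gauss_measure \<nu>) = UNIV"
  by (simp add: gauss_measure_def)

lemma integrable_gauss_measure:
  fixes f :: "'a::euclidean_space \<Rightarrow> 'b::{banach, second_countable_topology}"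
  assumes "f \<in> borel_measurable borel"
  shows "integrable (gauss_measure \<nu>) f \<longleftrightarrow> integrable lborel (\<lambda>x. exp (- \<nu> * (norm x)\<^sup>2) *\<^sub>R f x)"
  unfolding gauss_measure_def using assms by (subst integrable_density) auto

lemma integral_gauss_measure:
  fixes f :: "'a::euclidean_space \<Rightarrow> 'b::{banach, second_countable_topology}"
  assumes "f \<in> borel_measurable borel"
  shows "(LINT x|gauss_measure \<nu>. f x) = (LINT x|lborel. exp (- \<nu> * (norm x)\<^sup>2) *\<^sub>R f x)"
  unfolding gauss_measure_def using assms by (subst integral_density) auto

lemma gauss_measure_distr:
  assumes m: "T \<in> borel_measurable borel" and d: "distr lborel borel T = lborel"
    and n: "\<And>x. norm (T x) = norm x"
  shows "distr (gauss_measure \<nu>) borel T = gauss_measure \<nu>"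
proof -
  have "gauss_measure \<nu> = density (distr lborel borel T) (\<lambda>x. ennreal (exp (- \<nu> * (norm x)\<^sup>2)))"
    by (simp add: gauss_measure_def d)
  also have "\<dots> = distr (density lborel (\<lambda>x. ennreal (exp (- \<nu> * (norm (T x))\<^sup>2)))) borel T"
    using m by (subst density_distr) auto
  finally show ?thesis by (simp add: n gauss_measure_def)
qed

lemma gauss_measure_distr_Basis_iso:
  fixes T :: "'a::euclidean_space \<Rightarrow> 'b::euclidean_space"
  assumes "linear T" "bij_betw T Basis Basis"
  shows "distr (gauss_measure \<nu>) borel T = gauss_measure \<nu>"
proof (rule gauss_measure_distr)
  show "T \<in> borel_measurable borel"
    using assms(1) by (intro borel_measurable_continuous_onI linear_continuous_on) (simp add: linear_conv_bounded_linear)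
qed (auto simp: lborel_distr_Basis_iso[OF assms] norm_eq_sqrt_inner linear_Basis_iso_inner[OF assms])

text \<open>An affine substitution reduces the integral to the characteristic function of the
  standard normal distribution: completing the square absorbs \<open>Re c\<close> into the shift,
  and \<open>Im c\<close> becomes the frequency.\<close>

lemma gaussian_integral_real:
  fixes c :: complex
  assumes "\<nu> > 0"
  shows "has_bochner_integral lborel (\<lambda>x::real. exp (- of_real (\<nu> * x\<^sup>2) + c * of_real x))
    (of_real (sqrt (pi / \<nu>)) * exp (c\<^sup>2 / (4 * of_real \<nu>)))"
proof -
  define s where "s = sqrt (2 * \<nu>)"
  define p q where "p = Re c" and "q = Im c"
  have s: "s > 0" "s\<^sup>2 = 2 * \<nu>" using assms by (auto simp: s_def)
  \<comment> \<open>With y = s x - p / s, the constant \<open>k\<close> removes the normalisation of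
    the normal density and the factors free of x that the shift creates in modulus and
    phase.\<close>
  define k where "k = complex_of_real (sqrt (2 * pi)) * exp (of_real (p\<^sup>2 / (4 * \<nu>)) + \<i> * of_real (p * q / (2 * \<nu>)))"
  have 0: "has_bochner_integral lborel (\<lambda>y. std_normal_density y *\<^sub>R iexp (q / s * y))
      (complex_of_real (exp (- ((q / s)\<^sup>2) / 2)))"
  proof -
    have "integrable lborel (\<lambda>y. std_normal_density y *\<^sub>R iexp (q / s * y))"
    proof (rule Bochner_Integration.integrable_bound)
      show "integrable lborel std_normal_density" by (rule integrable_normal_density) simp
    qed auto
    moreover have "(LINT y|lborel. std_normal_density y *\<^sub>R iexp (q / s * y)) = exp (- ((q / s)\<^sup>2) / 2)"
      using fun_cong[OF char_std_normal_distribution, of "q / s"] unfolding char_def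
      by (subst (asm) integral_density) auto
    ultimately show ?thesis by (simp add: has_bochner_integral_iff)
  qed
  have "has_bochner_integral lborel (\<lambda>x. k * (std_normal_density (- (p / s) + s * x) *\<^sub>R iexp (q / s * (- (p / s) + s * x))))
      (k * (complex_of_real (exp (- ((q / s)\<^sup>2) / 2)) /\<^sub>R \<bar>s\<bar>))"
    using iffD1[OF lborel_has_bochner_integral_real_affine_iff 0, of s "- (p / s)"] s(1)
    by (intro has_bochner_integral_mult_right) simp_all
  also have "(\<lambda>x. k * (std_normal_density (- (p / s) + s * x) *\<^sub>R iexp (q / s * (- (p / s) + s * x)))) =
      (\<lambda>x. exp (- of_real (\<nu> * x\<^sup>2) + c * of_real x))"
  proof
    fix x
    have e1: "(- (p / s) + s * x)\<^sup>2 / 2 = p\<^sup>2 / (4 * \<nu>) - p * x + \<nu> * x\<^sup>2"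
    proof -
      have "(- (p / s) + s * x)\<^sup>2 = p\<^sup>2 / s\<^sup>2 - 2 * p * x + s\<^sup>2 * x\<^sup>2"
        using s(1) by (simp add: power2_eq_square field_simps)
      then show ?thesis by (simp add: s(2))
    qed
    have e2: "q / s * (- (p / s) + s * x) = - (p * q / (2 * \<nu>)) + q * x"
    proof -
      have "q / s * (- (p / s) + s * x) = - (p * q / s\<^sup>2) + q * x"
        using s(1) by (simp add: power2_eq_square field_simps)
      then show ?thesis by (simp add: s(2))
    qed
    have sd: "std_normal_density (- (p / s) + s * x) =
        1 / sqrt (2 * pi) * exp (- (p\<^sup>2 / (4 * \<nu>) - p * x + \<nu> * x\<^sup>2))"
      unfolding e1[symmetric] by (simp add: std_normal_density_def)
    have "k * (std_normal_density (- (p / s) + s * x) *\<^sub>R iexp (q / s * (- (p / s) + s * x))) =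
      exp (of_real (p\<^sup>2 / (4 * \<nu>)) + \<i> * of_real (p * q / (2 * \<nu>))) *
      (exp (of_real (- (p\<^sup>2 / (4 * \<nu>) - p * x + \<nu> * x\<^sup>2))) * exp (\<i> * of_real (- (p * q / (2 * \<nu>)) + q * x)))"
      unfolding k_def sd e2 scaleR_conv_of_real of_real_mult exp_of_real by simp
    also have "\<dots> = exp (- of_real (\<nu> * x\<^sup>2) + c * of_real x)"
      unfolding exp_add[symmetric]
      by (rule arg_cong[of _ _ exp]) (simp add: complex_eq_iff p_def q_def)
    finally show "k * (std_normal_density (- (p / s) + s * x) *\<^sub>R iexp (q / s * (- (p / s) + s * x))) =
      exp (- of_real (\<nu> * x\<^sup>2) + c * of_real x)" .
  qed
  also have "k * (complex_of_real (exp (- ((q / s)\<^sup>2) / 2)) /\<^sub>R \<bar>s\<bar>) =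
      of_real (sqrt (pi / \<nu>)) * exp (c\<^sup>2 / (4 * of_real \<nu>))"
  proof -
    have a: "sqrt (2 * pi) / s = sqrt (pi / \<nu>)" by (simp add: s_def real_sqrt_divide real_sqrt_mult)
    have b: "(q / s)\<^sup>2 / 2 = q\<^sup>2 / (4 * \<nu>)" using s by (simp add: power_divide)
    have "k * (complex_of_real (exp (- ((q / s)\<^sup>2) / 2)) /\<^sub>R \<bar>s\<bar>) =
      of_real (sqrt (2 * pi) / s) * (exp (of_real (p\<^sup>2 / (4 * \<nu>)) + \<i> * of_real (p * q / (2 * \<nu>))) *
        exp (of_real (- (q\<^sup>2 / (4 * \<nu>)))))"
    proof -
      have e: "complex_of_real (exp (- ((q / s)\<^sup>2) / 2)) = exp (of_real (- (q\<^sup>2 / (4 * \<nu>))))"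
        unfolding exp_of_real minus_divide_left[symmetric] b ..
      have "of_real u * w * (y /\<^sub>R \<bar>s\<bar>) = of_real (u / s) * (w * y)" for u and w y :: complex
        using s(1) by (simp add: scaleR_conv_of_real divide_inverse)
      then show ?thesis unfolding k_def e .
    qed
    also have "exp (of_real (p\<^sup>2 / (4 * \<nu>)) + \<i> * of_real (p * q / (2 * \<nu>))) *
        exp (of_real (- (q\<^sup>2 / (4 * \<nu>)))) = exp (c\<^sup>2 / (4 * of_real \<nu>))"
      unfolding exp_add[symmetric]
    proof (rule arg_cong[of _ _ exp])
      have "c = of_real p + \<i> * of_real q" by (simp add: p_def q_def complex_eq)
      then have "c\<^sup>2 = of_real (p\<^sup>2 - q\<^sup>2) + \<i> * of_real (2 * p * q)"
        by (simp add: power2_eq_square algebra_simps)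
      then show "of_real (p\<^sup>2 / (4 * \<nu>)) + \<i> * of_real (p * q / (2 * \<nu>)) + of_real (- (q\<^sup>2 / (4 * \<nu>))) = c\<^sup>2 / (4 * of_real \<nu>)"
        by (simp add: add_divide_distrib diff_divide_distrib)
    qed
    finally show ?thesis unfolding a .
  qed
  finally show ?thesis .
qed

lemma has_bochner_integral_lborel_prod:
  fixes f :: "'a::euclidean_space \<Rightarrow> real \<Rightarrow> complex"
  assumes "\<And>b. b \<in> Basis \<Longrightarrow> has_bochner_integral lborel (f b) (I b)"
  shows "has_bochner_integral lborel (\<lambda>x::'a. \<Prod>b\<in>Basis. f b (x \<bullet> b)) (\<Prod>b\<in>Basis. I b)"
proof -
  interpret product_sigma_finite "\<lambda>_::'a. lborel :: real measure" ..
  let ?e = "\<lambda>g. \<Sum>b\<in>Basis. g b *\<^sub>R b :: 'a"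
  have i: "integrable lborel (f b)" and I: "integral\<^sup>L lborel (f b) = I b" if "b \<in> Basis" for b
    using assms[OF that] by (auto simp: has_bochner_integral_iff)
  have fm: "f b \<in> borel_measurable borel" if "b \<in> Basis" for b
    using borel_measurable_integrable[OF i[OF that]] by simp
  have e: "(\<Prod>b\<in>Basis. f b (?e g \<bullet> b)) = (\<Prod>b\<in>Basis. f b (g b))" for g
    by (intro prod.cong refl) (simp add: inner_sum_left_Basis)
  have m: "?e \<in> borel_measurable (\<Pi>\<^sub>M b\<in>Basis. lborel)"
    by measurable
  have m2: "(\<lambda>x::'a. \<Prod>b\<in>Basis. f b (x \<bullet> b)) \<in> borel_measurable borel"
    by (intro borel_measurable_prod measurable_compose[OF _ fm]) measurable
  have "integrable (\<Pi>\<^sub>M b\<in>Basis. lborel) (\<lambda>g. \<Prod>b\<in>(Basis::'a set). f b (g b))"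
    using i by (intro product_integrable_prod) auto
  then have 1: "integrable lborel (\<lambda>x::'a. \<Prod>b\<in>Basis. f b (x \<bullet> b))"
    by (subst lborel_eq) (simp add: integrable_distr_eq[OF m m2] e)
  have "(\<integral>g. (\<Prod>b\<in>(Basis::'a set). f b (g b)) \<partial>(\<Pi>\<^sub>M b\<in>Basis. lborel)) = (\<Prod>b\<in>Basis. I b)"
    using i I by (subst product_integral_prod) auto
  then have 2: "(\<integral>x. (\<Prod>b\<in>Basis. f b (x \<bullet> b)) \<partial>(lborel :: 'a measure)) = (\<Prod>b\<in>Basis. I b)"
    by (subst lborel_eq) (simp add: integral_distr[OF m m2] e)
  show ?thesis using 1 2 by (simp add: has_bochner_integral_iff)
qed

text \<open>Source of the explicit Gaussian integrals below: the total mass (c = 0), the norm of the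
  Fock kernel and the pairing of two Segal-Bargmann kernels.\<close>

lemma gauss_measure_exp_linear:
  fixes c :: "'a::euclidean_space \<Rightarrow> complex"
  assumes "\<nu> > 0"
  shows "has_bochner_integral (gauss_measure \<nu>) (\<lambda>x::'a. exp (\<Sum>b\<in>Basis. c b * of_real (x \<bullet> b)))
    (of_real (sqrt (pi / \<nu>) ^ DIM('a)) * exp (\<Sum>b\<in>Basis. (c b)\<^sup>2 / (4 * of_real \<nu>)))"
proof -
  have "has_bochner_integral lborel (\<lambda>x::'a. \<Prod>b\<in>Basis. exp (- of_real (\<nu> * (x \<bullet> b)\<^sup>2) + c b * of_real (x \<bullet> b)))
     (\<Prod>b\<in>(Basis::'a set). of_real (sqrt (pi / \<nu>)) * exp ((c b)\<^sup>2 / (4 * of_real \<nu>)))"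
    by (intro has_bochner_integral_lborel_prod gaussian_integral_real assms)
  also have "(\<lambda>x::'a. \<Prod>b\<in>Basis. exp (- of_real (\<nu> * (x \<bullet> b)\<^sup>2) + c b * of_real (x \<bullet> b))) =
     (\<lambda>x. exp (- \<nu> * (norm x)\<^sup>2) *\<^sub>R exp (\<Sum>b\<in>Basis. c b * of_real (x \<bullet> b)))"
  proof
    fix x :: 'a
    have n: "(norm x)\<^sup>2 = (\<Sum>b\<in>Basis. (x \<bullet> b)\<^sup>2)"
      unfolding power2_norm_eq_inner by (subst euclidean_inner) (simp add: power2_eq_square)
    show "(\<Prod>b\<in>Basis. exp (- of_real (\<nu> * (x \<bullet> b)\<^sup>2) + c b * of_real (x \<bullet> b))) =
     exp (- \<nu> * (norm x)\<^sup>2) *\<^sub>R exp (\<Sum>b\<in>Basis. c b * of_real (x \<bullet> b))"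
      unfolding scaleR_conv_of_real exp_of_real[symmetric] exp_sum[OF finite_Basis, symmetric] exp_add[symmetric] n
      by (rule arg_cong[of _ _ exp]) (simp add: sum.distrib sum_subtractf sum_negf sum_distrib_left)
  qed
  also have "(\<Prod>b\<in>(Basis::'a set). of_real (sqrt (pi / \<nu>)) * exp ((c b)\<^sup>2 / (4 * of_real \<nu>))) =
     of_real (sqrt (pi / \<nu>) ^ DIM('a)) * exp (\<Sum>b\<in>Basis. (c b)\<^sup>2 / (4 * of_real \<nu>))"
    by (simp add: prod.distrib exp_sum)
  finally show ?thesis
    by (auto simp: has_bochner_integral_iff integrable_gauss_measure integral_gauss_measure)
qed

text \<open>The integrand only replaces the parameter \<nu> of the weight by \<nu> - a, whose total
  mass is finite.\<close>

lemma integrable_gauss_measure_exp: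
  fixes a :: real
  assumes "a < \<nu>"
  shows "integrable (gauss_measure \<nu>) (\<lambda>x::'a::euclidean_space. exp (a * (norm x)\<^sup>2))"
proof -
  have "integrable (gauss_measure (\<nu> - a)) (\<lambda>x::'a. 1 :: complex)"
    using gauss_measure_exp_linear[of "\<nu> - a" "\<lambda>_::'a. 0"] assms by (simp add: has_bochner_integral_iff)
  then have "integrable lborel (\<lambda>x::'a. complex_of_real (exp (- (\<nu> - a) * (norm x)\<^sup>2)))"
    by (subst (asm) integrable_gauss_measure) (auto simp: scaleR_conv_of_real)
  then have "integrable lborel (\<lambda>x::'a. exp (- (\<nu> - a) * (norm x)\<^sup>2))"
    using integrable_Re by fastforce
  then show ?thesis
    by (subst integrable_gauss_measure) (auto simp: exp_add[symmetric] algebra_simps)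
qed

lemma finite_measure_gauss:
  assumes "\<nu> > 0"
  shows "finite_measure (gauss_measure \<nu> :: 'a::euclidean_space measure)"
proof -
  have "integrable (gauss_measure \<nu> :: 'a measure) (\<lambda>_. 1 :: real)"
    using integrable_gauss_measure_exp[of 0 \<nu>] assms by simp
  then have "emeasure (gauss_measure \<nu> :: 'a measure) UNIV < \<infinity>"
    by (auto simp: integrable_iff_bounded)
  then show ?thesis by (intro finite_measureI) auto
qed

section \<open>Square integrable functions over a general measure\<close>

definition sq_integrable :: "'a measure \<Rightarrow> ('a \<Rightarrow> complex) \<Rightarrow> bool"
  where "sq_integrable M f \<longleftrightarrow> f \<in> borel_measurable M \<and> integrable M (\<lambda>x. (norm (f x))\<^sup>2)"

lemma gauss_L2_iff: "f \<in> gauss_L2 \<nu> \<longleftrightarrow> sq_integrable (gauss_measure \<nu>) f"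
  by (simp add: gauss_L2_def sq_integrable_def measurable_cong_sets[OF sets_gauss_measure refl])

lemma sq_integrable_gauss_measurable: "sq_integrable (gauss_measure \<nu>) f \<Longrightarrow> f \<in> borel_measurable borel"
  by (simp add: sq_integrable_def measurable_cong_sets[OF sets_gauss_measure refl])

lemma sq_integrable_cmult: "sq_integrable M f \<Longrightarrow> sq_integrable M (\<lambda>x. c * f x)"
  by (auto simp: sq_integrable_def norm_mult power_mult_distrib)

lemma measurable_cnj:
  assumes "f \<in> borel_measurable M"
  shows "(\<lambda>x. cnj (f x)) \<in> borel_measurable M"
  by (rule borel_measurable_continuous_on[OF _ assms]) (intro continuous_intros)

lemma sq_integrable_cnj: "sq_integrable M f \<Longrightarrow> sq_integrable M (\<lambda>x. cnj (f x))"
  by (auto simp: sq_integrable_def measurable_cnj)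

lemma norm_add_power2_le: "(norm (a + b))\<^sup>2 \<le> 2 * (norm a)\<^sup>2 + 2 * (norm (b :: 'a :: real_normed_vector))\<^sup>2"
proof -
  have "(norm (a + b))\<^sup>2 \<le> (norm a + norm b)\<^sup>2" by (intro power_mono norm_triangle_ineq) auto
  also have "\<dots> \<le> 2 * (norm a)\<^sup>2 + 2 * (norm b)\<^sup>2"
    using zero_le_power2[of "norm a - norm b"] by (simp add: power2_eq_square algebra_simps)
  finally show ?thesis .
qed

lemma sq_integrable_add:
  assumes "sq_integrable M f" "sq_integrable M g"
  shows "sq_integrable M (\<lambda>x. f x + g x)"
proof -
  have [measurable]: "f \<in> borel_measurable M" "g \<in> borel_measurable M"
    using assms by (auto simp: sq_integrable_def)
  have "integrable M (\<lambda>x. (norm (f x + g x))\<^sup>2)"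
  proof (rule Bochner_Integration.integrable_bound)
    show "integrable M (\<lambda>x. 2 * (norm (f x))\<^sup>2 + 2 * (norm (g x))\<^sup>2)"
      using assms by (auto simp: sq_integrable_def)
  qed (auto intro!: AE_I2 norm_add_power2_le)
  then show ?thesis by (auto simp: sq_integrable_def)
qed

lemma sq_integrable_diff:
  assumes "sq_integrable M f" "sq_integrable M g"
  shows "sq_integrable M (\<lambda>x. f x - g x)"
  using sq_integrable_add[OF assms(1) sq_integrable_cmult[OF assms(2), of "-1"]] by simp

lemma sq_integrable_mult:
  assumes "sq_integrable M f" "sq_integrable M g"
  shows "integrable M (\<lambda>x. f x * g x)"
proof (rule Bochner_Integration.integrable_bound)
  show "integrable M (\<lambda>x. (norm (f x))\<^sup>2 + (norm (g x))\<^sup>2)"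
    using assms by (auto simp: sq_integrable_def)
  show "(\<lambda>x. f x * g x) \<in> borel_measurable M"
    using assms by (auto simp: sq_integrable_def)
  have "norm a * norm b \<le> (norm a)\<^sup>2 + (norm b)\<^sup>2" for a b :: complex
  proof -
    have "2 * (norm a * norm b) \<le> (norm a)\<^sup>2 + (norm b)\<^sup>2"
      using zero_le_power2[of "norm a - norm b"] by (simp add: power2_eq_square algebra_simps)
    moreover have "0 \<le> norm a * norm b" by simp
    ultimately show ?thesis by linarith
  qed
  then show "AE x in M. norm (f x * g x) \<le> norm ((norm (f x))\<^sup>2 + (norm (g x))\<^sup>2)"
    by (auto simp: norm_mult)
qed

lemma sq_integrable_Cauchy_Schwarz:
  assumes "sq_integrable M f" "sq_integrable M g"
  shows "(norm (LINT x|M. f x * g x))\<^sup>2 \<le> (LINT x|M. (norm (f x))\<^sup>2) * (LINT x|M. (norm (g x))\<^sup>2)"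
proof -
  have [measurable]: "f \<in> borel_measurable M" "g \<in> borel_measurable M"
    and i: "integrable M (\<lambda>x. (norm (f x))\<^sup>2)" "integrable M (\<lambda>x. (norm (g x))\<^sup>2)"
    using assms by (auto simp: sq_integrable_def)
  have n: "integrable M (\<lambda>x. norm (f x) * norm (g x))"
    using integrable_norm[OF sq_integrable_mult[OF assms]] by (simp add: norm_mult)
  have "(\<integral>\<^sup>+x. ennreal (norm (f x)) * ennreal (norm (g x)) \<partial>M)\<^sup>2 \<le>
      (\<integral>\<^sup>+x. (ennreal (norm (f x)))\<^sup>2 \<partial>M) * (\<integral>\<^sup>+x. (ennreal (norm (g x)))\<^sup>2 \<partial>M)"
    by (rule Cauchy_Schwarz_nn_integral) measurable
  then have "(ennreal (LINT x|M. norm (f x) * norm (g x)))\<^sup>2 \<le>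
      ennreal (LINT x|M. (norm (f x))\<^sup>2) * ennreal (LINT x|M. (norm (g x))\<^sup>2)"
    by (simp add: ennreal_mult[symmetric] ennreal_power nn_integral_eq_integral n i)
  then have 1: "(LINT x|M. norm (f x) * norm (g x))\<^sup>2 \<le> (LINT x|M. (norm (f x))\<^sup>2) * (LINT x|M. (norm (g x))\<^sup>2)"
    by (subst (asm) ennreal_mult[symmetric], simp, simp, subst (asm) ennreal_power, simp, subst (asm) ennreal_le_iff) auto
  have "norm (LINT x|M. f x * g x) \<le> (LINT x|M. norm (f x) * norm (g x))"
    using integral_norm_bound[of M "\<lambda>x. f x * g x"] by (simp add: norm_mult)
  then have "(norm (LINT x|M. f x * g x))\<^sup>2 \<le> (LINT x|M. norm (f x) * norm (g x))\<^sup>2"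
    by (intro power_mono) auto
  with 1 show ?thesis by linarith
qed

text \<open>Completeness for rapidly Cauchy sequences. On a finite measure space Cauchy-Schwarz
  against the constant 1 turns the rate (1 / 4) ^ n for squared norms into the rate (1 / 2) ^ n in
  L1, which is summable; hence the sequence converges almost everywhere. Fatou's lemma then carries
  the L2 rate over to the limit.\<close>

lemma (in finite_measure) sq_integrable_complete:
  fixes f :: "nat \<Rightarrow> 'a \<Rightarrow> complex"
  assumes f: "\<And>n. sq_integrable M (f n)"
    and C: "\<And>m n. n \<le> m \<Longrightarrow> (LINT x|M. (norm (f n x - f m x))\<^sup>2) \<le> (1 / 4) ^ n"
  obtains g where "sq_integrable M g" "(\<lambda>n. LINT x|M. (norm (f n x - g x))\<^sup>2) \<longlonglongrightarrow> 0"
proof -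
  have [measurable]: "f n \<in> borel_measurable M" for n
    using f by (auto simp: sq_integrable_def)
  have d: "sq_integrable M (\<lambda>x. f n x - f m x)" for n m
    by (rule sq_integrable_diff[OF f f])
  have one: "sq_integrable M (\<lambda>_. 1)" by (simp add: sq_integrable_def)
  have na: "sq_integrable M (\<lambda>x. of_real (norm (f n x - f (Suc n) x)))" for n
  proof -
    have "(\<lambda>x. complex_of_real (norm (f n x - f (Suc n) x))) \<in> borel_measurable M" by measurable
    with d[of n "Suc n"] show ?thesis by (simp add: sq_integrable_def)
  qed
  define K where "K = sqrt (measure M (space M))"
  have b: "(\<integral>\<^sup>+x. ennreal (norm (f n x - f (Suc n) x)) \<partial>M) \<le> ennreal (K * (1 / 2) ^ n)" for n
  proof -
    have i: "integrable M (\<lambda>x. norm (f n x - f (Suc n) x))"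
      using integrable_norm[OF sq_integrable_mult[OF d one], of n "Suc n"] by simp
    have "(norm (LINT x|M. complex_of_real (norm (f n x - f (Suc n) x)) * 1))\<^sup>2 \<le>
        (LINT x|M. (norm (complex_of_real (norm (f n x - f (Suc n) x))))\<^sup>2) * (LINT x|M. (norm (1::complex))\<^sup>2)"
      by (rule sq_integrable_Cauchy_Schwarz[OF na one])
    then have "(LINT x|M. norm (f n x - f (Suc n) x))\<^sup>2 \<le> (LINT x|M. (norm (f n x - f (Suc n) x))\<^sup>2) * measure M (space M)"
      by simp
    also have "\<dots> \<le> (1 / 4) ^ n * measure M (space M)"
      by (intro mult_right_mono C) auto
    also have "\<dots> = (K * (1 / 2) ^ n)\<^sup>2"
    proof -
      have "((1 / 2 :: real) ^ n)\<^sup>2 = ((1 / 2)\<^sup>2) ^ n"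
        by (simp only: power_mult[symmetric] mult.commute)
      also have "\<dots> = (1 / 4) ^ n" by (simp add: power2_eq_square)
      finally show ?thesis unfolding K_def power_mult_distrib by simp
    qed
    finally have "(LINT x|M. norm (f n x - f (Suc n) x)) \<le> K * (1 / 2) ^ n"
      by (rule power2_le_imp_le) (simp add: K_def)
    then show ?thesis by (subst nn_integral_eq_integral[OF i]) (auto intro: ennreal_leI)
  qed
  have "(\<integral>\<^sup>+x. (\<Sum>n. ennreal (norm (f n x - f (Suc n) x))) \<partial>M) = (\<Sum>n. \<integral>\<^sup>+x. ennreal (norm (f n x - f (Suc n) x)) \<partial>M)"
    by (rule nn_integral_suminf) measurable
  also have "\<dots> \<le> (\<Sum>n. ennreal (K * (1 / 2) ^ n))"
    by (intro suminf_le b) auto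
  also have "\<dots> = ennreal (\<Sum>n. K * (1 / 2) ^ n)"
    by (intro suminf_ennreal2 summable_mult summable_geometric) (auto simp: K_def)
  finally have "(\<integral>\<^sup>+x. (\<Sum>n. ennreal (norm (f n x - f (Suc n) x))) \<partial>M) \<noteq> \<infinity>"
    by (auto simp: top_unique)
  then have "AE x in M. (\<Sum>n. ennreal (norm (f n x - f (Suc n) x))) \<noteq> \<infinity>"
    by (intro nn_integral_noteq_infinite) measurable
  then have conv: "AE x in M. (\<lambda>n. f n x) \<longlonglongrightarrow> lim (\<lambda>n. f n x)"
  proof eventually_elim
    case (elim x)
    then have "summable (\<lambda>n. norm (f n x - f (Suc n) x))"
      by (intro summable_suminf_not_top) auto
    then have "summable (\<lambda>n. f (Suc n) x - f n x)"
      using summable_minus[OF summable_norm_cancel] by fastforce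
    then have "convergent (\<lambda>n. \<Sum>i<n. f (Suc i) x - f i x)"
      by (simp add: summable_iff_convergent)
    then have "convergent (\<lambda>n. f n x - f 0 x)"
      by (simp add: sum_lessThan_telescope[of "\<lambda>i. f i x"])
    then have "convergent (\<lambda>n. f n x)"
      using convergent_diff_const_right_iff[of "\<lambda>n. f n x" "f 0 x"] by simp
    then show ?case by (simp add: convergent_LIMSEQ_iff)
  qed
  \<comment> \<open>Where the sequence diverges, \<open>lim\<close> is an unspecified value; these
    points form a null set, and \<open>g\<close> is measurable everywhere.\<close>
  define g where "g = (\<lambda>x. lim (\<lambda>n. f n x))"
  have [measurable]: "g \<in> borel_measurable M"
    unfolding g_def by measurable
  have fat: "(\<integral>\<^sup>+x. ennreal ((norm (f n x - g x))\<^sup>2) \<partial>M) \<le> ennreal ((1 / 4) ^ n)" for n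
  proof -
    have "(\<integral>\<^sup>+x. ennreal ((norm (f n x - g x))\<^sup>2) \<partial>M) = (\<integral>\<^sup>+x. liminf (\<lambda>m. ennreal ((norm (f n x - f m x))\<^sup>2)) \<partial>M)"
    proof (rule nn_integral_cong_AE)
      show "AE x in M. ennreal ((norm (f n x - g x))\<^sup>2) = liminf (\<lambda>m. ennreal ((norm (f n x - f m x))\<^sup>2))"
        using conv
      proof eventually_elim
        case (elim x)
        have "(\<lambda>m. ennreal ((norm (f n x - f m x))\<^sup>2)) \<longlonglongrightarrow> ennreal ((norm (f n x - g x))\<^sup>2)"
          unfolding g_def by (intro tendsto_intros tendsto_ennrealI elim)
        then show ?case by (intro lim_imp_Liminf[symmetric]) auto
      qed
    qed
    also have "\<dots> \<le> liminf (\<lambda>m. \<integral>\<^sup>+x. ennreal ((norm (f n x - f m x))\<^sup>2) \<partial>M)"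
      by (rule nn_integral_liminf) measurable
    also have "\<dots> \<le> liminf (\<lambda>m. ennreal ((1 / 4) ^ n))"
    proof (rule Liminf_mono, rule eventually_sequentiallyI[of n])
      fix m assume "n \<le> m"
      then show "(\<integral>\<^sup>+x. ennreal ((norm (f n x - f m x))\<^sup>2) \<partial>M) \<le> ennreal ((1 / 4) ^ n)"
        using d[of n m] C by (subst nn_integral_eq_integral) (auto simp: sq_integrable_def intro!: ennreal_leI)
    qed
    finally show ?thesis by (simp add: Liminf_const)
  qed
  have dg: "sq_integrable M (\<lambda>x. f n x - g x)" for n
    using le_less_trans[OF fat[of n] ennreal_less_top] by (auto simp: sq_integrable_def integrable_iff_bounded)
  have "sq_integrable M g"
    using sq_integrable_diff[OF f dg, of 0 0] by simp
  moreover have "(\<lambda>n. LINT x|M. (norm (f n x - g x))\<^sup>2) \<longlonglongrightarrow> 0"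
  proof (rule tendsto_sandwich[of "\<lambda>_. 0" _ _ "\<lambda>n. (1 / 4) ^ n"])
    have "(LINT x|M. (norm (f n x - g x))\<^sup>2) \<le> (1 / 4) ^ n" for n
      using fat[of n] dg[of n] by (subst (asm) nn_integral_eq_integral) (auto simp: sq_integrable_def)
    then show "\<forall>\<^sub>F n in sequentially. (LINT x|M. (norm (f n x - g x))\<^sup>2) \<le> (1 / 4) ^ n" by simp
  qed (auto intro!: LIMSEQ_power_zero)
  ultimately show ?thesis using that by blast
qed

section \<open>The reproducing kernel of the Bargmann-Fock space\<close>

lemma holomorphic_Cn_continuous: "holomorphic_Cn F \<Longrightarrow> continuous_on A F"
  unfolding holomorphic_Cn_def
  by (meson continuous_at_imp_continuous_on has_derivative_continuous)

lemma holomorphic_Cn_measurable: "holomorphic_Cn F \<Longrightarrow> F \<in> borel_measurable borel"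
  by (intro borel_measurable_continuous_onI holomorphic_Cn_continuous)

lemma bounded_linear_vec_scale: "bounded_linear (\<lambda>v :: complex^'d. c *s v)"
  unfolding linear_conv_bounded_linear[symmetric]
  by (rule linearI) (auto simp: vec_eq_iff algebra_simps)

lemma bounded_linear_vec_scale_left: "bounded_linear (\<lambda>c. c *s (v :: complex^'d))"
  unfolding linear_conv_bounded_linear[symmetric]
  by (rule linearI) (auto simp: vec_eq_iff algebra_simps)

lemma bounded_linear_vec_sum: "bounded_linear (\<lambda>z :: complex^'d. \<Sum>j\<in>UNIV. a j * z $ j)"
  unfolding linear_conv_bounded_linear[symmetric]
  by (rule linearI) (auto simp: algebra_simps sum.distrib scaleR_sum_right)

lemma holomorphic_Cn_affine:
  assumes "holomorphic_Cn F"
  shows "holomorphic_Cn (\<lambda>z. F (w + c *s z))"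
  unfolding holomorphic_Cn_def
proof
  fix z
  obtain D where D: "(F has_derivative D) (at (w + c *s z))" "\<And>c v. D (c *s v) = c * D v"
    using assms unfolding holomorphic_Cn_def by blast
  have "((\<lambda>z. F (w + c *s z)) has_derivative (\<lambda>v. D (c *s v))) (at z)"
    by (rule has_derivative_compose[of "\<lambda>z. w + c *s z" "\<lambda>v. c *s v", OF _ D(1)])
      (auto intro!: derivative_eq_intros bounded_linear.has_derivative[OF bounded_linear_vec_scale])
  then show "\<exists>D. ((\<lambda>z. F (w + c *s z)) has_derivative D) (at z) \<and> (\<forall>c v. D (c *s v) = c * D v)"
    using D(2) by (intro exI[of _ "\<lambda>v. D (c *s v)"]) (auto simp: algebra_simps)
qed

text \<open>The bridge to one-variable theory: it carries Cauchy's formula to \<complex>^d and gives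
  the holomorphy of F o \<open>psi2\<close>.\<close>

lemma holomorphic_Cn_line:
  assumes "holomorphic_Cn F"
  shows "(\<lambda>c. F (w + c *s v)) holomorphic_on A"
proof (rule holomorphic_onI)
  fix c
  obtain D where D: "(F has_derivative D) (at (w + c *s v))" "\<And>c v. D (c *s v) = c * D v"
    using assms unfolding holomorphic_Cn_def by blast
  have "((\<lambda>c. F (w + c *s v)) has_derivative (\<lambda>h. D (h *s v))) (at c)"
    by (rule has_derivative_compose[of "\<lambda>c. w + c *s v" "\<lambda>h. h *s v", OF _ D(1)])
      (auto intro!: derivative_eq_intros bounded_linear.has_derivative[OF bounded_linear_vec_scale_left])
  then have "((\<lambda>c. F (w + c *s v)) has_field_derivative D v) (at c)"
    by (simp add: has_field_derivative_def D(2) mult.commute[of _ "D v"])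
  then show "(\<lambda>c. F (w + c *s v)) field_differentiable at c within A"
    using field_differentiable_at_within field_differentiable_def by blast
qed

lemma holomorphic_Cn_mult:
  assumes "holomorphic_Cn F" "holomorphic_Cn G"
  shows "holomorphic_Cn (\<lambda>z. F z * G z)"
  unfolding holomorphic_Cn_def
proof
  fix z
  obtain D where D: "(F has_derivative D) (at z)" "\<And>c v. D (c *s v) = c * D v"
    using assms unfolding holomorphic_Cn_def by blast
  obtain E where E: "(G has_derivative E) (at z)" "\<And>c v. E (c *s v) = c * E v"
    using assms unfolding holomorphic_Cn_def by blast
  show "\<exists>D. ((\<lambda>z. F z * G z) has_derivative D) (at z) \<and> (\<forall>c v. D (c *s v) = c * D v)"
    using has_derivative_mult[OF D(1) E(1)]
    by (intro exI[of _ "\<lambda>h. F z * E h + D h * G z"]) (auto simp: D E algebra_simps)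
qed

lemma holomorphic_Cn_comp:
  assumes "f holomorphic_on UNIV" "bounded_linear L" "\<And>c v. L (c *s v) = c * L v"
  shows "holomorphic_Cn (\<lambda>z. f (L z))"
  unfolding holomorphic_Cn_def
proof
  fix z
  have f: "(f has_field_derivative deriv f (L z)) (at (L z))"
    using assms(1) by (simp add: holomorphic_derivI)
  have "((\<lambda>z. f (L z)) has_derivative (\<lambda>v. deriv f (L z) * L v)) (at z)"
    using has_derivative_compose[OF bounded_linear_imp_has_derivative[OF assms(2)] f[unfolded has_field_derivative_def]]
    by simp
  then show "\<exists>D. ((\<lambda>z. f (L z)) has_derivative D) (at z) \<and> (\<forall>c v. D (c *s v) = c * D v)"
    using assms(3) by (intro exI[of _ "\<lambda>v. deriv f (L z) * L v"]) (auto simp: algebra_simps)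
qed

lemma holomorphic_Cn_exp_linear: "holomorphic_Cn (\<lambda>z :: complex^'d. exp (\<Sum>j\<in>UNIV. a j * z $ j))"
  by (rule holomorphic_Cn_comp[OF _ bounded_linear_vec_sum])
    (auto intro: holomorphic_intros simp: sum_distrib_left algebra_simps)

text \<open>Cauchy's formula at the centre of the unit circle: the derivative of the parametrisation
  is 2 pi \<i> times the point itself and cancels the denominator.\<close>

lemma circle_mean_value:
  assumes "g holomorphic_on UNIV"
  shows "((\<lambda>t. g (exp (2 * of_real pi * \<i> * of_real t))) has_integral g 0) {0..1}"
proof -
  have "((\<lambda>u. g u / (u - 0)) has_contour_integral (2 * of_real pi * \<i>) * g 0) (circlepath 0 1)"
    by (rule Cauchy_integral_circlepath) (auto intro: holomorphic_on_subset[OF assms] holomorphic_on_imp_continuous_on)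
  then have "((\<lambda>t. g (exp (2 * of_real pi * \<i> * of_real t)) * (2 * of_real pi * \<i>)) has_integral (2 * of_real pi * \<i>) * g 0) {0..1}"
    unfolding has_contour_integral
    by (rule has_integral_eq[rotated])
      (auto simp: vector_derivative_circlepath01 vector_derivative_circlepath; simp add: circlepath)
  from has_integral_mult_left[OF this, of "inverse (2 * of_real pi * \<i>)"]
  show ?thesis by (simp add: field_simps)
qed

lemma gauss_measure_complex_rotation:
  fixes c :: complex
  assumes "norm c = 1"
  shows "distr (gauss_measure \<nu>) borel ((*s) c) = (gauss_measure \<nu> :: (complex^'d) measure)"
proof (rule gauss_measure_distr)
  show "((*s) c :: complex^'d \<Rightarrow> _) \<in> borel_measurable borel"
    by (intro borel_measurable_continuous_onI linear_continuous_on bounded_linear_vec_scale)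
  show "norm (c *s x) = norm x" for x :: "complex^'d"
    using assms by (simp add: norm_vec_def norm_mult)
qed (rule lborel_complex_rotation[OF assms])

text \<open>The measure is invariant under \<open>z \<mapsto> exp (2 \<pi> \<i> t) z\<close>; averaging over \<open>t\<close> first, the mean value
  property on the complex line through \<open>z\<close> turns the integrand into the constant \<open>F 0\<close>.\<close>

lemma gauss_measure_mean_value:
  fixes F :: "complex^'d \<Rightarrow> complex"
  assumes \<nu>: "\<nu> > 0" and hol: "holomorphic_Cn F" and int: "integrable (gauss_measure \<nu>) F"
  shows "(LINT z|gauss_measure \<nu>. F z) = of_real ((pi / \<nu>) ^ CARD('d)) * F 0"
proof -
  let ?\<mu> = "gauss_measure \<nu> :: (complex^'d) measure"
  define e where "e t = exp (2 * of_real pi * \<i> * of_real t)" for t :: real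
  have ne: "norm (e t) = 1" for t by (simp add: e_def norm_exp)
  \<comment> \<open>The uniform probability measure on [0, 1], from which the angle is
    drawn.\<close>
  define U where "U = density lborel (\<lambda>t::real. ennreal (indicator {0..1} t))"
  have U[simp, measurable_cong]: "sets U = sets borel" and spU: "space U = UNIV" by (auto simp: U_def)
  interpret \<mu>: finite_measure ?\<mu> by (rule finite_measure_gauss[OF \<nu>])
  have eU: "emeasure U (space U) = 1"
    unfolding U_def by (subst emeasure_density) (auto simp: ennreal_indicator)
  interpret U: finite_measure U by (rule finite_measureI) (use eU in auto)
  interpret pair_sigma_finite U ?\<mu> ..
  have [measurable]: "F \<in> borel_measurable borel" by (rule holomorphic_Cn_measurable[OF hol])
  have rm[measurable]: "(\<lambda>z. c *s z :: complex^'d) \<in> borel_measurable borel" for c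
    by (intro borel_measurable_continuous_onI linear_continuous_on bounded_linear_vec_scale)
  have rot: "integrable ?\<mu> (\<lambda>z. F (e t *s z))" "(LINT z|?\<mu>. F (e t *s z)) = (LINT z|?\<mu>. F z)"
    "(LINT z|?\<mu>. norm (F (e t *s z))) = (LINT z|?\<mu>. norm (F z))" for t
  proof -
    have d: "distr ?\<mu> borel ((*s) (e t)) = ?\<mu>" by (rule gauss_measure_complex_rotation[OF ne])
    have "integrable (distr ?\<mu> borel ((*s) (e t))) F" unfolding d by (rule int)
    then show "integrable ?\<mu> (\<lambda>z. F (e t *s z))" by (subst (asm) integrable_distr_eq) auto
    have "(LINT z|distr ?\<mu> borel ((*s) (e t)). F z) = (LINT z|?\<mu>. F (e t *s z))" by (subst integral_distr) auto
    then show "(LINT z|?\<mu>. F (e t *s z)) = (LINT z|?\<mu>. F z)" unfolding d ..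
    have "(LINT z|distr ?\<mu> borel ((*s) (e t)). norm (F z)) = (LINT z|?\<mu>. norm (F (e t *s z)))" by (subst integral_distr) auto
    then show "(LINT z|?\<mu>. norm (F (e t *s z))) = (LINT z|?\<mu>. norm (F z))" unfolding d ..
  qed
  have me: "(\<lambda>(t, z). F (e t *s z)) \<in> borel_measurable (U \<Otimes>\<^sub>M ?\<mu>)"
  proof -
    have "continuous_on UNIV (\<lambda>p :: real \<times> (complex^'d). F (e (fst p) *s snd p))"
    proof (rule continuous_on_compose2[OF holomorphic_Cn_continuous[OF hol, of UNIV]])
      have eq: "(\<lambda>p :: real \<times> (complex^'d). e (fst p) *s snd p) = (\<lambda>p. \<chi> j. e (fst p) * snd p $ j)"
        by (auto simp: vec_eq_iff)
      show "continuous_on UNIV (\<lambda>p :: real \<times> (complex^'d). e (fst p) *s snd p)"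
        unfolding eq unfolding e_def by (intro continuous_intros)
    qed auto
    then have "(\<lambda>p :: real \<times> (complex^'d). F (e (fst p) *s snd p)) \<in> borel_measurable (borel \<Otimes>\<^sub>M borel)"
      unfolding borel_prod by (rule borel_measurable_continuous_onI)
    moreover have "sets (U \<Otimes>\<^sub>M ?\<mu>) = sets (borel \<Otimes>\<^sub>M borel)"
      by (intro sets_pair_measure_cong) auto
    ultimately show ?thesis
      by (simp add: case_prod_unfold cong: measurable_cong_sets)
  qed
  \<comment> \<open>For each fixed t the integral of the norm has the same value by invariance, so
    its integral over t is finite.\<close>
  have "integrable (U \<Otimes>\<^sub>M ?\<mu>) (\<lambda>(t, z). F (e t *s z))"
    by (rule Fubini_integrable[OF me]) (simp_all add: rot)
  then have "(LINT z|?\<mu>. LINT t|U. F (e t *s z)) = (LINT t|U. LINT z|?\<mu>. F (e t *s z))"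
    by (rule Fubini_integral)
  also have "\<dots> = (LINT z|?\<mu>. F z)"
    using eU by (simp add: rot measure_def)
  also have "(LINT z|?\<mu>. LINT t|U. F (e t *s z)) = (LINT z|?\<mu>. F 0)"
  proof (rule Bochner_Integration.integral_cong[OF refl])
    fix z
    have "continuous_on UNIV (\<lambda>t. F (e t *s z))"
    proof (rule continuous_on_compose2[OF holomorphic_Cn_continuous[OF hol, of UNIV]])
      show "continuous_on UNIV (\<lambda>t. e t *s z)"
        unfolding e_def
        by (intro bounded_linear.continuous_on[OF bounded_linear_vec_scale_left] continuous_intros)
    qed auto
    then have c: "continuous_on A (\<lambda>t. F (e t *s z))" for A
      by (rule continuous_on_subset) auto
    have [measurable]: "(\<lambda>t. F (e t *s z)) \<in> borel_measurable borel"
      by (rule borel_measurable_continuous_onI[OF c])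
    have "((\<lambda>t. F (0 + e t *s z)) has_integral F (0 + 0 *s z)) {0..1}"
      unfolding e_def by (rule circle_mean_value) (rule holomorphic_Cn_line[OF hol])
    then have 1: "((\<lambda>t. F (e t *s z)) has_integral F 0) {0..1}" by simp
    have "(LINT t|U. F (e t *s z)) = (LINT t|lborel. indicator {0..1} t *\<^sub>R F (e t *s z))"
      unfolding U_def by (subst integral_density) auto
    also have "\<dots> = integral {0..1} (\<lambda>t. F (e t *s z))"
      unfolding set_lebesgue_integral_def[symmetric]
      by (rule set_borel_integral_eq_integral) (rule borel_integrable_atLeastAtMost'[OF c])
    also have "\<dots> = F 0" using 1 by blast
    finally show "(LINT t|U. F (e t *s z)) = F 0" .
  qed
  also have "\<dots> = of_real (measure ?\<mu> UNIV) * F 0" by (simp add: scaleR_conv_of_real)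
  also have "measure ?\<mu> UNIV = (pi / \<nu>) ^ CARD('d)"
  proof -
    have "complex_of_real (measure ?\<mu> UNIV) = (LINT z|?\<mu>. 1)" by (simp add: scaleR_conv_of_real)
    also have "\<dots> = of_real (sqrt (pi / \<nu>) ^ DIM(complex^'d))"
      using gauss_measure_exp_linear[OF \<nu>, of "\<lambda>_::complex^'d. 0"] by (simp add: has_bochner_integral_iff)
    also have "sqrt (pi / \<nu>) ^ DIM(complex^'d) = (pi / \<nu>) ^ CARD('d)"
      using \<nu> by (simp add: mult.commute[of _ 2] power_mult)
    finally show ?thesis by (simp only: of_real_eq_iff)
  qed
  finally show ?thesis ..
qed

text \<open>The reproducing kernel without its factor (\<nu> / pi) ^ d; this is the origin of the
  powers of pi / \<nu> in the reproducing formulas.\<close>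

definition fock_kernel :: "real \<Rightarrow> complex^'d \<Rightarrow> complex^'d \<Rightarrow> complex"
  where "fock_kernel \<nu> z w = exp (of_real \<nu> * (\<Sum>j\<in>UNIV. z $ j * cnj (w $ j)))"

lemma fock_kernel_measurable [measurable]:
  "(\<lambda>w. fock_kernel \<nu> z w) \<in> borel_measurable borel"
  unfolding fock_kernel_def
  by (intro borel_measurable_continuous_onI continuous_intros)

lemma norm_fock_kernel: "norm (fock_kernel \<nu> z w) = exp (\<nu> * (z \<bullet> w))"
proof -
  have "Re (\<Sum>j\<in>UNIV. z $ j * cnj (w $ j)) = z \<bullet> w"
    by (simp add: inner_vec_def inner_complex_def)
  then show ?thesis by (simp add: fock_kernel_def norm_exp)
qed

text \<open>The squared modulus is the exponential of the real linear form 2 \<nu> (z \<bullet> w)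
  in w. Its integral is the constant in the pointwise bound \<open>fock_growth\<close>.\<close>

lemma fock_kernel_norm_integral:
  fixes z :: "complex^'d"
  assumes "\<nu> > 0"
  shows "has_bochner_integral (gauss_measure \<nu>) (\<lambda>w. (norm (fock_kernel \<nu> z w))\<^sup>2)
    ((pi / \<nu>) ^ CARD('d) * exp (\<nu> * (norm z)\<^sup>2))"
proof -
  have s: "sqrt (pi / \<nu>) ^ DIM(complex^'d) = (pi / \<nu>) ^ CARD('d)"
    using assms by (simp add: mult.commute[of _ 2] power_mult)
  have n: "(norm z)\<^sup>2 = (\<Sum>b\<in>Basis. (z \<bullet> b)\<^sup>2)"
    unfolding power2_norm_eq_inner by (subst euclidean_inner) (simp add: power2_eq_square)
  have c: "complex_of_real ((norm (fock_kernel \<nu> z w))\<^sup>2) =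
      exp (\<Sum>b\<in>Basis. of_real (2 * \<nu> * (z \<bullet> b)) * of_real (w \<bullet> b))" for w
  proof -
    have "(norm (fock_kernel \<nu> z w))\<^sup>2 = exp (2 * \<nu> * (z \<bullet> w))"
      unfolding norm_fock_kernel by (simp add: power2_eq_square flip: exp_add)
    also have "2 * \<nu> * (z \<bullet> w) = (\<Sum>b\<in>Basis. 2 * \<nu> * (z \<bullet> b) * (w \<bullet> b))"
      by (subst euclidean_inner) (simp add: sum_distrib_left mult.assoc)
    finally show ?thesis unfolding of_real_mult[symmetric] of_real_sum[symmetric] exp_of_real by (rule arg_cong)
  qed
  have v: "(\<Sum>b\<in>Basis. (complex_of_real (2 * \<nu> * (z \<bullet> b)))\<^sup>2 / (4 * of_real \<nu>)) = of_real (\<nu> * (norm z)\<^sup>2)"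
    unfolding n sum_distrib_left of_real_sum
    using assms by (intro sum.cong) (simp_all add: power2_eq_square)
  have "has_bochner_integral (gauss_measure \<nu>) (\<lambda>w. complex_of_real ((norm (fock_kernel \<nu> z w))\<^sup>2))
    (complex_of_real ((pi / \<nu>) ^ CARD('d) * exp (\<nu> * (norm z)\<^sup>2)))"
    using gauss_measure_exp_linear[OF assms, of "\<lambda>b. of_real (2 * \<nu> * (z \<bullet> b))"]
    unfolding v s c[symmetric] exp_of_real unfolding of_real_mult[symmetric] .
  from has_bochner_integral_bounded_linear[OF bounded_linear_Re this] show ?thesis by simp
qed

lemma fock_kernel_sq_integrable:
  assumes "\<nu> > 0"
  shows "sq_integrable (gauss_measure \<nu>) (\<lambda>w. fock_kernel \<nu> z w)"
  using fock_kernel_norm_integral[OF assms, of z] by (simp add: sq_integrable_def has_bochner_integral_iff)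

lemma bargmann_fock_iff: "F \<in> bargmann_fock \<nu> \<longleftrightarrow> holomorphic_Cn F \<and> sq_integrable (gauss_measure \<nu>) F"
  using holomorphic_Cn_measurable by (auto simp: bargmann_fock_def sq_integrable_def cong: measurable_cong_sets)

text \<open>The substitution \<open>z = w + u\<close> reduces the formula to the mean value of
  \<open>u \<mapsto> F (w + u) exp (- \<nu> (\<Sum>j. cnj (w $ j) u $ j))\<close>.\<close>

theorem fock_reproducing:
  fixes F :: "complex^'d \<Rightarrow> complex"
  assumes \<nu>: "\<nu> > 0" and F: "F \<in> bargmann_fock \<nu>"
  shows "integrable (gauss_measure \<nu>) (\<lambda>z. fock_kernel \<nu> w z * F z)"
    and "(LINT z|gauss_measure \<nu>. fock_kernel \<nu> w z * F z) = of_real ((pi / \<nu>) ^ CARD('d)) * F w"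
proof -
  have hol: "holomorphic_Cn F" and sq: "sq_integrable (gauss_measure \<nu>) F"
    using F by (auto simp: bargmann_fock_iff)
  have [measurable]: "F \<in> borel_measurable borel" by (rule holomorphic_Cn_measurable[OF hol])
  show i: "integrable (gauss_measure \<nu>) (\<lambda>z. fock_kernel \<nu> w z * F z)"
    by (rule sq_integrable_mult[OF fock_kernel_sq_integrable[OF \<nu>] sq])
  \<comment> \<open>The factor 1 in \<open>1 *s u\<close> matches the form of
    \<open>holomorphic_Cn_affine\<close>.\<close>
  define G where "G u = F (w + 1 *s u) * exp (\<Sum>j\<in>UNIV. (- of_real \<nu> * cnj (w $ j)) * u $ j)" for u
  have holG: "holomorphic_Cn G"
    unfolding G_def by (intro holomorphic_Cn_mult holomorphic_Cn_affine holomorphic_Cn_exp_linear hol)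
  have [measurable]: "G \<in> borel_measurable borel" by (rule holomorphic_Cn_measurable[OF holG])
  \<comment> \<open>In the exponent -\<nu> |w + u|^2 + \<nu> <w, w + u> the terms |w|^2 and <w, u>
    cancel. The second was the only cross term conjugate linear in u; what remains beside the weight
    is -\<nu> <u, w>, which is holomorphic in u.\<close>
  have sh: "exp (- \<nu> * (norm (w + u))\<^sup>2) *\<^sub>R (fock_kernel \<nu> w (w + u) * F (w + u)) =
      exp (- \<nu> * (norm u)\<^sup>2) *\<^sub>R G u" for u
  proof -
    have n: "complex_of_real ((norm z)\<^sup>2) = (\<Sum>j\<in>UNIV. z $ j * cnj (z $ j))" for z :: "complex^'d"
    proof -
      have "complex_of_real ((norm (z $ j))\<^sup>2) = z $ j * cnj (z $ j)" for j
        by (simp only: complex_norm_square)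
      then show ?thesis
        by (simp add: norm_vec_def L2_set_def sum_nonneg)
    qed
    have "exp (- \<nu> * (norm (w + u))\<^sup>2) *\<^sub>R fock_kernel \<nu> w (w + u) =
      exp (- of_real \<nu> * of_real ((norm (w + u))\<^sup>2) + of_real \<nu> * (\<Sum>j\<in>UNIV. w $ j * cnj ((w + u) $ j)))"
      unfolding fock_kernel_def scaleR_conv_of_real exp_add exp_of_real[symmetric] by simp
    also have "- of_real \<nu> * of_real ((norm (w + u))\<^sup>2) + of_real \<nu> * (\<Sum>j\<in>UNIV. w $ j * cnj ((w + u) $ j)) =
      - of_real \<nu> * of_real ((norm u)\<^sup>2) + (\<Sum>j\<in>UNIV. (- of_real \<nu> * cnj (w $ j)) * u $ j)"
      unfolding n sum_distrib_left sum.distrib[symmetric]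
      by (intro sum.cong) (auto simp: algebra_simps)
    finally show ?thesis
      unfolding G_def scaleR_conv_of_real exp_add exp_of_real[symmetric] by (simp add: algebra_simps)
  qed
  have d: "distr lborel borel ((+) w) = (lborel :: (complex^'d) measure)" by (rule lborel_distr_plus)
  have i': "integrable lborel (\<lambda>z. exp (- \<nu> * (norm z)\<^sup>2) *\<^sub>R (fock_kernel \<nu> w z * F z))"
    using i by (subst (asm) integrable_gauss_measure) auto
  then have "integrable lborel (\<lambda>u. exp (- \<nu> * (norm (w + u))\<^sup>2) *\<^sub>R (fock_kernel \<nu> w (w + u) * F (w + u)))"
    by (subst (asm) d[symmetric], subst (asm) integrable_distr_eq) auto
  then have iG: "integrable (gauss_measure \<nu>) G"
    unfolding sh by (subst integrable_gauss_measure) auto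
  have "(LINT z|gauss_measure \<nu>. fock_kernel \<nu> w z * F z) =
      (LINT z|lborel. exp (- \<nu> * (norm z)\<^sup>2) *\<^sub>R (fock_kernel \<nu> w z * F z))"
    by (subst integral_gauss_measure) auto
  also have "\<dots> = (LINT u|lborel. exp (- \<nu> * (norm (w + u))\<^sup>2) *\<^sub>R (fock_kernel \<nu> w (w + u) * F (w + u)))"
    by (subst d[symmetric], subst integral_distr) auto
  also have "\<dots> = (LINT u|gauss_measure \<nu>. G u)"
    unfolding sh by (subst integral_gauss_measure) auto
  also have "\<dots> = of_real ((pi / \<nu>) ^ CARD('d)) * G 0"
    by (rule gauss_measure_mean_value[OF \<nu> holG iG])
  also have "G 0 = F w" by (simp add: G_def)
  finally show "(LINT z|gauss_measure \<nu>. fock_kernel \<nu> w z * F z) = of_real ((pi / \<nu>) ^ CARD('d)) * F w" .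
qed

text \<open>Cauchy-Schwarz in the reproducing formula, with the known norm of the kernel.\<close>

lemma fock_growth:
  fixes F :: "complex^'d \<Rightarrow> complex"
  assumes \<nu>: "\<nu> > 0" and F: "F \<in> bargmann_fock \<nu>"
  obtains C where "C > 0" "\<And>z. norm (F z) \<le> C * exp (\<nu> * (norm z)\<^sup>2 / 2)"
proof -
  define p where "p = (pi / \<nu>) ^ CARD('d)"
  define N where "N = (LINT z|gauss_measure \<nu>. (norm (F z))\<^sup>2)"
  have sq: "sq_integrable (gauss_measure \<nu>) F" using F by (auto simp: bargmann_fock_iff)
  have p: "p > 0" using \<nu> by (simp add: p_def)
  have N: "N \<ge> 0" by (simp add: N_def)
  \<comment> \<open>Adding 1 keeps the constant positive when F vanishes.\<close>
  have "norm (F w) \<le> (sqrt (N / p) + 1) * exp (\<nu> * (norm w)\<^sup>2 / 2)" for w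
  proof -
    have "(norm (of_real p * F w))\<^sup>2 \<le> (p * exp (\<nu> * (norm w)\<^sup>2)) * N"
      using sq_integrable_Cauchy_Schwarz[OF fock_kernel_sq_integrable[OF \<nu>, of w] sq]
        fock_kernel_norm_integral[OF \<nu>, of w]
      unfolding fock_reproducing(2)[OF \<nu> F] by (simp add: has_bochner_integral_iff N_def p_def)
    then have "p * (p * (norm (F w))\<^sup>2) \<le> p * (exp (\<nu> * (norm w)\<^sup>2) * N)"
      using p by (simp add: norm_mult power2_eq_square algebra_simps)
    then have "p * (norm (F w))\<^sup>2 \<le> exp (\<nu> * (norm w)\<^sup>2) * N"
      using p by (subst (asm) mult_le_cancel_left_pos) auto
    then have "(norm (F w))\<^sup>2 \<le> N / p * exp (\<nu> * (norm w)\<^sup>2)"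
      using p by (simp add: field_simps)
    also have "\<dots> = (sqrt (N / p) * exp (\<nu> * (norm w)\<^sup>2 / 2))\<^sup>2"
      using p N by (simp add: power_mult_distrib flip: exp_double)
    finally have "norm (F w) \<le> sqrt (N / p) * exp (\<nu> * (norm w)\<^sup>2 / 2)"
      by (rule power2_le_imp_le) (use p N in simp)
    also have "\<dots> \<le> (sqrt (N / p) + 1) * exp (\<nu> * (norm w)\<^sup>2 / 2)"
      by (intro mult_right_mono) auto
    finally show ?thesis .
  qed
  moreover have "sqrt (N / p) + 1 > 0" using N p by (intro add_nonneg_pos) auto
  ultimately show ?thesis using that by blast
qed

section \<open>The adjoint of the Segal-Bargmann transform\<close>

lemma (in pair_sigma_finite) integrable_dominated_product:
  fixes H :: "'a \<times> 'b \<Rightarrow> 'c::{banach, second_countable_topology}" and p :: "'a \<Rightarrow> real" and q :: "'b \<Rightarrow> real"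
  assumes H: "H \<in> borel_measurable (M1 \<Otimes>\<^sub>M M2)"
    and p: "integrable M1 p" and q: "integrable M2 q"
    and le: "\<And>x y. norm (H (x, y)) \<le> p x * q y"
  shows "integrable (M1 \<Otimes>\<^sub>M M2) H"
proof (rule Bochner_Integration.integrable_bound)
  have [measurable]: "p \<in> borel_measurable M1" "q \<in> borel_measurable M2" using p q by auto
  show "integrable (M1 \<Otimes>\<^sub>M M2) (\<lambda>(x, y). p x * q y)"
    by (rule Fubini_integrable) (use p q in \<open>simp_all add: abs_mult\<close>)
  show "AE z in M1 \<Otimes>\<^sub>M M2. norm (H z) \<le> norm (case z of (x, y) \<Rightarrow> p x * q y)"
    using le by (auto intro!: AE_I2 order_trans[OF _ abs_ge_self])
qed (rule H)

text \<open>What the exponential of the transform leaves after exp (-\<nu> |x|^2) is split off. The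
  transform thus becomes a bilinear pairing over \<open>gauss_measure\<close>, and its kernel is
  itself square integrable in x.\<close>

definition sb_kernel :: "real \<Rightarrow> complex^'d \<Rightarrow> real^'d \<Rightarrow> complex"
  where "sb_kernel \<nu> z x = exp (of_real \<nu> * (\<Sum>j\<in>UNIV. of_real (sqrt 2 * x $ j) * z $ j - (z $ j)\<^sup>2 / 2))"

lemma sb_kernel_measurable_pair [measurable]:
  "(\<lambda>p :: (complex^'d) \<times> (real^'d). sb_kernel \<nu> (fst p) (snd p)) \<in> borel_measurable (borel \<Otimes>\<^sub>M borel)"
  unfolding borel_prod sb_kernel_def
  by (intro borel_measurable_continuous_onI continuous_intros) auto

lemma sb_kernel_measurable [measurable (raw)]:
  assumes "f \<in> borel_measurable M" "g \<in> borel_measurable M"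
  shows "(\<lambda>u. sb_kernel \<nu> (f u) (g u)) \<in> borel_measurable M"
  using measurable_compose[OF measurable_Pair[OF assms] sb_kernel_measurable_pair] by simp

lemma sb_kernel_exp:
  fixes x :: "real^'d"
  shows "exp (- of_real \<nu> * (\<Sum>j\<in>UNIV. (of_real (x $ j) - z $ j / of_real (sqrt 2))\<^sup>2)) =
    exp (- \<nu> * (norm x)\<^sup>2) *\<^sub>R sb_kernel \<nu> z x"
proof -
  have n: "complex_of_real ((norm x)\<^sup>2) = (\<Sum>j\<in>UNIV. (of_real (x $ j))\<^sup>2)"
    by (simp add: norm_vec_def L2_set_def sum_nonneg)
  have s: "(complex_of_real (sqrt 2))\<^sup>2 = 2"
    unfolding of_real_power[symmetric] by simp
  have t: "(of_real (x $ j) - z $ j / of_real (sqrt 2))\<^sup>2 =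
     (of_real (x $ j))\<^sup>2 - (of_real (sqrt 2 * x $ j) * z $ j - (z $ j)\<^sup>2 / 2)" for j
  proof -
    have q: "z $ j / of_real (sqrt 2) = of_real (sqrt 2) * z $ j / 2"
      using s by (simp add: field_simps power2_eq_square)
    show ?thesis
      unfolding q by (simp add: power2_diff power_mult_distrib power_divide s)
  qed
  have eq: "- of_real \<nu> * (\<Sum>j\<in>UNIV. (of_real (x $ j) - z $ j / of_real (sqrt 2))\<^sup>2) =
    - of_real \<nu> * of_real ((norm x)\<^sup>2) + of_real \<nu> * (\<Sum>j\<in>UNIV. of_real (sqrt 2 * x $ j) * z $ j - (z $ j)\<^sup>2 / 2)"
    unfolding n t sum_subtractf by (simp add: algebra_simps)
  show ?thesis
    unfolding eq exp_add sb_kernel_def scaleR_conv_of_real exp_of_real[symmetric]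
    by simp
qed

lemma segal_bargmann_eq:
  fixes f :: "real^'d \<Rightarrow> complex"
  assumes "f \<in> borel_measurable borel"
  shows "segal_bargmann \<nu> f z = of_real ((\<nu> / pi) powr (3 * real CARD('d) / 4)) *
    (LINT x|gauss_measure \<nu>. f x * sb_kernel \<nu> z x)"
  unfolding segal_bargmann_def sb_kernel_exp mult_scaleR_right
  by (subst integral_gauss_measure) (use assms in measurable)

text \<open>The product is the exponential of a linear form in x with coefficients \<nu> sqrt 2 (w_j
  + cnj z_j). Its Gaussian integral contributes \<nu> (w_j + cnj z_j)^2 / 2; the pure squares cancel
  against those in the two kernels, and only the mixed term \<nu> w_j cnj z_j survives.\<close>

lemma sb_kernel_pairing:
  fixes w z :: "complex^'d"
  assumes "\<nu> > 0"
  shows "has_bochner_integral (gauss_measure \<nu>) (\<lambda>x. sb_kernel \<nu> w x * cnj (sb_kernel \<nu> z x))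
    (of_real (sqrt (pi / \<nu>) ^ CARD('d)) * fock_kernel \<nu> w z)"
proof -
  \<comment> \<open>The Gaussian integral indexes coefficients by basis vectors \<open>b\<close>;
    the sum over j selects the coordinate that \<open>b\<close> stands for.\<close>
  define c where "c b = of_real (\<nu> * sqrt 2) * (\<Sum>j\<in>UNIV. of_real (b $ j) * (w $ j + cnj (z $ j)))" for b :: "real^'d"
  define k where "k = exp (- of_real \<nu> * (\<Sum>j\<in>UNIV. (w $ j)\<^sup>2 / 2 + (cnj (z $ j))\<^sup>2 / 2))"
  have B: "(\<Sum>b\<in>Basis. g b) = (\<Sum>j\<in>UNIV. g (axis j 1))" for g :: "real^'d \<Rightarrow> complex"
  proof -
    have "(\<Sum>b\<in>Basis. g b) = (\<Sum>b\<in>(\<lambda>j. axis j 1) ` UNIV. g b)"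
      by (rule arg_cong[of _ _ "sum g"]) (auto simp: Basis_vec_def)
    also have "\<dots> = (\<Sum>j\<in>UNIV. g (axis j 1))"
      by (subst sum.reindex) (auto simp: inj_def axis_eq_axis)
    finally show ?thesis .
  qed
  have ca: "c (axis j 1) = of_real (\<nu> * sqrt 2) * (w $ j + cnj (z $ j))" for j
    by (simp add: c_def axis_def if_distrib if_distribR cong: if_cong)
  have s: "(complex_of_real (sqrt 2))\<^sup>2 = 2" unfolding of_real_power[symmetric] by simp
  have "has_bochner_integral (gauss_measure \<nu>) (\<lambda>x. k * exp (\<Sum>b\<in>Basis. c b * of_real (x \<bullet> b)))
    (k * (of_real (sqrt (pi / \<nu>) ^ DIM(real^'d)) * exp (\<Sum>b\<in>Basis. (c b)\<^sup>2 / (4 * of_real \<nu>))))"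
    by (intro has_bochner_integral_mult_right gauss_measure_exp_linear assms)
  also have "(\<lambda>x. k * exp (\<Sum>b\<in>Basis. c b * of_real (x \<bullet> b))) = (\<lambda>x. sb_kernel \<nu> w x * cnj (sb_kernel \<nu> z x))"
  proof
    fix x
    show "k * exp (\<Sum>b\<in>Basis. c b * of_real (x \<bullet> b)) = sb_kernel \<nu> w x * cnj (sb_kernel \<nu> z x)"
      unfolding k_def sb_kernel_def exp_cnj exp_add[symmetric] B ca complex_cnj_mult cnj_sum complex_cnj_complex_of_real
        sum_distrib_left sum.distrib[symmetric]
      by (intro arg_cong[of _ _ exp] sum.cong) (auto simp: inner_axis algebra_simps)
  qed
  also have "k * (of_real (sqrt (pi / \<nu>) ^ DIM(real^'d)) * exp (\<Sum>b\<in>Basis. (c b)\<^sup>2 / (4 * of_real \<nu>))) =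
     of_real (sqrt (pi / \<nu>) ^ CARD('d)) * fock_kernel \<nu> w z"
  proof -
    have q: "(c (axis j 1))\<^sup>2 / (4 * of_real \<nu>) = of_real \<nu> * (w $ j + cnj (z $ j))\<^sup>2 / 2" for j
      unfolding ca power_mult_distrib of_real_mult s using assms by (simp add: power2_eq_square)
    have "k * exp (\<Sum>b\<in>Basis. (c b)\<^sup>2 / (4 * of_real \<nu>)) = fock_kernel \<nu> w z"
      unfolding B q k_def fock_kernel_def exp_add[symmetric] sum_distrib_left sum.distrib[symmetric]
      by (intro arg_cong[of _ _ exp] sum.cong) (auto simp: power2_eq_square field_simps)
    then show ?thesis by (simp add: algebra_simps)
  qed
  finally show ?thesis .
qed

lemma sb_kernel_sq_integrable:
  assumes "\<nu> > 0"
  shows "sq_integrable (gauss_measure \<nu>) (sb_kernel \<nu> z)"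
proof -
  have "integrable (gauss_measure \<nu>) (\<lambda>x. complex_of_real ((norm (sb_kernel \<nu> z x))\<^sup>2))"
    using sb_kernel_pairing[OF assms, of z z] unfolding complex_norm_square by (simp add: has_bochner_integral_iff)
  then have "integrable (gauss_measure \<nu>) (\<lambda>x. (norm (sb_kernel \<nu> z x))\<^sup>2)"
    using integrable_Re by fastforce
  then show ?thesis by (simp add: sq_integrable_def)
qed

lemma segal_bargmann_integrable:
  fixes f :: "real^'d \<Rightarrow> complex"
  assumes \<nu>: "\<nu> > 0" and f: "f \<in> gauss_L2 \<nu>"
  shows "integrable lborel (\<lambda>x. f x * exp (- of_real \<nu> * (\<Sum>j\<in>UNIV. (of_real (x $ j) - z $ j / of_real (sqrt 2))\<^sup>2)))"
proof -
  have [measurable]: "f \<in> borel_measurable borel" and sq: "sq_integrable (gauss_measure \<nu>) f"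
    using f by (simp_all add: gauss_L2_iff sq_integrable_gauss_measurable)
  have "integrable (gauss_measure \<nu>) (\<lambda>x. f x * sb_kernel \<nu> z x)"
    by (rule sq_integrable_mult[OF sq sb_kernel_sq_integrable[OF \<nu>]])
  then show ?thesis
    unfolding sb_kernel_exp mult_scaleR_right by (subst (asm) integrable_gauss_measure) auto
qed

text \<open>The factor on the left is the growth of a dilated Fock function, with \<open>1 - 4 \<delta>\<close> the square of the
  dilation factor.\<close>

lemma norm_sb_kernel_le:
  fixes z :: "complex^'d" and x :: "real^'d"
  assumes \<nu>: "\<nu> > 0" and \<delta>: "\<delta> > 0"
  shows "exp (\<nu> * (1 - 4 * \<delta>) * (norm z)\<^sup>2 / 2) * norm (sb_kernel \<nu> z x) \<le>
    exp (\<nu> * (1 - \<delta>) * (norm z)\<^sup>2) * exp (\<nu> * (norm x)\<^sup>2 / (2 * (1 + \<delta>)))"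
proof -
  have nz: "(norm z)\<^sup>2 = (\<Sum>j\<in>UNIV. (Re (z $ j))\<^sup>2 + (Im (z $ j))\<^sup>2)"
    by (simp add: norm_vec_def L2_set_def sum_nonneg cmod_power2)
  have nx: "(norm x)\<^sup>2 = (\<Sum>j\<in>UNIV. (x $ j)\<^sup>2)"
    by (simp add: norm_vec_def L2_set_def sum_nonneg)
  have nk: "norm (sb_kernel \<nu> z x) =
      exp (\<nu> * (\<Sum>j\<in>UNIV. sqrt 2 * x $ j * Re (z $ j) - ((Re (z $ j))\<^sup>2 - (Im (z $ j))\<^sup>2) / 2))"
    unfolding sb_kernel_def norm_exp_eq_Re by (simp add: Re_power2)
  \<comment> \<open>A weighted Young inequality. The factor 1 + \<delta> in the denominator makes
    the square of the resulting bound in x integrable, at the price of an extra \<delta>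
    a^2.\<close>
  have y: "sqrt 2 * t * a \<le> t\<^sup>2 / (2 * (1 + \<delta>)) + (1 + \<delta>) * a\<^sup>2" for t a :: real
  proof -
    have "0 \<le> (t - sqrt 2 * (1 + \<delta>) * a)\<^sup>2" by simp
    also have "\<dots> = 2 * (1 + \<delta>) * (t\<^sup>2 / (2 * (1 + \<delta>)) + (1 + \<delta>) * a\<^sup>2 - sqrt 2 * t * a)"
    proof -
      have "(t - sqrt 2 * (1 + \<delta>) * a)\<^sup>2 = t\<^sup>2 + (sqrt 2)\<^sup>2 * (1 + \<delta>)\<^sup>2 * a\<^sup>2 - 2 * (1 + \<delta>) * (sqrt 2 * t * a)"
        by (simp add: power2_diff power_mult_distrib)
      also have "\<dots> = t\<^sup>2 + 2 * (1 + \<delta>)\<^sup>2 * a\<^sup>2 - 2 * (1 + \<delta>) * (sqrt 2 * t * a)" by simp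
      also have "\<dots> = 2 * (1 + \<delta>) * (t\<^sup>2 / (2 * (1 + \<delta>)) + (1 + \<delta>) * a\<^sup>2 - sqrt 2 * t * a)"
        using \<delta> by (simp add: right_diff_distrib distrib_left power2_eq_square mult.assoc del: distrib_left_numeral)
      finally show ?thesis .
    qed
    finally show ?thesis using \<delta> by (simp add: zero_le_mult_iff)
  qed
  \<comment> \<open>The dilation lowers the coefficients of both A and B by 2 \<delta>. For A,
    Young's inequality takes back \<delta>, leaving exactly 1 - \<delta>; B ends at 1 - 2 \<delta>,
    and the hypothesis on \<delta> B absorbs the difference.\<close>
  have lin: "(1 - 4 * \<delta>) * (A + B) / 2 + (X - (A - B) / 2) \<le> (1 - \<delta>) * (A + B) + T"
    if "X \<le> T + (1 + \<delta>) * A" "0 \<le> \<delta> * B" for A B X T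
  proof -
    have e: "(1 - 4 * \<delta>) * (A + B) / 2 = A / 2 + B / 2 - 2 * (\<delta> * A) - 2 * (\<delta> * B)"
      "(1 - \<delta>) * (A + B) = A + B - \<delta> * A - \<delta> * B" "(1 + \<delta>) * A = A + \<delta> * A"
      by (simp_all add: field_simps)
    show ?thesis using that unfolding e by argo
  qed
  have "(1 - 4 * \<delta>) * (norm z)\<^sup>2 / 2 + (\<Sum>j\<in>UNIV. sqrt 2 * x $ j * Re (z $ j) - ((Re (z $ j))\<^sup>2 - (Im (z $ j))\<^sup>2) / 2)
      \<le> (1 - \<delta>) * (norm z)\<^sup>2 + (norm x)\<^sup>2 / (2 * (1 + \<delta>))"
    unfolding nz nx sum_distrib_left sum_divide_distrib sum.distrib[symmetric]
  proof (rule sum_mono)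
    fix j
    have "0 \<le> \<delta> * (Im (z $ j))\<^sup>2" using \<delta> by simp
    then show "(1 - 4 * \<delta>) * ((Re (z $ j))\<^sup>2 + (Im (z $ j))\<^sup>2) / 2 +
        (sqrt 2 * x $ j * Re (z $ j) - ((Re (z $ j))\<^sup>2 - (Im (z $ j))\<^sup>2) / 2)
        \<le> (1 - \<delta>) * ((Re (z $ j))\<^sup>2 + (Im (z $ j))\<^sup>2) + (x $ j)\<^sup>2 / (2 * (1 + \<delta>))"
      using y[of "x $ j" "Re (z $ j)"] by (intro lin)
  qed
  then have "\<nu> * ((1 - 4 * \<delta>) * (norm z)\<^sup>2 / 2 + (\<Sum>j\<in>UNIV. sqrt 2 * x $ j * Re (z $ j) - ((Re (z $ j))\<^sup>2 - (Im (z $ j))\<^sup>2) / 2))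
      \<le> \<nu> * ((1 - \<delta>) * (norm z)\<^sup>2 + (norm x)\<^sup>2 / (2 * (1 + \<delta>)))"
    using \<nu> by (intro mult_left_mono) auto
  then show ?thesis
    unfolding nk exp_add[symmetric] exp_le_cancel_iff by (simp add: algebra_simps)
qed

text \<open>The Hilbert space adjoint as an integral. It is applied only to functions of subcritical
  growth; where the integral fails to converge, its value would be the default 0.\<close>

definition sb_adjoint :: "real \<Rightarrow> (complex^'d \<Rightarrow> complex) \<Rightarrow> real^'d \<Rightarrow> complex"
  where "sb_adjoint \<nu> G x = of_real ((\<nu> / pi) powr (3 * real CARD('d) / 4)) *
    (LINT z|gauss_measure \<nu>. G z * cnj (sb_kernel \<nu> z x))"

text \<open>This identity dictates the exponent 3 d / 4 of the transform: composing it with its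
  adjoint uses its factor twice, the pairing of the kernels gives (pi / \<nu>) powr (d / 2), and the
  reproducing formula gives (pi / \<nu>) ^ d.\<close>

lemma sb_const:
  assumes "\<nu> > 0"
  shows "((\<nu> / pi) powr (3 * real n / 4))\<^sup>2 * (sqrt (pi / \<nu>) ^ n * (pi / \<nu>) ^ n) = 1"
proof -
  have p: "\<nu> / pi > 0" "pi / \<nu> > 0" using assms by auto
  have "((\<nu> / pi) powr (3 * real n / 4))\<^sup>2 = (\<nu> / pi) powr (3 * real n / 2)"
    by (simp add: power2_eq_square flip: powr_add)
  also have "\<dots> = inverse ((pi / \<nu>) powr (3 * real n / 2))"
    using p assms by (subst powr_minus[symmetric]) (simp add: powr_divide powr_minus field_simps)
  also have "(pi / \<nu>) powr (3 * real n / 2) = (pi / \<nu>) powr (1 / 2 * real n) * (pi / \<nu>) powr (real n)"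
    by (simp flip: powr_add)
  also have "\<dots> = sqrt (pi / \<nu>) ^ n * (pi / \<nu>) ^ n"
    unfolding powr_powr[symmetric] using p by (simp add: powr_realpow powr_half_sqrt del: powr_powr)
  finally have "((\<nu> / pi) powr (3 * real n / 4))\<^sup>2 = inverse (sqrt (pi / \<nu>) ^ n * (pi / \<nu>) ^ n)" .
  then show ?thesis by (simp only:) (rule left_inverse, use p assms in simp)
qed

text \<open>Strictly subcritical growth makes the adjoint kernel integral converge absolutely, so that
  Fubini's theorem turns the pairing of the kernels into the reproducing formula.\<close>

lemma sb_adjoint_inverse:
  fixes G :: "complex^'d \<Rightarrow> complex"
  assumes \<nu>: "\<nu> > 0" and hol: "holomorphic_Cn G" and \<delta>: "0 < \<delta>"
    and gr: "\<And>z. norm (G z) \<le> C * exp (\<nu> * (1 - 4 * \<delta>) * (norm z)\<^sup>2 / 2)"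
  shows "G \<in> bargmann_fock \<nu>"
    and "integrable (gauss_measure \<nu>) (\<lambda>z. G z * cnj (sb_kernel \<nu> z x))"
    and "sb_adjoint \<nu> G \<in> gauss_L2 \<nu>"
    and "segal_bargmann \<nu> (sb_adjoint \<nu> G) = G"
    and "(LINT x|gauss_measure \<nu>. (norm (sb_adjoint \<nu> G x))\<^sup>2) = (LINT z|gauss_measure \<nu>. (norm (G z))\<^sup>2)"
proof -
  let ?\<mu> = "gauss_measure \<nu> :: (complex^'d) measure" and ?\<rho> = "gauss_measure \<nu> :: (real^'d) measure"
  interpret \<mu>: finite_measure ?\<mu> by (rule finite_measure_gauss[OF \<nu>])
  interpret \<rho>: finite_measure ?\<rho> by (rule finite_measure_gauss[OF \<nu>])
  interpret P: pair_sigma_finite ?\<mu> ?\<rho> ..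
  define \<kappa> where "\<kappa> = (\<nu> / pi) powr (3 * real CARD('d) / 4)"
  \<comment> \<open>\<open>p\<close> and \<open>q\<close> separate the variables of the kernel
    bound: \<open>p\<close> is integrable because 1 - \<delta> < 1, and the square of
    \<open>q\<close> is integrable because 1 / (1 + \<delta>) < 1.\<close>
  define p where "p z = exp (\<nu> * (1 - \<delta>) * (norm z)\<^sup>2)" for z :: "complex^'d"
  define q where "q x = exp (\<nu> * (norm x)\<^sup>2 / (2 * (1 + \<delta>)))" for x :: "real^'d"
  have [measurable]: "G \<in> borel_measurable borel" by (rule holomorphic_Cn_measurable[OF hol])
  have [measurable]: "p \<in> borel_measurable borel" "q \<in> borel_measurable borel"
    unfolding p_def q_def by measurable
  have C: "C \<ge> 0"
    using order_trans[OF norm_ge_zero gr[of 0]] by simp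
  have ip: "integrable ?\<mu> p"
    unfolding p_def using \<nu> \<delta> by (intro integrable_gauss_measure_exp) (simp add: algebra_simps)
  have iq: "integrable ?\<rho> (\<lambda>x. (q x)\<^sup>2)"
  proof -
    have "(q x)\<^sup>2 = exp (\<nu> / (1 + \<delta>) * (norm x)\<^sup>2)" for x
    proof -
      have "2 * (\<nu> * (norm x)\<^sup>2 / (2 * (1 + \<delta>))) = \<nu> / (1 + \<delta>) * (norm x)\<^sup>2"
        using \<delta> by (simp add: field_simps)
      then show ?thesis by (simp only: q_def exp_double[symmetric])
    qed
    moreover have "\<nu> / (1 + \<delta>) < \<nu>" using \<nu> \<delta> by (simp add: divide_less_eq)
    ultimately show ?thesis by (simp only: integrable_gauss_measure_exp)
  qed
  have sq: "sq_integrable ?\<rho> (\<lambda>x. of_real (q x))"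
    using iq by (simp add: sq_integrable_def)
  have bd: "norm (G z * cnj (sb_kernel \<nu> z x)) \<le> C * p z * q x" for z x
  proof -
    have "norm (G z) * norm (sb_kernel \<nu> z x) \<le> C * (exp (\<nu> * (1 - 4 * \<delta>) * (norm z)\<^sup>2 / 2) * norm (sb_kernel \<nu> z x))"
      using mult_right_mono[OF gr[of z], of "norm (sb_kernel \<nu> z x)"] by (simp add: mult.assoc)
    also have "\<dots> \<le> C * (p z * q x)"
      unfolding p_def q_def by (intro mult_left_mono norm_sb_kernel_le \<nu> \<delta> C)
    finally show ?thesis by (simp add: norm_mult mult.assoc)
  qed
  have sqG: "sq_integrable ?\<mu> G"
  proof -
    have "integrable ?\<mu> (\<lambda>z. (norm (G z))\<^sup>2)"
    proof (rule Bochner_Integration.integrable_bound)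
      show "integrable ?\<mu> (\<lambda>z. C\<^sup>2 * exp (\<nu> * (1 - 4 * \<delta>) * (norm z)\<^sup>2))"
        using \<nu> \<delta> by (intro integrable_mult_right integrable_gauss_measure_exp) (simp add: algebra_simps)
      have "(norm (G z))\<^sup>2 \<le> (C * exp (\<nu> * (1 - 4 * \<delta>) * (norm z)\<^sup>2 / 2))\<^sup>2" for z
        by (intro power_mono gr) auto
      also have "(C * exp (\<nu> * (1 - 4 * \<delta>) * (norm z)\<^sup>2 / 2))\<^sup>2 = C\<^sup>2 * exp (\<nu> * (1 - 4 * \<delta>) * (norm z)\<^sup>2)" for z :: "complex^'d"
        by (simp add: power_mult_distrib flip: exp_double)
      finally show "AE z in ?\<mu>. norm ((norm (G z))\<^sup>2) \<le> norm (C\<^sup>2 * exp (\<nu> * (1 - 4 * \<delta>) * (norm z)\<^sup>2))"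
        by (intro AE_I2) (simp add: abs_mult)
    qed measurable
    then show ?thesis by (simp add: sq_integrable_def)
  qed
  show fock: "G \<in> bargmann_fock \<nu>" using hol sqG by (simp add: bargmann_fock_iff)
  show iz: "integrable ?\<mu> (\<lambda>z. G z * cnj (sb_kernel \<nu> z x))" for x
  proof (rule Bochner_Integration.integrable_bound)
    show "integrable ?\<mu> (\<lambda>z. C * p z * q x)" using ip by simp
    show "AE z in ?\<mu>. norm (G z * cnj (sb_kernel \<nu> z x)) \<le> norm (C * p z * q x)"
      using bd by (intro AE_I2) (auto intro: order_trans[OF _ abs_ge_self])
  qed (intro borel_measurable_times measurable_cnj; measurable)
  let ?f = "sb_adjoint \<nu> G"
  have Ameas: "(\<lambda>u. sb_kernel \<nu> (snd u) (fst u)) \<in> borel_measurable (?\<rho> \<Otimes>\<^sub>M ?\<mu>)" by measurable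
  have fm[measurable]: "?f \<in> borel_measurable borel"
  proof -
    have "(\<lambda>(x, z). G z * cnj (sb_kernel \<nu> z x)) \<in> borel_measurable (?\<rho> \<Otimes>\<^sub>M ?\<mu>)"
      unfolding case_prod_unfold by (intro borel_measurable_times measurable_cnj Ameas) measurable
    then have "(\<lambda>x. LINT z|?\<mu>. G z * cnj (sb_kernel \<nu> z x)) \<in> borel_measurable ?\<rho>"
      by (rule \<mu>.borel_measurable_lebesgue_integral)
    then show ?thesis
      unfolding sb_adjoint_def by simp
  qed
  define K where "K = \<kappa> * (C * (LINT z|?\<mu>. p z))"
  have K: "K \<ge> 0" unfolding K_def \<kappa>_def p_def using C by (intro mult_nonneg_nonneg integral_nonneg) auto
  have fb: "norm (?f x) \<le> K * q x" for x
  proof -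
    have "norm (LINT z|?\<mu>. G z * cnj (sb_kernel \<nu> z x)) \<le> (LINT z|?\<mu>. C * p z * q x)"
      by (rule order_trans[OF integral_norm_bound integral_mono[OF integrable_norm[OF iz]]]) (use ip bd in auto)
    also have "\<dots> = C * (LINT z|?\<mu>. p z) * q x" by simp
    finally have "\<kappa> * norm (LINT z|?\<mu>. G z * cnj (sb_kernel \<nu> z x)) \<le> \<kappa> * (C * (LINT z|?\<mu>. p z) * q x)"
      by (intro mult_left_mono) (auto simp: \<kappa>_def)
    then show ?thesis
      by (simp add: sb_adjoint_def norm_mult K_def \<kappa>_def[symmetric] mult.assoc) (simp add: \<kappa>_def)
  qed
  have sqf: "sq_integrable ?\<rho> ?f"
  proof -
    have "integrable ?\<rho> (\<lambda>x. (norm (?f x))\<^sup>2)"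
    proof (rule Bochner_Integration.integrable_bound)
      show "integrable ?\<rho> (\<lambda>x. K\<^sup>2 * (q x)\<^sup>2)" using iq by simp
      show "AE x in ?\<rho>. norm ((norm (?f x))\<^sup>2) \<le> norm (K\<^sup>2 * (q x)\<^sup>2)"
        using power_mono[OF fb norm_ge_zero, of _ 2] by (intro AE_I2) (simp add: power_mult_distrib)
    qed measurable
    then show ?thesis by (simp add: sq_integrable_def)
  qed
  then show "?f \<in> gauss_L2 \<nu>" by (simp add: gauss_L2_iff)
  have Bf: "segal_bargmann \<nu> ?f w = of_real \<kappa> * (LINT x|?\<rho>. ?f x * sb_kernel \<nu> w x)" for w
    unfolding \<kappa>_def by (rule segal_bargmann_eq[OF fm])
  have "segal_bargmann \<nu> ?f w = G w" for w
  proof -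
    \<comment> \<open>In x only \<open>q\<close> and the kernel at the fixed point \<open>w\<close>
      remain; both are square integrable, so their product is integrable.\<close>
    have int: "integrable (?\<mu> \<Otimes>\<^sub>M ?\<rho>) (\<lambda>(z, x). G z * cnj (sb_kernel \<nu> z x) * sb_kernel \<nu> w x)"
    proof (rule P.integrable_dominated_product)
      show "(\<lambda>(z, x). G z * cnj (sb_kernel \<nu> z x) * sb_kernel \<nu> w x) \<in> borel_measurable (?\<mu> \<Otimes>\<^sub>M ?\<rho>)"
        unfolding case_prod_unfold by (intro borel_measurable_times measurable_cnj) measurable
      show "integrable ?\<mu> (\<lambda>z. C * p z)" using ip by simp
      show "integrable ?\<rho> (\<lambda>x. q x * norm (sb_kernel \<nu> w x))"
        using integrable_norm[OF sq_integrable_mult[OF sq sb_kernel_sq_integrable[OF \<nu>, of w]]]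
        by (simp add: norm_mult q_def)
      show "norm (case (z, x) of (z, x) \<Rightarrow> G z * cnj (sb_kernel \<nu> z x) * sb_kernel \<nu> w x) \<le> C * p z * (q x * norm (sb_kernel \<nu> w x))" for z x
        using mult_right_mono[OF bd[of z x], of "norm (sb_kernel \<nu> w x)"] by (simp add: norm_mult mult.assoc)
    qed
    have "(LINT x|?\<rho>. ?f x * sb_kernel \<nu> w x) =
        (LINT x|?\<rho>. of_real \<kappa> * (LINT z|?\<mu>. G z * cnj (sb_kernel \<nu> z x) * sb_kernel \<nu> w x))"
      unfolding sb_adjoint_def \<kappa>_def[symmetric] by (simp add: mult.assoc[symmetric])
    also have "\<dots> = of_real \<kappa> * (LINT x|?\<rho>. LINT z|?\<mu>. G z * cnj (sb_kernel \<nu> z x) * sb_kernel \<nu> w x)"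
      by simp
    also have "(LINT x|?\<rho>. LINT z|?\<mu>. G z * cnj (sb_kernel \<nu> z x) * sb_kernel \<nu> w x) =
        (LINT z|?\<mu>. LINT x|?\<rho>. G z * cnj (sb_kernel \<nu> z x) * sb_kernel \<nu> w x)"
      by (rule P.Fubini_integral[OF int])
    also have "\<dots> = (LINT z|?\<mu>. of_real (sqrt (pi / \<nu>) ^ CARD('d)) * (fock_kernel \<nu> w z * G z))"
    proof (rule Bochner_Integration.integral_cong[OF refl])
      fix z
      have "(LINT x|?\<rho>. G z * cnj (sb_kernel \<nu> z x) * sb_kernel \<nu> w x) = G z * (LINT x|?\<rho>. sb_kernel \<nu> w x * cnj (sb_kernel \<nu> z x))"
        by (subst integral_mult_right_zero[symmetric]) (simp add: algebra_simps)
      also have "\<dots> = G z * (of_real (sqrt (pi / \<nu>) ^ CARD('d)) * fock_kernel \<nu> w z)"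
        using sb_kernel_pairing[OF \<nu>, of w z] by (simp add: has_bochner_integral_iff)
      finally show "(LINT x|?\<rho>. G z * cnj (sb_kernel \<nu> z x) * sb_kernel \<nu> w x) =
        of_real (sqrt (pi / \<nu>) ^ CARD('d)) * (fock_kernel \<nu> w z * G z)" by (simp add: algebra_simps)
    qed
    also have "\<dots> = of_real (sqrt (pi / \<nu>) ^ CARD('d)) * (of_real ((pi / \<nu>) ^ CARD('d)) * G w)"
      unfolding fock_reproducing(2)[OF \<nu> fock, symmetric] by simp
    finally have "segal_bargmann \<nu> ?f w = of_real (\<kappa>\<^sup>2 * (sqrt (pi / \<nu>) ^ CARD('d) * (pi / \<nu>) ^ CARD('d))) * G w"
      unfolding Bf by (simp add: power2_eq_square)
    then show ?thesis unfolding \<kappa>_def sb_const[OF \<nu>] by simp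
  qed
  then show BG: "segal_bargmann \<nu> ?f = G" by blast
  have int: "integrable (?\<mu> \<Otimes>\<^sub>M ?\<rho>) (\<lambda>(z, x). cnj (G z) * sb_kernel \<nu> z x * ?f x)"
  proof (rule P.integrable_dominated_product)
    show "(\<lambda>(z, x). cnj (G z) * sb_kernel \<nu> z x * ?f x) \<in> borel_measurable (?\<mu> \<Otimes>\<^sub>M ?\<rho>)"
      unfolding case_prod_unfold by (intro borel_measurable_times measurable_cnj) measurable
    show "integrable ?\<mu> (\<lambda>z. C * p z)" using ip by simp
    show "integrable ?\<rho> (\<lambda>x. K * (q x)\<^sup>2)" using iq by simp
    show "norm (case (z, x) of (z, x) \<Rightarrow> cnj (G z) * sb_kernel \<nu> z x * ?f x) \<le> C * p z * (K * (q x)\<^sup>2)" for z x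
    proof -
      have "norm (G z * cnj (sb_kernel \<nu> z x)) * norm (?f x) \<le> (C * p z * q x) * (K * q x)"
        by (intro mult_mono bd fb) (auto simp: C p_def q_def)
      then show ?thesis by (simp add: norm_mult power2_eq_square algebra_simps)
    qed
  qed
  \<comment> \<open>The isometry: writing one factor of <f, f> as the adjoint integral of G and
    exchanging the integrals gives the pairing of the transform of f with G, and that transform is
    G.\<close>
  have "complex_of_real (LINT x|?\<rho>. (norm (?f x))\<^sup>2) = (LINT x|?\<rho>. ?f x * cnj (?f x))"
    unfolding complex_norm_square[symmetric] by (rule integral_complex_of_real[symmetric])
  also have "\<dots> = (LINT x|?\<rho>. of_real \<kappa> * (LINT z|?\<mu>. cnj (G z) * sb_kernel \<nu> z x * ?f x))"
  proof (rule Bochner_Integration.integral_cong[OF refl])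
    fix x
    have "cnj (?f x) = of_real \<kappa> * (LINT z|?\<mu>. cnj (G z * cnj (sb_kernel \<nu> z x)))"
      unfolding Bochner_Integration.integral_cnj[of ?\<mu> "\<lambda>z. G z * cnj (sb_kernel \<nu> z x)"]
      by (simp add: sb_adjoint_def \<kappa>_def)
    then show "?f x * cnj (?f x) = of_real \<kappa> * (LINT z|?\<mu>. cnj (G z) * sb_kernel \<nu> z x * ?f x)"
      by simp
  qed
  also have "\<dots> = of_real \<kappa> * (LINT x|?\<rho>. LINT z|?\<mu>. cnj (G z) * sb_kernel \<nu> z x * ?f x)" by simp
  also have "(LINT x|?\<rho>. LINT z|?\<mu>. cnj (G z) * sb_kernel \<nu> z x * ?f x) =
      (LINT z|?\<mu>. LINT x|?\<rho>. cnj (G z) * sb_kernel \<nu> z x * ?f x)"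
    by (rule P.Fubini_integral[OF int])
  also have "of_real \<kappa> * \<dots> = (LINT z|?\<mu>. of_real \<kappa> * (LINT x|?\<rho>. cnj (G z) * (?f x * sb_kernel \<nu> z x)))"
    by (simp add: mult.assoc mult.commute[of "?f _"])
  also have "\<dots> = (LINT z|?\<mu>. cnj (G z) * segal_bargmann \<nu> ?f z)"
    unfolding Bf by (simp add: algebra_simps)
  also have "\<dots> = complex_of_real (LINT z|?\<mu>. (norm (G z))\<^sup>2)"
    unfolding BG integral_complex_of_real[symmetric] complex_norm_square by (simp add: mult.commute)
  finally show "(LINT x|?\<rho>. (norm (?f x))\<^sup>2) = (LINT z|?\<mu>. (norm (G z))\<^sup>2)"
    by (simp only: of_real_eq_iff)
qed

section \<open>Surjectivity of the Segal-Bargmann transform\<close>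

text \<open>Fatou's lemma applied to \<open>2|f n|\<^sup>2 + 2|f|\<^sup>2 - |f n - f|\<^sup>2\<close>.\<close>

lemma sq_integrable_tendsto:
  fixes f :: "nat \<Rightarrow> 'a \<Rightarrow> complex"
  assumes fn: "\<And>n. sq_integrable M (f n)" and g: "sq_integrable M g"
    and lim: "\<And>x. (\<lambda>n. f n x) \<longlonglongrightarrow> g x"
    and le: "\<And>n. (LINT x|M. (norm (f n x))\<^sup>2) \<le> a n"
    and a: "a \<longlonglongrightarrow> (LINT x|M. (norm (g x))\<^sup>2)"
  shows "(\<lambda>n. LINT x|M. (norm (f n x - g x))\<^sup>2) \<longlonglongrightarrow> 0"
proof -
  define N D where "N = (LINT x|M. (norm (g x))\<^sup>2)" and "D n = (LINT x|M. (norm (f n x - g x))\<^sup>2)" for n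
  have [measurable]: "f n \<in> borel_measurable M" "g \<in> borel_measurable M" for n
    using fn g by (auto simp: sq_integrable_def)
  define u where "u n x = 2 * (norm (f n x))\<^sup>2 + 2 * (norm (g x))\<^sup>2 - (norm (f n x - g x))\<^sup>2" for n x
  have u0: "u n x \<ge> 0" for n x
    using norm_add_power2_le[of "f n x" "- g x"] by (simp add: u_def)
  have iu: "integrable M (u n)" for n
    using fn[of n] g sq_integrable_diff[OF fn[of n] g] by (auto simp: sq_integrable_def u_def[abs_def])
  have Iu: "(LINT x|M. u n x) = 2 * (LINT x|M. (norm (f n x))\<^sup>2) + 2 * N - D n" for n
    using fn[of n] g sq_integrable_diff[OF fn[of n] g] by (auto simp: sq_integrable_def u_def[abs_def] N_def D_def)
  have [measurable]: "u n \<in> borel_measurable M" for n using iu by auto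
  have N0: "N \<ge> 0" by (simp add: N_def)
  have "ennreal (4 * N) = (\<integral>\<^sup>+x. ennreal (4 * (norm (g x))\<^sup>2) \<partial>M)"
    using g by (subst nn_integral_eq_integral) (auto simp: sq_integrable_def N_def)
  also have "\<dots> = (\<integral>\<^sup>+x. liminf (\<lambda>n. ennreal (u n x)) \<partial>M)"
  proof (rule nn_integral_cong)
    fix x
    have "(\<lambda>n. u n x) \<longlonglongrightarrow> 2 * (norm (g x))\<^sup>2 + 2 * (norm (g x))\<^sup>2 - (norm (g x - g x))\<^sup>2"
      unfolding u_def by (intro tendsto_intros lim)
    then have "(\<lambda>n. ennreal (u n x)) \<longlonglongrightarrow> ennreal (4 * (norm (g x))\<^sup>2)"
      by (intro tendsto_ennrealI) simp
    then show "ennreal (4 * (norm (g x))\<^sup>2) = liminf (\<lambda>n. ennreal (u n x))"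
      by (intro lim_imp_Liminf[symmetric]) auto
  qed
  also have "\<dots> \<le> liminf (\<lambda>n. \<integral>\<^sup>+x. ennreal (u n x) \<partial>M)"
    by (rule nn_integral_liminf) measurable
  also have "(\<lambda>n. \<integral>\<^sup>+x. ennreal (u n x) \<partial>M) = (\<lambda>n. ennreal (LINT x|M. u n x))"
    using iu u0 by (intro ext nn_integral_eq_integral) auto
  finally have fatou: "ennreal (4 * N) \<le> liminf (\<lambda>n. ennreal (LINT x|M. u n x))" .
  have "\<forall>\<^sub>F n in sequentially. D n < e" if e: "e > 0" for e
  proof -
    \<comment> \<open>The sign is split because \<open>ennreal\<close> sends negative numbers to 0.
      The margin e / 2 here and twice the margin e / 4 for \<open>a\<close> add up to e in D n = 2
      |f n|^2 + 2 N - (integral of u n).\<close>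
    have "\<forall>\<^sub>F n in sequentially. 4 * N - e / 2 < (LINT x|M. u n x)"
    proof (cases "4 * N - e / 2 < 0")
      case True
      have "(LINT x|M. u n x) \<ge> 0" for n using u0 by simp
      then show ?thesis using True by (intro always_eventually allI) (meson less_le_trans)
    next
      case False
      then have "ennreal (4 * N - e / 2) < ennreal (4 * N)" using e by (intro ennreal_lessI) auto
      from less_LiminfD[OF less_le_trans[OF this fatou]]
      show ?thesis by eventually_elim (use False in \<open>simp add: ennreal_less_iff\<close>)
    qed
    moreover have "\<forall>\<^sub>F n in sequentially. a n < N + e / 4"
      using order_tendstoD(2)[OF a[folded N_def], of "N + e / 4"] e by simp
    ultimately show ?thesis
    proof eventually_elim
      case (elim n)
      then show ?case using le[of n] unfolding Iu by linarith
    qed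
  qed
  moreover have "D n \<ge> 0" for n by (simp add: D_def)
  ultimately have "D \<longlonglongrightarrow> 0"
    by (intro order_tendstoI) (auto intro: always_eventually less_le_trans)
  then show ?thesis by (simp add: D_def[abs_def])
qed

text \<open>The substitution y = r z costs the Jacobian in the denominator and changes the weight to
  exp (-\<nu> |y|^2 / r^2), which is smaller than the original one since r \<le> 1.\<close>

lemma fock_dilation_norm:
  fixes F :: "complex^'d \<Rightarrow> complex"
  assumes \<nu>: "\<nu> > 0" and F: "F \<in> bargmann_fock \<nu>" and r: "0 < r" "r \<le> 1"
  shows "(LINT z|gauss_measure \<nu>. (norm (F (of_real r *s z)))\<^sup>2) \<le>
    (LINT z|gauss_measure \<nu>. (norm (F z))\<^sup>2) / r ^ DIM(complex^'d)"
proof -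
  have hol: "holomorphic_Cn F" and i: "integrable (gauss_measure \<nu>) (\<lambda>z. (norm (F z))\<^sup>2)"
    using F by (auto simp: bargmann_fock_def)
  have [measurable]: "F \<in> borel_measurable borel" by (rule holomorphic_Cn_measurable[OF hol])
  have sc: "of_real r *s z = r *\<^sub>R z" for z :: "complex^'d"
    by (simp add: vec_eq_iff scaleR_conv_of_real[where 'a=complex])
  have [measurable]: "(\<lambda>z. F (r *\<^sub>R z)) \<in> borel_measurable borel" by measurable
  define h where "h y = exp (- \<nu> * (norm y)\<^sup>2 / r\<^sup>2) * (norm (F y))\<^sup>2" for y
  have [measurable]: "h \<in> borel_measurable borel" unfolding h_def by measurable
  have i1: "integrable lborel (\<lambda>z. exp (- \<nu> * (norm z)\<^sup>2) * (norm (F z))\<^sup>2)"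
    using i by (subst (asm) integrable_gauss_measure) auto
  have le: "h z \<le> exp (- \<nu> * (norm z)\<^sup>2) * (norm (F z))\<^sup>2" for z
  proof -
    have "r\<^sup>2 \<le> 1" using r by (simp add: power_le_one)
    then have "(norm z)\<^sup>2 * r\<^sup>2 \<le> (norm z)\<^sup>2" using mult_left_mono[of "r\<^sup>2" 1 "(norm z)\<^sup>2"] by simp
    then have "(norm z)\<^sup>2 \<le> (norm z)\<^sup>2 / r\<^sup>2" using r by (simp add: field_simps)
    then have "\<nu> * (norm z)\<^sup>2 \<le> \<nu> * ((norm z)\<^sup>2 / r\<^sup>2)" using \<nu> by (intro mult_left_mono) auto
    then show ?thesis unfolding h_def by (intro mult_right_mono) auto
  qed
  have ih: "integrable lborel h"
    by (rule Bochner_Integration.integrable_bound[OF i1]) (use le in \<open>auto simp: h_def intro!: AE_I2\<close>)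
  have lb: "(lborel :: (complex^'d) measure) = density (distr lborel borel (\<lambda>z. 0 + r *\<^sub>R z)) (\<lambda>_. ennreal (r ^ DIM(complex^'d)))"
    using lborel_affine[of r "0 :: complex^'d"] r by simp
  have hr: "h (r *\<^sub>R z) = exp (- \<nu> * (norm z)\<^sup>2) * (norm (F (r *\<^sub>R z)))\<^sup>2" for z
    using r by (simp add: h_def power_mult_distrib)
  have "integral\<^sup>L lborel h = integral\<^sup>L (density (distr lborel borel (\<lambda>z. 0 + r *\<^sub>R z)) (\<lambda>_. ennreal (r ^ DIM(complex^'d)))) h"
    by (subst lb[symmetric]) (rule refl)
  also have "\<dots> = r ^ DIM(complex^'d) * (LINT z|lborel. h (r *\<^sub>R z))"
    using r by (subst integral_density) (auto simp: integral_distr)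
  also have "(LINT z|lborel. h (r *\<^sub>R z)) = (LINT z|gauss_measure \<nu>. (norm (F (of_real r *s z)))\<^sup>2)"
    unfolding hr sc by (subst integral_gauss_measure) auto
  finally have "(LINT z|gauss_measure \<nu>. (norm (F (of_real r *s z)))\<^sup>2) = integral\<^sup>L lborel h / r ^ DIM(complex^'d)"
    using r by (simp add: field_simps)
  also have "\<dots> \<le> (LINT z|lborel. exp (- \<nu> * (norm z)\<^sup>2) * (norm (F z))\<^sup>2) / r ^ DIM(complex^'d)"
    using r by (intro divide_right_mono integral_mono ih i1 le) auto
  also have "(LINT z|lborel. exp (- \<nu> * (norm z)\<^sup>2) * (norm (F z))\<^sup>2) = (LINT z|gauss_measure \<nu>. (norm (F z))\<^sup>2)"
    by (subst integral_gauss_measure) auto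
  finally show ?thesis .
qed

lemma holomorphic_Cn_diff:
  assumes "holomorphic_Cn F" "holomorphic_Cn G"
  shows "holomorphic_Cn (\<lambda>z. F z - G z)"
  unfolding holomorphic_Cn_def
proof
  fix z
  obtain D where D: "(F has_derivative D) (at z)" "\<And>c v. D (c *s v) = c * D v"
    using assms unfolding holomorphic_Cn_def by blast
  obtain E where E: "(G has_derivative E) (at z)" "\<And>c v. E (c *s v) = c * E v"
    using assms unfolding holomorphic_Cn_def by blast
  show "\<exists>D. ((\<lambda>z. F z - G z) has_derivative D) (at z) \<and> (\<forall>c v. D (c *s v) = c * D v)"
    using has_derivative_diff[OF D(1) E(1)]
    by (intro exI[of _ "\<lambda>h. D h - E h"]) (auto simp: D E algebra_simps)
qed

text \<open>The isometry, applied to differences of dilations, makes their preimages Cauchy. The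
  limit g is a preimage of F because the transform at a fixed point is continuous on L2 by
  Cauchy-Schwarz, while the dilations also converge to F pointwise.\<close>

theorem segal_bargmann_surj:
  fixes F :: "complex^'d \<Rightarrow> complex"
  assumes \<nu>: "\<nu> > 0" and F: "F \<in> bargmann_fock \<nu>"
  shows "F \<in> segal_bargmann \<nu> ` gauss_L2 \<nu>"
proof -
  let ?\<mu> = "gauss_measure \<nu> :: (complex^'d) measure" and ?\<rho> = "gauss_measure \<nu> :: (real^'d) measure"
  interpret \<rho>: finite_measure ?\<rho> by (rule finite_measure_gauss[OF \<nu>])
  have hol: "holomorphic_Cn F" and sq: "sq_integrable ?\<mu> F" using F by (auto simp: bargmann_fock_iff)
  obtain C where C: "C > 0" "\<And>z. norm (F z) \<le> C * exp (\<nu> * (norm z)\<^sup>2 / 2)"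
    using fock_growth[OF \<nu> F] by blast
  \<comment> \<open>The shift by 2 keeps the factor strictly between 0 and 1 already for n =
    0.\<close>
  define r where "r n = 1 - 1 / (real n + 2)" for n
  define H where "H n z = F (of_real (r n) *s z)" for n z
  \<comment> \<open>The solution of 1 - 4 d = r^2, the form of growth exponent that
    \<open>sb_adjoint_inverse\<close> expects.\<close>
  define d where "d n = (1 - (r n)\<^sup>2) / 4" for n
  have r: "0 < r n" "r n < 1" for n by (auto simp: r_def field_simps)
  have d: "0 < d n" for n
    using r[of n] power_strict_mono[of "r n" 1 2] by (simp add: d_def)
  have rl: "r \<longlonglongrightarrow> 1" unfolding r_def by real_asymp
  have holH: "holomorphic_Cn (H n)" for n
    using holomorphic_Cn_affine[OF hol, of 0 "of_real (r n)"] by (simp add: H_def[abs_def])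
  have grH: "norm (H n z) \<le> C * exp (\<nu> * (1 - 4 * d n) * (norm z)\<^sup>2 / 2)" for n z
  proof -
    have "of_real (r n) *s z = r n *\<^sub>R z"
      by (simp add: vec_eq_iff scaleR_conv_of_real[where 'a=complex])
    then have "(norm (of_real (r n) *s z))\<^sup>2 = (r n)\<^sup>2 * (norm z)\<^sup>2"
      by (simp add: power_mult_distrib)
    moreover have "1 - 4 * d n = (r n)\<^sup>2" by (simp add: d_def field_simps)
    ultimately show ?thesis using C(2)[of "of_real (r n) *s z"] by (simp add: H_def mult.assoc)
  qed
  note H1 = sb_adjoint_inverse[OF \<nu> holH d grH]
  have sqH: "sq_integrable ?\<mu> (H n)" for n
    using H1(1) by (auto simp: bargmann_fock_iff)
  have Hl: "(\<lambda>n. H n z) \<longlonglongrightarrow> F z" for z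
  proof -
    have "(\<lambda>n. of_real (r n) *s z) \<longlonglongrightarrow> of_real 1 *s z"
      by (intro bounded_linear.tendsto[OF bounded_linear_vec_scale_left] tendsto_intros rl)
    then show ?thesis
      unfolding H_def
      using holomorphic_Cn_continuous[OF hol, of UNIV]
      by (intro isCont_tendsto_compose[of _ F]) (auto simp: continuous_on_eq_continuous_at)
  qed
  define N where "N = (LINT z|?\<mu>. (norm (F z))\<^sup>2)"
  have "(\<lambda>n. LINT z|?\<mu>. (norm (H n z - F z))\<^sup>2) \<longlonglongrightarrow> 0"
  proof (rule sq_integrable_tendsto[OF sqH sq Hl])
    show "(LINT z|?\<mu>. (norm (H n z))\<^sup>2) \<le> N / (r n) ^ DIM(complex^'d)" for n
      unfolding H_def N_def by (rule fock_dilation_norm[OF \<nu> F]) (use r[of n] in auto)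
    have "(\<lambda>n. N / (r n) ^ DIM(complex^'d)) \<longlonglongrightarrow> N / 1 ^ DIM(complex^'d)"
      by (intro tendsto_intros rl) auto
    then show "(\<lambda>n. N / (r n) ^ DIM(complex^'d)) \<longlonglongrightarrow> (LINT z|?\<mu>. (norm (F z))\<^sup>2)" by (simp add: N_def)
  qed
  \<comment> \<open>The extra quarter pays for comparing two dilations through F: there are two such
    terms, each with a factor 2.\<close>
  then have "\<forall>\<^sub>F n in sequentially. (LINT z|?\<mu>. (norm (H n z - F z))\<^sup>2) < (1 / 4) ^ m / 4" for m
    by (rule order_tendstoD(2)) simp
  \<comment> \<open>Requiring k \<ge> m makes the chosen indices tend to infinity, so pointwise
    convergence survives the selection.\<close>
  then have "\<exists>k\<ge>m. (LINT z|?\<mu>. (norm (H k z - F z))\<^sup>2) < (1 / 4) ^ m / 4" for m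
    unfolding eventually_sequentially by (meson le_refl nle_le order_trans)
  then obtain k where k: "\<And>m. m \<le> k m" "\<And>m. (LINT z|?\<mu>. (norm (H (k m) z - F z))\<^sup>2) < (1 / 4) ^ m / 4"
    by metis
  have HH: "(LINT z|?\<mu>. (norm (H (k n) z - H (k m) z))\<^sup>2) \<le> (1 / 4) ^ n" if "n \<le> m" for n m
  proof -
    have dn: "sq_integrable ?\<mu> (\<lambda>z. H (k n) z - F z)" for n by (rule sq_integrable_diff[OF sqH sq])
    have "(LINT z|?\<mu>. (norm (H (k n) z - H (k m) z))\<^sup>2) \<le>
        (LINT z|?\<mu>. 2 * (norm (H (k n) z - F z))\<^sup>2 + 2 * (norm (H (k m) z - F z))\<^sup>2)"
    proof (rule integral_mono)
      show "integrable ?\<mu> (\<lambda>z. (norm (H (k n) z - H (k m) z))\<^sup>2)"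
        using sq_integrable_diff[OF sqH sqH] by (simp add: sq_integrable_def)
      show "integrable ?\<mu> (\<lambda>z. 2 * (norm (H (k n) z - F z))\<^sup>2 + 2 * (norm (H (k m) z - F z))\<^sup>2)"
        using dn by (simp add: sq_integrable_def)
      show "(norm (H (k n) z - H (k m) z))\<^sup>2 \<le> 2 * (norm (H (k n) z - F z))\<^sup>2 + 2 * (norm (H (k m) z - F z))\<^sup>2" for z
        using norm_add_power2_le[of "H (k n) z - F z" "F z - H (k m) z"] by (simp add: norm_minus_commute[of "F z"])
    qed
    also have "\<dots> = 2 * (LINT z|?\<mu>. (norm (H (k n) z - F z))\<^sup>2) + 2 * (LINT z|?\<mu>. (norm (H (k m) z - F z))\<^sup>2)"
      using dn by (simp add: sq_integrable_def)
    also have "\<dots> \<le> 2 * ((1 / 4) ^ n / 4) + 2 * ((1 / 4) ^ m / 4)"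
      using k(2)[of n] k(2)[of m] by linarith
    also have "\<dots> \<le> (1 / 4) ^ n"
    proof -
      have "(1 / 4 :: real) ^ m \<le> (1 / 4) ^ n" by (rule power_decreasing[OF that]) auto
      then show ?thesis by linarith
    qed
    finally show ?thesis .
  qed
  define f where "f n = sb_adjoint \<nu> (H (k n))" for n
  have sqf: "sq_integrable ?\<rho> (f n)" for n
    using H1(3)[of "k n"] by (simp add: f_def gauss_L2_iff)
  have ff: "(LINT x|?\<rho>. (norm (f n x - f m x))\<^sup>2) \<le> (1 / 4) ^ n" if "n \<le> m" for n m
  proof -
    have hol': "holomorphic_Cn (\<lambda>z. H (k n) z - H (k m) z)"
      by (intro holomorphic_Cn_diff holH)
    \<comment> \<open>The difference needs one growth exponent for both terms; the smaller gap gives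
      the weaker bound, which both satisfy.\<close>
    define e where "e = min (d (k n)) (d (k m))"
    have e: "e > 0" "e \<le> d (k n)" "e \<le> d (k m)" using d by (auto simp: e_def)
    have mono: "C * exp (\<nu> * (1 - 4 * d') * (norm z)\<^sup>2 / 2) \<le> C * exp (\<nu> * (1 - 4 * e) * (norm z)\<^sup>2 / 2)"
      if "e \<le> d'" for d' and z :: "complex^'d"
    proof -
      have "\<nu> * (1 - 4 * d') * (norm z)\<^sup>2 \<le> \<nu> * (1 - 4 * e) * (norm z)\<^sup>2"
        using that \<nu> by (intro mult_right_mono mult_left_mono) auto
      then show ?thesis using C(1) by simp
    qed
    have gr': "norm (H (k n) z - H (k m) z) \<le> 2 * C * exp (\<nu> * (1 - 4 * e) * (norm z)\<^sup>2 / 2)" for z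
      using norm_triangle_ineq4[of "H (k n) z" "H (k m) z"] grH[of "k n" z] grH[of "k m" z] mono[OF e(2), of z] mono[OF e(3), of z]
      by linarith
    have "sb_adjoint \<nu> (\<lambda>z. H (k n) z - H (k m) z) = (\<lambda>x. f n x - f m x)"
      using H1(2)[of "k n"] H1(2)[of "k m"]
      by (auto simp: fun_eq_iff f_def sb_adjoint_def left_diff_distrib right_diff_distrib)
    with sb_adjoint_inverse(5)[OF \<nu> hol' e(1) gr'] HH[OF that] show ?thesis by simp
  qed
  obtain g where g: "sq_integrable ?\<rho> g" "(\<lambda>n. LINT x|?\<rho>. (norm (f n x - g x))\<^sup>2) \<longlonglongrightarrow> 0"
    using \<rho>.sq_integrable_complete[OF sqf ff] by blast
  have gm: "g \<in> borel_measurable borel" and gL: "g \<in> gauss_L2 \<nu>"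
    using g(1) by (simp_all add: gauss_L2_iff sq_integrable_gauss_measurable)
  have fm: "f n \<in> borel_measurable borel" for n
    using sqf[of n] by (rule sq_integrable_gauss_measurable)
  have "segal_bargmann \<nu> g z = F z" for z
  proof -
    define c where "c = (\<nu> / pi) powr (3 * real CARD('d) / 4)"
    define A where "A = (LINT x|?\<rho>. (norm (sb_kernel \<nu> z x))\<^sup>2)"
    define D where "D n = (LINT x|?\<rho>. (norm (f n x - g x))\<^sup>2)" for n
    have le: "norm (H (k n) z - segal_bargmann \<nu> g z) \<le> \<bar>c\<bar> * sqrt (D n * A)" for n
    proof -
      have "H (k n) z - segal_bargmann \<nu> g z = segal_bargmann \<nu> (f n) z - segal_bargmann \<nu> g z"
        using H1(4)[of "k n"] by (simp add: f_def)
      also have "\<dots> = of_real c * (LINT x|?\<rho>. (f n x - g x) * sb_kernel \<nu> z x)"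
        unfolding segal_bargmann_eq[OF fm] segal_bargmann_eq[OF gm] c_def
        using sq_integrable_mult[OF sqf[of n] sb_kernel_sq_integrable[OF \<nu>, of z]]
          sq_integrable_mult[OF g(1) sb_kernel_sq_integrable[OF \<nu>, of z]]
        by (simp add: left_diff_distrib right_diff_distrib)
      finally have "norm (H (k n) z - segal_bargmann \<nu> g z) = \<bar>c\<bar> * norm (LINT x|?\<rho>. (f n x - g x) * sb_kernel \<nu> z x)"
        by (simp add: norm_mult)
      also have "norm (LINT x|?\<rho>. (f n x - g x) * sb_kernel \<nu> z x) \<le> sqrt (D n * A)"
        unfolding D_def A_def
        by (rule real_le_rsqrt, rule sq_integrable_Cauchy_Schwarz[OF sq_integrable_diff[OF sqf g(1)] sb_kernel_sq_integrable[OF \<nu>]])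
      finally show ?thesis by (simp add: mult_left_mono)
    qed
    have lim: "(\<lambda>n. \<bar>c\<bar> * sqrt (D n * A)) \<longlonglongrightarrow> \<bar>c\<bar> * sqrt (0 * A)"
      unfolding D_def by (intro tendsto_intros g(2))
    have "(\<lambda>n. H (k n) z - segal_bargmann \<nu> g z) \<longlonglongrightarrow> 0"
      by (rule Lim_null_comparison[OF always_eventually[OF allI[OF le]]]) (use lim in simp)
    then have 1: "(\<lambda>n. H (k n) z) \<longlonglongrightarrow> segal_bargmann \<nu> g z"
      by (simp add: LIM_zero_iff)
    have "filterlim k at_top sequentially"
      by (rule filterlim_at_top_mono[OF filterlim_ident]) (use k(1) in auto)
    then have 2: "(\<lambda>n. H (k n) z) \<longlonglongrightarrow> F z"
      by (rule filterlim_compose[OF Hl])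
    from 1 2 show ?thesis by (rule LIMSEQ_unique)
  qed
  then have "segal_bargmann \<nu> g = F" by blast
  then show ?thesis using gL by blast
qed

corollary segal_bargmann_inv:
  assumes "\<nu> > 0" "F \<in> bargmann_fock \<nu>"
  shows "segal_bargmann_inv \<nu> F \<in> gauss_L2 \<nu>" "segal_bargmann \<nu> (segal_bargmann_inv \<nu> F) = F"
  using segal_bargmann_surj[OF assms] unfolding segal_bargmann_inv_def
  by (auto intro: inv_into_into simp: f_inv_into_f)

section \<open>The Bargmann-Fock space of the plane\<close>

lemma gauss_measure_Basis_iso_integral:
  fixes T :: "'a::euclidean_space \<Rightarrow> 'b::euclidean_space" and f :: "'b \<Rightarrow> 'c::{banach, second_countable_topology}"
  assumes T: "linear T" "bij_betw T Basis Basis" and f: "f \<in> borel_measurable borel"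
  shows "(LINT x|gauss_measure \<nu>. f (T x)) = (LINT y|gauss_measure \<nu>. f y)"
    and "integrable (gauss_measure \<nu>) (\<lambda>x. f (T x)) \<longleftrightarrow> integrable (gauss_measure \<nu>) f"
proof -
  have m: "T \<in> measurable (gauss_measure \<nu>) borel"
    using linear_continuous_on[of T UNIV] T(1)
    by (simp add: linear_conv_bounded_linear borel_measurable_continuous_onI measurable_cong_sets[OF sets_gauss_measure refl])
  note d = gauss_measure_distr_Basis_iso[OF T, of \<nu>]
  show "(LINT x|gauss_measure \<nu>. f (T x)) = (LINT y|gauss_measure \<nu>. f y)"
    using integral_distr[OF m f] unfolding d ..
  show "integrable (gauss_measure \<nu>) (\<lambda>x. f (T x)) \<longleftrightarrow> integrable (gauss_measure \<nu>) f"
    using integrable_distr_eq[OF m f] unfolding d ..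
qed

lemma sq_integrable_Basis_iso:
  fixes T :: "'a::euclidean_space \<Rightarrow> 'b::euclidean_space"
  assumes T: "linear T" "bij_betw T Basis Basis" and f: "sq_integrable (gauss_measure \<nu>) f"
  shows "sq_integrable (gauss_measure \<nu>) (\<lambda>x. f (T x))"
proof -
  have fm[measurable]: "f \<in> borel_measurable borel" by (rule sq_integrable_gauss_measurable[OF f])
  have m[measurable]: "T \<in> borel_measurable borel"
    using linear_continuous_on[of T UNIV] T(1)
    by (simp add: linear_conv_bounded_linear borel_measurable_continuous_onI)
  have "integrable (gauss_measure \<nu>) (\<lambda>x. (norm (f (T x)))\<^sup>2)"
    by (subst gauss_measure_Basis_iso_integral(2)[OF T]) (use f in \<open>auto simp: sq_integrable_def\<close>)
  then show ?thesis by (simp add: sq_integrable_def)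
qed

lemma vec_Basis_iso:
  "linear (vec :: 'a::euclidean_space \<Rightarrow> 'a^1)" "bij_betw (vec :: 'a \<Rightarrow> 'a^1) Basis Basis"
proof -
  show "linear (vec :: 'a \<Rightarrow> 'a^1)" by (rule linearI) (auto simp: vec_eq_iff)
  have "vec ` Basis = (Basis :: ('a^1) set)"
  proof -
    have "vec u = axis (1::1) u" for u :: 'a by (simp add: vec_eq_iff axis_def)
    then show ?thesis by (auto simp: Basis_vec_def)
  qed
  moreover have "inj (vec :: 'a \<Rightarrow> 'a^1)" by (auto simp: inj_def vec_eq_iff)
  ultimately show "bij_betw (vec :: 'a \<Rightarrow> 'a^1) Basis Basis"
    by (auto simp: bij_betw_def intro: inj_on_subset)
qed

lemma complex_real2_Basis_iso:
  "linear (\<lambda>w :: complex. vector [Re w, Im w] :: real^2)"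
  "bij_betw (\<lambda>w :: complex. vector [Re w, Im w] :: real^2) Basis Basis"
proof -
  let ?T = "\<lambda>w :: complex. vector [Re w, Im w] :: real^2"
  show "linear ?T" by (rule linearI) (auto simp: vec_eq_iff forall_2)
  have "?T ` Basis = {axis 1 1, axis 2 1}"
  proof -
    have "?T 1 = axis 1 1" "?T \<i> = axis 2 1" by (auto simp: vec_eq_iff forall_2 axis_def)
    then show ?thesis by (simp add: Basis_complex_def)
  qed
  also have "\<dots> = Basis"
    by (auto simp: Basis_vec_def UNIV_2)
  finally have "?T ` Basis = Basis" .
  moreover have "inj ?T" by (auto simp: inj_def vec_eq_iff forall_2 complex_eq_iff)
  ultimately show "bij_betw ?T Basis Basis"
    by (auto simp: bij_betw_def intro: inj_on_subset)
qed

lemma fock_kernel_vec: "fock_kernel \<nu> (vec w) (vec z :: complex^1) = exp (of_real \<nu> * w * cnj z)"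
  by (simp add: fock_kernel_def mult.assoc)

lemma plane_kernel_sq_integrable:
  assumes "\<nu> > 0"
  shows "sq_integrable (gauss_measure \<nu>) (\<lambda>z. exp (of_real \<nu> * w * cnj z))"
  using sq_integrable_Basis_iso[OF vec_Basis_iso fock_kernel_sq_integrable[OF assms, of "vec w :: complex^1"]]
  unfolding fock_kernel_vec .

lemma bargmann_fock_plane_iff:
  "f \<in> bargmann_fock_plane \<nu> \<longleftrightarrow> f holomorphic_on UNIV \<and> sq_integrable (gauss_measure \<nu>) f"
proof -
  have "f \<in> borel_measurable borel" if "f holomorphic_on UNIV"
    using that by (intro borel_measurable_continuous_onI holomorphic_on_imp_continuous_on)
  then show ?thesis
    by (auto simp: bargmann_fock_plane_def sq_integrable_def measurable_cong_sets[OF sets_gauss_measure refl])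
qed

lemma bargmann_fock_plane_cmult:
  "f \<in> bargmann_fock_plane \<nu> \<Longrightarrow> (\<lambda>z. c * f z) \<in> bargmann_fock_plane \<nu>"
  unfolding bargmann_fock_plane_iff
  by (intro conjI holomorphic_on_mult[OF holomorphic_on_const] sq_integrable_cmult) auto

lemma bargmann_fock_plane_vec:
  assumes "f \<in> bargmann_fock_plane \<nu>"
  shows "(\<lambda>z :: complex^1. f (z $ 1)) \<in> bargmann_fock \<nu>"
proof -
  have hol: "f holomorphic_on UNIV" and sq: "sq_integrable (gauss_measure \<nu>) f"
    using assms by (auto simp: bargmann_fock_plane_iff)
  have h: "holomorphic_Cn (\<lambda>z :: complex^1. f (z $ 1))"
    by (rule holomorphic_Cn_comp[OF hol]) (auto intro: bounded_linear_vec_nth)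
  have m: "(\<lambda>z :: complex^1. (norm (f (z $ 1)))\<^sup>2) \<in> borel_measurable borel"
    using holomorphic_Cn_measurable[OF h] by measurable
  have "integrable (gauss_measure \<nu>) (\<lambda>z :: complex^1. (norm (f (z $ 1)))\<^sup>2)"
    by (subst gauss_measure_Basis_iso_integral(2)[OF vec_Basis_iso m, symmetric])
      (use sq in \<open>simp add: sq_integrable_def\<close>)
  then show ?thesis using h by (simp add: bargmann_fock_def)
qed

lemma plane_reproducing:
  assumes \<nu>: "\<nu> > 0" and f: "f \<in> bargmann_fock_plane \<nu>"
  shows "integrable (gauss_measure \<nu>) (\<lambda>z. exp (of_real \<nu> * w * cnj z) * f z)"
    and "(LINT z|gauss_measure \<nu>. exp (of_real \<nu> * w * cnj z) * f z) = of_real (pi / \<nu>) * f w"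
proof -
  note F = bargmann_fock_plane_vec[OF f]
  have sq: "sq_integrable (gauss_measure \<nu>) f" using f by (simp add: bargmann_fock_plane_iff)
  show "integrable (gauss_measure \<nu>) (\<lambda>z. exp (of_real \<nu> * w * cnj z) * f z)"
    by (rule sq_integrable_mult[OF plane_kernel_sq_integrable[OF \<nu>] sq])
  have [measurable]: "(\<lambda>z :: complex^1. f (z $ 1)) \<in> borel_measurable borel"
    using F by (auto simp: bargmann_fock_def intro: holomorphic_Cn_measurable)
  have "(LINT z|gauss_measure \<nu>. fock_kernel \<nu> (vec w) (vec z :: complex^1) * f (vec z $ (1::1))) =
      (LINT z|gauss_measure \<nu>. fock_kernel \<nu> (vec w) (z :: complex^1) * f (z $ 1))"
    by (rule gauss_measure_Basis_iso_integral(1)[OF vec_Basis_iso]) measurable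
  also have "\<dots> = of_real (pi / \<nu>) * f w"
    using fock_reproducing(2)[OF \<nu> F, of "vec w"] by simp
  finally show "(LINT z|gauss_measure \<nu>. exp (of_real \<nu> * w * cnj z) * f z) = of_real (pi / \<nu>) * f w"
    by (simp add: fock_kernel_vec)
qed

text \<open>Schur's test: conjugated by the Gaussian weight, the kernel is dominated by the
  convolution kernel \<open>exp (- \<nu> |\<xi> - w|\<^sup>2 / 2)\<close>.\<close>

lemma fock_kernel_Schur:
  fixes g :: "'a::euclidean_space \<Rightarrow> complex"
  assumes \<nu>: "\<nu> > 0" and g: "sq_integrable (gauss_measure \<nu>) g"
  shows "(\<integral>\<^sup>+\<xi>. (\<integral>\<^sup>+w. ennreal (exp (\<nu> * (\<xi> \<bullet> w)) * norm (g w)) \<partial>gauss_measure \<nu>)\<^sup>2 \<partial>gauss_measure \<nu>) < \<infinity>"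
proof -
  have [measurable]: "g \<in> borel_measurable borel" by (rule sq_integrable_gauss_measurable[OF g])
  \<comment> \<open>\<open>s\<close> is the square root of the convolution kernel, so that
    Cauchy-Schwarz can split the kernel evenly. \<open>G\<close> carries half of the Gaussian
    exponent, so its Lebesgue L2 norm is the Gaussian L2 norm of \<open>g\<close>.\<close>
  define s where "s u = exp (- (\<nu> / 4) * (norm u)\<^sup>2)" for u :: 'a
  define G where "G w = exp (- (\<nu> / 2) * (norm w)\<^sup>2) * norm (g w)" for w
  have [measurable]: "s \<in> borel_measurable borel" "G \<in> borel_measurable borel"
    unfolding s_def G_def by measurable
  have pos: "s u \<ge> 0" "G u \<ge> 0" for u by (auto simp: s_def G_def)
  define \<kappa> where "\<kappa> = (\<integral>\<^sup>+u. ennreal ((s u)\<^sup>2) \<partial>lborel)"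
  have s2: "(s u)\<^sup>2 = exp (- (\<nu> / 2) * (norm u)\<^sup>2)" for u
    by (simp add: s_def flip: exp_double)
  have "integrable (gauss_measure (\<nu> / 2)) (\<lambda>u :: 'a. exp (0 * (norm u)\<^sup>2) :: real)"
    by (rule integrable_gauss_measure_exp) (use \<nu> in simp)
  then have "integrable lborel (\<lambda>u :: 'a. exp (- (\<nu> / 2) * (norm u)\<^sup>2) *\<^sub>R (exp (0 * (norm u)\<^sup>2) :: real))"
    by (subst (asm) integrable_gauss_measure) auto
  then have "integrable lborel (\<lambda>u. (s u)\<^sup>2)" by (simp add: s2)
  then have \<kappa>: "\<kappa> < \<infinity>"
    unfolding \<kappa>_def by (subst nn_integral_eq_integral) auto
  have sh: "(\<integral>\<^sup>+w. ennreal ((s (\<xi> - w))\<^sup>2) \<partial>lborel) = \<kappa>" "(\<integral>\<^sup>+w. ennreal ((s (w - \<xi>))\<^sup>2) \<partial>lborel) = \<kappa>" for \<xi>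
  proof -
    have d: "distr lborel borel ((+) (- \<xi>)) = (lborel :: 'a measure)" by (rule lborel_distr_plus)
    have "(\<integral>\<^sup>+w. ennreal ((s (- \<xi> + w))\<^sup>2) \<partial>lborel) = (\<integral>\<^sup>+w. ennreal ((s w)\<^sup>2) \<partial>distr lborel borel ((+) (- \<xi>)))"
      by (subst nn_integral_distr) auto
    then have *: "(\<integral>\<^sup>+w. ennreal ((s (- \<xi> + w))\<^sup>2) \<partial>lborel) = \<kappa>" by (simp add: d \<kappa>_def)
    then show "(\<integral>\<^sup>+w. ennreal ((s (w - \<xi>))\<^sup>2) \<partial>lborel) = \<kappa>" by simp
    with * show "(\<integral>\<^sup>+w. ennreal ((s (\<xi> - w))\<^sup>2) \<partial>lborel) = \<kappa>"
      by (simp add: s_def norm_minus_commute)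
  qed
  define \<Phi> where "\<Phi> \<xi> = (\<integral>\<^sup>+w. ennreal (exp (\<nu> * (\<xi> \<bullet> w)) * norm (g w)) \<partial>gauss_measure \<nu>)" for \<xi>
  have gm: "gauss_measure \<nu> = density lborel (\<lambda>x :: 'a. ennreal (exp (- \<nu> * (norm x)\<^sup>2)))"
    by (rule gauss_measure_def)
  have \<Phi>: "ennreal (exp (- \<nu> * (norm \<xi>)\<^sup>2)) * (\<Phi> \<xi>)\<^sup>2 =
      (\<integral>\<^sup>+w. ennreal (s (\<xi> - w)) * ennreal (s (\<xi> - w) * G w) \<partial>lborel)\<^sup>2" for \<xi>
  proof -
    \<comment> \<open>The polarisation -\<nu> |\<xi>|^2 / 2 + \<nu> (\<xi> \<bullet> w) - \<nu>
      |w|^2 / 2 = -\<nu> |\<xi> - w|^2 / 2. Only half of the weight in \<xi> enters, because the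
      inner integral is squared afterwards.\<close>
    have e: "exp (- (\<nu> / 2) * (norm \<xi>)\<^sup>2) * (exp (- \<nu> * (norm w)\<^sup>2) * (exp (\<nu> * (\<xi> \<bullet> w)) * norm (g w))) =
      s (\<xi> - w) * (s (\<xi> - w) * G w)" for w
    proof -
      have "s (\<xi> - w) * (s (\<xi> - w) * G w) = (s (\<xi> - w))\<^sup>2 * G w" by (simp add: power2_eq_square)
      also have "\<dots> = exp (- (\<nu> / 2) * (norm (\<xi> - w))\<^sup>2 + - (\<nu> / 2) * (norm w)\<^sup>2) * norm (g w)"
        unfolding s2 G_def exp_add by simp
      also have "- (\<nu> / 2) * (norm (\<xi> - w))\<^sup>2 + - (\<nu> / 2) * (norm w)\<^sup>2 =
          - (\<nu> / 2) * (norm \<xi>)\<^sup>2 + (- \<nu> * (norm w)\<^sup>2 + \<nu> * (\<xi> \<bullet> w))"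
        unfolding power2_norm_eq_inner by (simp add: inner_diff_left inner_diff_right inner_commute algebra_simps)
      finally show ?thesis by (simp only: exp_add mult.assoc)
    qed
    have "ennreal (exp (- (\<nu> / 2) * (norm \<xi>)\<^sup>2)) * \<Phi> \<xi> =
       (\<integral>\<^sup>+w. ennreal (exp (- (\<nu> / 2) * (norm \<xi>)\<^sup>2)) * (ennreal (exp (- \<nu> * (norm w)\<^sup>2)) * ennreal (exp (\<nu> * (\<xi> \<bullet> w)) * norm (g w))) \<partial>lborel)"
      unfolding \<Phi>_def gm by (subst nn_integral_density, simp, simp, subst nn_integral_cmult) auto
    also have "\<dots> = (\<integral>\<^sup>+w. ennreal (s (\<xi> - w)) * ennreal (s (\<xi> - w) * G w) \<partial>lborel)"
      using e pos by (intro nn_integral_cong) (simp add: ennreal_mult[symmetric])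
    finally have "(\<integral>\<^sup>+w. ennreal (s (\<xi> - w)) * ennreal (s (\<xi> - w) * G w) \<partial>lborel)\<^sup>2 =
       (ennreal (exp (- (\<nu> / 2) * (norm \<xi>)\<^sup>2)))\<^sup>2 * (\<Phi> \<xi>)\<^sup>2"
      unfolding power_mult_distrib[symmetric] by (rule arg_cong[OF sym])
    also have "(ennreal (exp (- (\<nu> / 2) * (norm \<xi>)\<^sup>2)))\<^sup>2 = ennreal (exp (- \<nu> * (norm \<xi>)\<^sup>2))"
      by (simp add: ennreal_power flip: exp_double)
    finally show ?thesis ..
  qed
  have [measurable]: "\<Phi> \<in> borel_measurable borel"
  proof -
    interpret finite_measure "gauss_measure \<nu> :: 'a measure" by (rule finite_measure_gauss[OF \<nu>])
    show ?thesis unfolding \<Phi>_def by measurable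
  qed
  have "(\<integral>\<^sup>+\<xi>. (\<Phi> \<xi>)\<^sup>2 \<partial>gauss_measure \<nu>) =
      (\<integral>\<^sup>+\<xi>. (\<integral>\<^sup>+w. ennreal (s (\<xi> - w)) * ennreal (s (\<xi> - w) * G w) \<partial>lborel)\<^sup>2 \<partial>lborel)"
    unfolding gm by (subst nn_integral_density, simp, simp) (simp only: \<Phi>)
  \<comment> \<open>The first \<open>\<kappa>\<close> comes from Cauchy-Schwarz in w; the second
    appears below, when the translated kernel is integrated in \<xi>.\<close>
  also have "\<dots> \<le> (\<integral>\<^sup>+\<xi>. \<kappa> * (\<integral>\<^sup>+w. ennreal ((s (\<xi> - w))\<^sup>2) * ennreal ((G w)\<^sup>2) \<partial>lborel) \<partial>lborel)"
  proof (intro nn_integral_mono)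
    fix \<xi> :: 'a
    have "(\<integral>\<^sup>+w. ennreal (s (\<xi> - w)) * ennreal (s (\<xi> - w) * G w) \<partial>lborel)\<^sup>2 \<le>
      (\<integral>\<^sup>+w. (ennreal (s (\<xi> - w)))\<^sup>2 \<partial>lborel) * (\<integral>\<^sup>+w. (ennreal (s (\<xi> - w) * G w))\<^sup>2 \<partial>lborel)"
      by (rule Cauchy_Schwarz_nn_integral) measurable
    also have "\<dots> = \<kappa> * (\<integral>\<^sup>+w. ennreal ((s (\<xi> - w))\<^sup>2) * ennreal ((G w)\<^sup>2) \<partial>lborel)"
      using pos sh(1)[of \<xi>] by (simp add: ennreal_power power_mult_distrib ennreal_mult)
    finally show "(\<integral>\<^sup>+w. ennreal (s (\<xi> - w)) * ennreal (s (\<xi> - w) * G w) \<partial>lborel)\<^sup>2 \<le>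
      \<kappa> * (\<integral>\<^sup>+w. ennreal ((s (\<xi> - w))\<^sup>2) * ennreal ((G w)\<^sup>2) \<partial>lborel)" .
  qed
  also have "\<dots> = \<kappa> * (\<integral>\<^sup>+\<xi>. (\<integral>\<^sup>+w. ennreal ((s (\<xi> - w))\<^sup>2) * ennreal ((G w)\<^sup>2) \<partial>lborel) \<partial>lborel)"
    by (rule nn_integral_cmult) measurable
  also have "(\<integral>\<^sup>+\<xi>. (\<integral>\<^sup>+w. ennreal ((s (\<xi> - w))\<^sup>2) * ennreal ((G w)\<^sup>2) \<partial>lborel) \<partial>lborel) =
      (\<integral>\<^sup>+w. (\<integral>\<^sup>+\<xi>. ennreal ((s (\<xi> - w))\<^sup>2) * ennreal ((G w)\<^sup>2) \<partial>lborel) \<partial>lborel)"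
    by (rule lborel_pair.Fubini') measurable
  also have "\<dots> = \<kappa> * (\<integral>\<^sup>+w. ennreal ((G w)\<^sup>2) \<partial>lborel)"
    by (simp add: nn_integral_multc sh nn_integral_cmult)
  also have "(\<integral>\<^sup>+w. ennreal ((G w)\<^sup>2) \<partial>lborel) = (\<integral>\<^sup>+w. ennreal ((norm (g w))\<^sup>2) \<partial>gauss_measure \<nu>)"
  proof -
    have "(G w)\<^sup>2 = exp (- \<nu> * (norm w)\<^sup>2) * (norm (g w))\<^sup>2" for w
      by (simp add: G_def power_mult_distrib flip: exp_double)
    then show ?thesis
      unfolding gm by (subst nn_integral_density) (auto simp: ennreal_mult)
  qed
  also have "\<kappa> * (\<kappa> * \<dots>) < \<infinity>"
    using g \<kappa> by (auto simp: sq_integrable_def integrable_iff_bounded ennreal_mult_less_top)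
  finally show ?thesis by (simp add: \<Phi>_def)
qed

section \<open>The orthogonal projection\<close>

text \<open>Point evaluation is bounded by the norm through the reproducing formula, so a null
  vector vanishes at every point and not merely almost everywhere. This makes the \<open>THE\<close>
  in \<open>fock_proj\<close> unique.\<close>

lemma plane_fock_unique:
  assumes \<nu>: "\<nu> > 0" and d: "d \<in> bargmann_fock_plane \<nu>"
    and 0: "(LINT z|gauss_measure \<nu>. d z * cnj (d z)) = 0"
  shows "d w = 0"
proof -
  have sq: "sq_integrable (gauss_measure \<nu>) d" using d by (simp add: bargmann_fock_plane_iff)
  have "complex_of_real (LINT z|gauss_measure \<nu>. (norm (d z))\<^sup>2) = 0"
    using 0 unfolding complex_norm_square[symmetric] integral_complex_of_real .
  then have "(LINT z|gauss_measure \<nu>. (norm (d z))\<^sup>2) = 0" by simp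
  with sq_integrable_Cauchy_Schwarz[OF plane_kernel_sq_integrable[OF \<nu>, of w] sq]
  have "of_real (pi / \<nu>) * d w = 0" unfolding plane_reproducing(2)[OF \<nu> d] by simp
  then show ?thesis using \<nu> by simp
qed

text \<open>The integral operator with the Fock kernel is the orthogonal projection: its kernel is
  Hermitian and reproduces Fock functions. Holomorphy of \<open>h\<close> is taken as a hypothesis
  because in the application \<open>h\<close> is known to be a multiple of F o
  \<open>psi2\<close>.\<close>

lemma fock_proj_eq:
  assumes \<nu>: "\<nu> > 0" and g: "sq_integrable (gauss_measure \<nu>) g"
    and h: "\<And>\<xi>. h \<xi> = of_real (\<nu> / pi) * (LINT w|gauss_measure \<nu>. exp (of_real \<nu> * \<xi> * cnj w) * g w)"
    and hol: "h holomorphic_on UNIV"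
  shows "h \<in> bargmann_fock_plane \<nu>" and "fock_proj \<nu> g = h"
proof -
  let ?\<mu> = "gauss_measure \<nu> :: complex measure"
  let ?e = "\<lambda>\<xi> w. exp (of_real \<nu> * \<xi> * cnj w)"
  interpret \<mu>: finite_measure ?\<mu> by (rule finite_measure_gauss[OF \<nu>])
  interpret pair_sigma_finite ?\<mu> ?\<mu> ..
  have gm[measurable]: "g \<in> borel_measurable borel" by (rule sq_integrable_gauss_measurable[OF g])
  have hm[measurable]: "h \<in> borel_measurable borel"
    using hol by (intro borel_measurable_continuous_onI holomorphic_on_imp_continuous_on)
  have ne: "norm (?e \<xi> w) = exp (\<nu> * (\<xi> \<bullet> w))" for \<xi> w
    by (simp add: norm_exp_eq_Re inner_complex_def algebra_simps)
  have em: "(\<lambda>p. ?e (fst p) (snd p)) \<in> borel_measurable (?\<mu> \<Otimes>\<^sub>M ?\<mu>)"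
  proof -
    have "(\<lambda>p. ?e (fst p) (snd p)) \<in> borel_measurable (borel \<Otimes>\<^sub>M borel)"
      unfolding borel_prod by (intro borel_measurable_continuous_onI continuous_intros)
    moreover have "sets (?\<mu> \<Otimes>\<^sub>M ?\<mu>) = sets (borel \<Otimes>\<^sub>M borel)"
      by (intro sets_pair_measure_cong) auto
    ultimately show ?thesis by (simp cong: measurable_cong_sets)
  qed
  have ie: "integrable ?\<mu> (\<lambda>w. ?e \<xi> w * g w)" for \<xi>
    by (rule sq_integrable_mult[OF plane_kernel_sq_integrable[OF \<nu>] g])
  define \<Phi> where "\<Phi> \<xi> = (\<integral>\<^sup>+w. ennreal (exp (\<nu> * (\<xi> \<bullet> w)) * norm (g w)) \<partial>?\<mu>)" for \<xi>
  have [measurable]: "\<Phi> \<in> borel_measurable borel" unfolding \<Phi>_def by measurable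
  have Schur: "(\<integral>\<^sup>+\<xi>. (\<Phi> \<xi>)\<^sup>2 \<partial>?\<mu>) < \<infinity>"
    unfolding \<Phi>_def by (rule fock_kernel_Schur[OF \<nu> g])
  have h\<Phi>: "ennreal (norm (h \<xi>)) \<le> ennreal (\<nu> / pi) * \<Phi> \<xi>" for \<xi>
  proof -
    have "ennreal (norm (LINT w|?\<mu>. ?e \<xi> w * g w)) \<le> \<Phi> \<xi>"
      unfolding \<Phi>_def using integral_norm_bound_ennreal[OF ie[of \<xi>]] by (simp only: norm_mult ne)
    then have "ennreal (\<nu> / pi) * ennreal (norm (LINT w|?\<mu>. ?e \<xi> w * g w)) \<le> ennreal (\<nu> / pi) * \<Phi> \<xi>"
      by (rule mult_left_mono) simp
    then show ?thesis
      using \<nu> by (simp add: h norm_mult norm_divide ennreal_mult[symmetric])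
  qed
  have "(\<integral>\<^sup>+\<xi>. ennreal ((norm (h \<xi>))\<^sup>2) \<partial>?\<mu>) \<le> (\<integral>\<^sup>+\<xi>. (ennreal (\<nu> / pi))\<^sup>2 * (\<Phi> \<xi>)\<^sup>2 \<partial>?\<mu>)"
    using power_mono[OF h\<Phi>, where n = 2]
    by (intro nn_integral_mono) (simp add: ennreal_power power_mult_distrib)
  also have "\<dots> = (ennreal (\<nu> / pi))\<^sup>2 * (\<integral>\<^sup>+\<xi>. (\<Phi> \<xi>)\<^sup>2 \<partial>?\<mu>)"
    by (rule nn_integral_cmult) measurable
  also have "\<dots> < \<infinity>" using Schur by (simp add: ennreal_mult_less_top power2_eq_square)
  finally have sqh: "sq_integrable ?\<mu> h" by (simp add: sq_integrable_def integrable_iff_bounded)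
  show plane: "h \<in> bargmann_fock_plane \<nu>" using hol sqh by (simp add: bargmann_fock_plane_iff)
  have orth: "(LINT z|?\<mu>. (g z - h z) * cnj (k z)) = 0" if k: "k \<in> bargmann_fock_plane \<nu>" for k
  proof -
    have sqk: "sq_integrable ?\<mu> k" using k by (simp add: bargmann_fock_plane_iff)
    have [measurable]: "k \<in> borel_measurable borel" by (rule sq_integrable_gauss_measurable[OF sqk])
    \<comment> \<open>The inner integral of absolute values is \<open>\<Phi>\<close>, square
      integrable by the Schur estimate, so its pairing with the square integrable \<open>k\<close>
      is finite.\<close>
    have int: "integrable (?\<mu> \<Otimes>\<^sub>M ?\<mu>) (\<lambda>(\<xi>, w). ?e \<xi> w * g w * cnj (k \<xi>))"
    proof (rule integrableI_bounded)
      show "(\<lambda>(\<xi>, w). ?e \<xi> w * g w * cnj (k \<xi>)) \<in> borel_measurable (?\<mu> \<Otimes>\<^sub>M ?\<mu>)"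
        unfolding case_prod_unfold by (intro borel_measurable_times measurable_cnj em) measurable
      have m: "(\<lambda>(\<xi>, w). ennreal (exp (\<nu> * (\<xi> \<bullet> w)) * norm (g w) * norm (k \<xi>))) \<in> borel_measurable (?\<mu> \<Otimes>\<^sub>M ?\<mu>)"
        by measurable
      have "(\<integral>\<^sup>+p. ennreal (norm (case p of (\<xi>, w) \<Rightarrow> ?e \<xi> w * g w * cnj (k \<xi>))) \<partial>(?\<mu> \<Otimes>\<^sub>M ?\<mu>)) =
          (\<integral>\<^sup>+(\<xi>, w). ennreal (exp (\<nu> * (\<xi> \<bullet> w)) * norm (g w) * norm (k \<xi>)) \<partial>(?\<mu> \<Otimes>\<^sub>M ?\<mu>))"
        unfolding case_prod_unfold norm_mult ne complex_mod_cnj ..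
      also have "\<dots> = (\<integral>\<^sup>+\<xi>. \<integral>\<^sup>+w. ennreal (exp (\<nu> * (\<xi> \<bullet> w)) * norm (g w) * norm (k \<xi>)) \<partial>?\<mu> \<partial>?\<mu>)"
        using \<mu>.nn_integral_fst[OF m] by simp
      also have "\<dots> = (\<integral>\<^sup>+\<xi>. \<Phi> \<xi> * ennreal (norm (k \<xi>)) \<partial>?\<mu>)"
        unfolding \<Phi>_def by (intro nn_integral_cong) (simp add: ennreal_mult nn_integral_multc)
      finally have eq: "(\<integral>\<^sup>+p. ennreal (norm (case p of (\<xi>, w) \<Rightarrow> ?e \<xi> w * g w * cnj (k \<xi>))) \<partial>(?\<mu> \<Otimes>\<^sub>M ?\<mu>)) =
        (\<integral>\<^sup>+\<xi>. \<Phi> \<xi> * ennreal (norm (k \<xi>)) \<partial>?\<mu>)" .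
      have "(\<integral>\<^sup>+\<xi>. \<Phi> \<xi> * ennreal (norm (k \<xi>)) \<partial>?\<mu>)\<^sup>2 \<le>
          (\<integral>\<^sup>+\<xi>. (\<Phi> \<xi>)\<^sup>2 \<partial>?\<mu>) * (\<integral>\<^sup>+\<xi>. (ennreal (norm (k \<xi>)))\<^sup>2 \<partial>?\<mu>)"
        by (rule Cauchy_Schwarz_nn_integral) measurable
      also have "\<dots> < \<infinity>"
        using Schur sqk by (auto simp: sq_integrable_def integrable_iff_bounded ennreal_mult_less_top ennreal_power)
      finally show "(\<integral>\<^sup>+p. ennreal (norm (case p of (\<xi>, w) \<Rightarrow> ?e \<xi> w * g w * cnj (k \<xi>))) \<partial>(?\<mu> \<Otimes>\<^sub>M ?\<mu>)) < \<infinity>"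
        unfolding eq by (simp add: power_less_top_ennreal)
    qed
    have "(LINT \<xi>|?\<mu>. h \<xi> * cnj (k \<xi>)) = (LINT \<xi>|?\<mu>. of_real (\<nu> / pi) * (LINT w|?\<mu>. ?e \<xi> w * g w * cnj (k \<xi>)))"
      by (simp add: h mult.assoc[symmetric])
    also have "\<dots> = of_real (\<nu> / pi) * (LINT \<xi>|?\<mu>. LINT w|?\<mu>. ?e \<xi> w * g w * cnj (k \<xi>))"
      by (rule integral_mult_right_zero)
    also have "(LINT \<xi>|?\<mu>. LINT w|?\<mu>. ?e \<xi> w * g w * cnj (k \<xi>)) = (LINT w|?\<mu>. LINT \<xi>|?\<mu>. ?e \<xi> w * g w * cnj (k \<xi>))"
      by (rule Fubini_integral[OF int, symmetric])
    also have "\<dots> = (LINT w|?\<mu>. of_real (pi / \<nu>) * (g w * cnj (k w)))"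
    proof (rule Bochner_Integration.integral_cong[OF refl])
      fix w
      \<comment> \<open>Hermitian symmetry: after the exchange of integrals the kernel acts on
        \<open>k\<close>, which it reproduces.\<close>
      have c: "?e \<xi> w = cnj (?e w \<xi>)" for \<xi> by (simp add: exp_cnj mult.commute mult.left_commute)
      have "(LINT \<xi>|?\<mu>. ?e \<xi> w * g w * cnj (k \<xi>)) = (LINT \<xi>|?\<mu>. g w * cnj (?e w \<xi> * k \<xi>))"
        unfolding c by (simp add: mult_ac)
      also have "\<dots> = g w * (LINT \<xi>|?\<mu>. cnj (?e w \<xi> * k \<xi>))" by (rule integral_mult_right_zero)
      also have "(LINT \<xi>|?\<mu>. cnj (?e w \<xi> * k \<xi>)) = cnj (LINT \<xi>|?\<mu>. ?e w \<xi> * k \<xi>)"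
        by (rule Bochner_Integration.integral_cnj)
      also have "\<dots> = of_real (pi / \<nu>) * cnj (k w)"
        unfolding plane_reproducing(2)[OF \<nu> k] by simp
      finally show "(LINT \<xi>|?\<mu>. ?e \<xi> w * g w * cnj (k \<xi>)) = of_real (pi / \<nu>) * (g w * cnj (k w))" by simp
    qed
    also have "of_real (\<nu> / pi) * \<dots> = (LINT w|?\<mu>. g w * cnj (k w))" using \<nu> by simp
    finally have "(LINT \<xi>|?\<mu>. h \<xi> * cnj (k \<xi>)) = (LINT w|?\<mu>. g w * cnj (k w))" .
    then show ?thesis
      using sq_integrable_mult[OF g sq_integrable_cnj[OF sqk]] sq_integrable_mult[OF sqh sq_integrable_cnj[OF sqk]]
      by (simp add: left_diff_distrib)
  qed
  show "fock_proj \<nu> g = h"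
    unfolding fock_proj_def
  proof (rule the_equality)
    show "h \<in> bargmann_fock_plane \<nu> \<and> (\<forall>k\<in>bargmann_fock_plane \<nu>. (LINT z|?\<mu>. (g z - h z) * cnj (k z)) = 0)"
      using plane orth by blast
    fix h'
    assume h': "h' \<in> bargmann_fock_plane \<nu> \<and> (\<forall>k\<in>bargmann_fock_plane \<nu>. (LINT z|?\<mu>. (g z - h' z) * cnj (k z)) = 0)"
    then have sqh': "sq_integrable ?\<mu> h'" and holh': "h' holomorphic_on UNIV" by (auto simp: bargmann_fock_plane_iff)
    define d where "d z = h' z - h z" for z
    have d: "d \<in> bargmann_fock_plane \<nu>"
      unfolding bargmann_fock_plane_iff d_def
      by (intro conjI holomorphic_on_diff holh' hol sq_integrable_diff sqh' sqh)
    have sqd: "sq_integrable ?\<mu> (\<lambda>z. cnj (d z))"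
      using d by (intro sq_integrable_cnj) (simp add: bargmann_fock_plane_iff)
    \<comment> \<open>The difference of two candidates is orthogonal to the whole Fock space, hence
      to itself.\<close>
    have "(LINT z|?\<mu>. d z * cnj (d z)) = (LINT z|?\<mu>. (g z - h z) * cnj (d z) - (g z - h' z) * cnj (d z))"
      by (simp add: d_def left_diff_distrib)
    also have "\<dots> = (LINT z|?\<mu>. (g z - h z) * cnj (d z)) - (LINT z|?\<mu>. (g z - h' z) * cnj (d z))"
      by (intro Bochner_Integration.integral_diff sq_integrable_mult sq_integrable_diff g sqh sqh' sqd)
    also have "\<dots> = 0" using orth[OF d] h' d by simp
    finally have "d z = 0" for z by (rule plane_fock_unique[OF \<nu> d])
    then show "h' = h" by (auto simp: d_def fun_eq_iff)
  qed
qed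

text \<open>The coordinates of \<open>psi2 \<xi>\<close> have squares summing to 0, so the quadratic
  part of the exponent vanishes; the linear part is \<xi> (Re w - \<i> Im w) = \<xi> cnj w. This
  isotropy is what singles out \<open>psi2\<close>.\<close>

lemma sb_kernel_psi2:
  "sb_kernel \<nu> (psi2 \<xi>) (vector [Re w, Im w]) = exp (of_real \<nu> * \<xi> * cnj w)"
proof -
  have r: "complex_of_real (sqrt 2) * complex_of_real (sqrt 2) = 2"
    unfolding of_real_mult[symmetric] by simp
  have c: "cnj w = of_real (Re w) - \<i> * of_real (Im w)" by (simp add: complex_eq_iff)
  show ?thesis
    unfolding c sb_kernel_def psi2_def
    by (simp add: sum_2 power_divide power2_eq_square r power_mult_distrib algebra_simps)
qed

text \<open>The result is stated through a preimage \<phi> because the inverse transform yields only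
  some representative; that \<phi> transforms to h is all the quaternionic transform needs to
  know.\<close>

lemma R_transform_preimage:
  fixes F :: "complex^2 \<Rightarrow> complex"
  assumes \<nu>: "\<nu> > 0" and F: "F \<in> bargmann_fock \<nu>"
  defines "h \<equiv> \<lambda>\<xi>. of_real (sqrt (pi / \<nu>)) * F (psi2 \<xi>)"
  shows "h \<in> bargmann_fock_plane \<nu>"
    and "\<exists>\<phi> \<in> gauss_L2 \<nu>. segal_bargmann \<nu> \<phi> = (\<lambda>z :: complex^1. h (z $ 1)) \<and> R_transform \<nu> F = (\<lambda>t. \<phi> (vec t))"
proof -
  define f where "f = segal_bargmann_inv \<nu> F"
  have f: "sq_integrable (gauss_measure \<nu>) f" and Bf: "segal_bargmann \<nu> f = F"
    using segal_bargmann_inv[OF \<nu> F] by (simp_all add: f_def gauss_L2_iff)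
  have fm[measurable]: "f \<in> borel_measurable borel" by (rule sq_integrable_gauss_measurable[OF f])
  define g where "g w = f (vector [Re w, Im w])" for w
  have g: "sq_integrable (gauss_measure \<nu>) g"
    unfolding g_def by (rule sq_integrable_Basis_iso[OF complex_real2_Basis_iso f])
  have hg: "h \<xi> = of_real (\<nu> / pi) * (LINT w|gauss_measure \<nu>. exp (of_real \<nu> * \<xi> * cnj w) * g w)" for \<xi>
  proof -
    define J where "J = (LINT w|gauss_measure \<nu>. exp (of_real \<nu> * \<xi> * cnj w) * g w)"
    have "J = (LINT w|gauss_measure \<nu>. f (vector [Re w, Im w]) * sb_kernel \<nu> (psi2 \<xi>) (vector [Re w, Im w]))"
      unfolding J_def sb_kernel_psi2 g_def by (simp add: mult.commute)
    also have "\<dots> = (LINT x|gauss_measure \<nu>. f x * sb_kernel \<nu> (psi2 \<xi>) x)"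
      by (rule gauss_measure_Basis_iso_integral(1)[OF complex_real2_Basis_iso]) measurable
    finally have "F (psi2 \<xi>) = of_real ((\<nu> / pi) powr (3 / 2)) * J"
      unfolding Bf[symmetric] segal_bargmann_eq[OF fm] by simp
    then have "h \<xi> = of_real (sqrt (pi / \<nu>) * (\<nu> / pi) powr (3 / 2)) * J" by (simp add: h_def)
    \<comment> \<open>This identity fixes the factor in \<open>h\<close>: 3 / 2 is the exponent 3 d
      / 4 for d = 2, and \<nu> / pi is the factor of the plane projection.\<close>
    also have "sqrt (pi / \<nu>) * (\<nu> / pi) powr (3 / 2) = \<nu> / pi"
    proof -
      have p: "\<nu> / pi > 0" using \<nu> by simp
      have "(\<nu> / pi) powr (3 / 2) = (\<nu> / pi) powr 1 * (\<nu> / pi) powr (1 / 2)"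
        unfolding powr_add[symmetric] by simp
      also have "\<dots> = \<nu> / pi * sqrt (\<nu> / pi)" using p assms(1) by (simp add: powr_half_sqrt)
      finally have "sqrt (pi / \<nu>) * (\<nu> / pi) powr (3 / 2) = \<nu> / pi * sqrt (pi / \<nu> * (\<nu> / pi))"
        unfolding real_sqrt_mult by simp
      then show ?thesis using \<nu> by simp
    qed
    finally show ?thesis by (simp add: J_def)
  qed
  have hol: "h holomorphic_on UNIV"
  proof -
    \<comment> \<open>\<open>psi2\<close> parametrises a complex line through the origin.\<close>
    have line: "psi2 \<xi> = 0 + \<xi> *s psi2 1" for \<xi>
      by (auto simp: psi2_def vec_eq_iff forall_2)
    have "(\<lambda>\<xi>. F (0 + \<xi> *s psi2 1)) holomorphic_on UNIV"
      by (rule holomorphic_Cn_line) (use F in \<open>simp add: bargmann_fock_def\<close>)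
    then have "(\<lambda>\<xi>. F (psi2 \<xi>)) holomorphic_on UNIV"
      unfolding line[symmetric] .
    then show ?thesis unfolding h_def by (intro holomorphic_intros)
  qed
  note P = fock_proj_eq[OF \<nu> g hg hol]
  show plane: "h \<in> bargmann_fock_plane \<nu>" by (rule P(1))
  define \<phi> where "\<phi> = segal_bargmann_inv \<nu> (\<lambda>z :: complex^1. h (z $ 1))"
  have "\<phi> \<in> gauss_L2 \<nu>" "segal_bargmann \<nu> \<phi> = (\<lambda>z. h (z $ 1))"
    unfolding \<phi>_def by (rule segal_bargmann_inv[OF \<nu> bargmann_fock_plane_vec[OF plane]])+
  moreover have "R_transform \<nu> F = (\<lambda>t. \<phi> (vec t))"
    unfolding R_transform_def Let_def \<phi>_def P(2)[symmetric] g_def f_def ..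
  ultimately show "\<exists>\<phi> \<in> gauss_L2 \<nu>. segal_bargmann \<nu> \<phi> = (\<lambda>z :: complex^1. h (z $ 1)) \<and> R_transform \<nu> F = (\<lambda>t. \<phi> (vec t))"
    by blast
qed

section \<open>The quaternionic transform\<close>

lemma slice_embed_eq: "slice_embed J z = Re z *\<^sub>R 1 + Im z *\<^sub>R J"
  by (simp add: slice_embed_def of_real_def)

lemma bounded_linear_slice_embed: "bounded_linear (slice_embed J)"
  unfolding linear_conv_bounded_linear[symmetric] slice_embed_eq[abs_def]
  by (rule linearI) (auto simp: scaleR_add_left scaleR_add_right)

lemmas slice_embed_linear =
  linear_add[OF bounded_linear.linear[OF bounded_linear_slice_embed]]
  linear_diff[OF bounded_linear.linear[OF bounded_linear_slice_embed]]
  linear_cmul[OF bounded_linear.linear[OF bounded_linear_slice_embed]]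

lemma imag_unit_square: "J \<in> imag_units \<Longrightarrow> J * J = -1"
  by (simp add: imag_units_def power2_eq_square)

lemma slice_embed_mult:
  assumes "J \<in> imag_units"
  shows "slice_embed J (a * b) = slice_embed J a * slice_embed J b"
  by (simp add: slice_embed_eq distrib_left distrib_right imag_unit_square[OF assms] scaleR_diff_left scaleR_add_left algebra_simps)

lemma slice_embed_of_real: "slice_embed J (of_real r) = of_real r"
  by (simp add: slice_embed_eq of_real_def)

lemma slice_embed_power:
  assumes "J \<in> imag_units"
  shows "slice_embed J (a ^ n) = slice_embed J a ^ n"
proof (induction n)
  case 0
  show ?case using slice_embed_of_real[of J 1] by simp
qed (simp add: slice_embed_mult[OF assms])

lemma slice_embed_exp:
  assumes "J \<in> imag_units"
  shows "slice_embed J (exp a) = exp (slice_embed J a)"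
  unfolding exp_def
  by (subst bounded_linear.suminf[OF bounded_linear_slice_embed summable_exp_generic])
    (simp add: slice_embed_linear slice_embed_power[OF assms])

text \<open>The product of elements from two different slices is the extension formula for the
  complex function w \<mapsto> w v: the half sum carries \<open>Re w\<close>, the half difference
  carries \<open>Im w\<close>, and \<open>J * I\<close> trades the unit I for J. Being real linear,
  the formula passes through series and integrals.\<close>

lemma slice_embed_mult_ext:
  assumes J: "J \<in> imag_units" and I: "I \<in> imag_units"
  shows "slice_embed J w * slice_embed I v =
    (1/2) *\<^sub>R (slice_embed I (w * v) + slice_embed I (cnj w * v)) +
    (1/2) *\<^sub>R (J * I * (slice_embed I (cnj w * v) - slice_embed I (w * v)))"
proof -
  have 1: "slice_embed I (w * v) + slice_embed I (cnj w * v) = (2 * Re w) *\<^sub>R slice_embed I v"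
    unfolding slice_embed_linear(1,3)[symmetric]
    by (rule arg_cong[of _ _ "slice_embed I"]) (simp add: complex_eq_iff)
  have 2: "slice_embed I (cnj w * v) - slice_embed I (w * v) = - ((2 * Im w) *\<^sub>R (I * slice_embed I v))"
  proof -
    have "slice_embed I (cnj w * v) - slice_embed I (w * v) = slice_embed I ((- 2 * Im w) *\<^sub>R (\<i> * v))"
      unfolding slice_embed_linear(2)[symmetric]
      by (rule arg_cong[of _ _ "slice_embed I"]) (simp add: complex_eq_iff)
    also have "\<dots> = (- 2 * Im w) *\<^sub>R (I * slice_embed I v)"
      unfolding slice_embed_linear(3) slice_embed_mult[OF I] by (simp add: slice_embed_eq)
    finally show ?thesis by simp
  qed
  have 3: "J * I * (I * x) = - (J * x)" for x
  proof -
    have "J * I * (I * x) = J * (I * I) * x" by (simp only: mult.assoc)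
    then show ?thesis by (simp add: imag_unit_square[OF I])
  qed
  show ?thesis
    unfolding 1 2 by (simp add: slice_embed_eq[of J] distrib_right 3)
qed

text \<open>Here a and b stand for the integrands at z and at cnj z, and K for \<open>J * I\<close>;
  the transform and the kernel integral both have this form.\<close>

lemma slice_ext_integral:
  fixes a b :: "'a \<Rightarrow> complex"
  assumes a: "has_bochner_integral M a A" and b: "has_bochner_integral M b B"
  shows "has_bochner_integral M
    (\<lambda>x. (1/2) *\<^sub>R (slice_embed I (a x) + slice_embed I (b x)) +
      (1/2) *\<^sub>R (K * (slice_embed I (b x) - slice_embed I (a x))))
    ((1/2) *\<^sub>R (slice_embed I A + slice_embed I B) + (1/2) *\<^sub>R (K * (slice_embed I B - slice_embed I A)))"
  using has_bochner_integral_bounded_linear[OF bounded_linear_slice_embed a]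
    has_bochner_integral_bounded_linear[OF bounded_linear_slice_embed b]
  by (intro has_bochner_integral_add has_bochner_integral_diff has_bochner_integral_scaleR_right has_bochner_integral_mult_right) auto

lemma quat_slice_cases:
  fixes q :: quat
  assumes I: "I \<in> imag_units"
  obtains J z where "J \<in> imag_units" "q = slice_embed J z"
proof -
  define v where "v = q - of_real (qre q)"
  define J where "J = (if v = 0 then I else v /\<^sub>R norm v)"
  have "J \<in> imag_units"
    using I by (auto simp: J_def imag_units_iff v_def)
  moreover have "q = slice_embed J (Complex (qre q) (norm v))"
    by (auto simp: slice_embed_def J_def v_def)
  ultimately show ?thesis using that by blast
qed

lemma slice_ext_slice_embed:
  assumes "J \<in> imag_units"
  shows "slice_ext I f (slice_embed J z) =
    (1/2) *\<^sub>R (slice_embed I (f z) + slice_embed I (f (cnj z))) +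
    (1/2) *\<^sub>R (J * I * (slice_embed I (f (cnj z)) - slice_embed I (f z)))"
  using slice_ext_eq[OF assms, of I f "Re z" "Im z"] unfolding slice_embed_def[of J]
  by (simp add: complex_cnj[symmetric] del: complex_cnj)

lemma slice_ext_cmult:
  "slice_ext I (\<lambda>z. of_real c * f z) q = c *\<^sub>R slice_ext I f q"
proof -
  have e: "slice_embed I (of_real c * w) = c *\<^sub>R slice_embed I w" for w
    unfolding slice_embed_linear(3)[symmetric] by (simp add: scaleR_conv_of_real[where 'a = complex])
  show ?thesis
    unfolding slice_ext_def Let_def e scaleR_diff_right[symmetric] scaleR_add_right[symmetric]
    by (simp add: scaleR_add_right mult.commute)
qed

lemma segal_bargmann_real1:
  fixes \<phi> :: "real^1 \<Rightarrow> complex"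
  assumes \<nu>: "\<nu> > 0" and \<phi>: "\<phi> \<in> gauss_L2 \<nu>"
  shows "has_bochner_integral lborel (\<lambda>t. exp (- of_real \<nu> * (of_real t - z / of_real (sqrt 2))\<^sup>2) * \<phi> (vec t))
    (segal_bargmann \<nu> \<phi> (vec z) / of_real ((\<nu> / pi) powr (3 / 4)))"
proof -
  have [measurable]: "\<phi> \<in> borel_measurable borel" using \<phi> by (simp add: gauss_L2_def)
  define f where "f x = \<phi> x * exp (- of_real \<nu> * (\<Sum>j\<in>UNIV. (of_real (x $ j) - vec z $ j / of_real (sqrt 2))\<^sup>2))" for x :: "real^1"
  have fm[measurable]: "f \<in> borel_measurable borel" unfolding f_def by measurable
  have "integrable lborel f"
    unfolding f_def by (rule segal_bargmann_integrable[OF \<nu> \<phi>])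
  then have "has_bochner_integral lborel f (segal_bargmann \<nu> \<phi> (vec z) / of_real ((\<nu> / pi) powr (3 / 4)))"
    using \<nu> by (simp add: has_bochner_integral_iff segal_bargmann_def f_def[abs_def])
  then have "has_bochner_integral (distr lborel borel (vec :: real \<Rightarrow> real^1)) f (segal_bargmann \<nu> \<phi> (vec z) / of_real ((\<nu> / pi) powr (3 / 4)))"
    unfolding lborel_distr_Basis_iso[OF vec_Basis_iso] .
  moreover have "(vec :: real \<Rightarrow> real^1) \<in> borel_measurable lborel"
    using linear_continuous_on[of "vec :: real \<Rightarrow> real^1" UNIV] vec_Basis_iso(1)[where 'a = real]
    by (simp add: linear_conv_bounded_linear borel_measurable_continuous_onI)
  ultimately have "has_bochner_integral lborel (\<lambda>t. f (vec t)) (segal_bargmann \<nu> \<phi> (vec z) / of_real ((\<nu> / pi) powr (3 / 4)))"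
    using fm by (simp add: has_bochner_integral_iff integrable_distr_eq integral_distr)
  then show ?thesis by (simp add: f_def mult.commute)
qed

text \<open>For real t the kernel at q lies in the slice of q and is the image of the complex kernel
  at z; its conjugate is the complex kernel at cnj z. Multiplying by values in the slice of I
  therefore gives the extension formula pointwise, and integration gives it for h.\<close>

lemma quat_segal_bargmann_slice:
  fixes \<phi> :: "real^1 \<Rightarrow> complex"
  assumes \<nu>: "\<nu> > 0" and I: "I \<in> imag_units" and \<phi>: "\<phi> \<in> gauss_L2 \<nu>"
    and h: "segal_bargmann \<nu> \<phi> = (\<lambda>z :: complex^1. h (z $ 1))"
  shows "quat_segal_bargmann \<nu> (slice_embed I \<circ> (\<lambda>t. \<phi> (vec t))) q = slice_ext I h q"
proof -
  obtain J z where J: "J \<in> imag_units" and q: "q = slice_embed J z"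
    using quat_slice_cases[OF I] by blast
  define c where "c = (\<nu> / pi) powr (3 / 4)"
  have c: "c > 0" using \<nu> by (simp add: c_def)
  define E where "E z t = exp (- of_real \<nu> * (of_real t - z / of_real (sqrt 2))\<^sup>2)" for z :: complex and t :: real
  have cE: "cnj (E z t) = E (cnj z) t" for t
    by (simp add: E_def exp_cnj)
  have hE: "has_bochner_integral lborel (\<lambda>t. E z t * \<phi> (vec t)) (of_real (1 / c) * h z)" for z
    using segal_bargmann_real1[OF \<nu> \<phi>, of z] by (simp add: h E_def c_def)
  have ex: "exp (- \<nu> *\<^sub>R (of_real t - q /\<^sub>R sqrt 2)\<^sup>2) = slice_embed J (E z t)" for t
  proof -
    have "of_real t - q /\<^sub>R sqrt 2 = slice_embed J (of_real t - z /\<^sub>R sqrt 2)"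
      by (simp add: slice_embed_linear slice_embed_of_real q)
    then have "- \<nu> *\<^sub>R (of_real t - q /\<^sub>R sqrt 2)\<^sup>2 = slice_embed J (- \<nu> *\<^sub>R (of_real t - z /\<^sub>R sqrt 2)\<^sup>2)"
      by (simp only: slice_embed_linear slice_embed_power[OF J])
    also have "- \<nu> *\<^sub>R (of_real t - z /\<^sub>R sqrt 2)\<^sup>2 = - of_real \<nu> * (of_real t - z / of_real (sqrt 2))\<^sup>2"
      by (simp add: scaleR_conv_of_real divide_inverse mult.commute)
    finally show ?thesis by (simp add: E_def slice_embed_exp[OF J])
  qed
  have "has_bochner_integral lborel (\<lambda>t. exp (- \<nu> *\<^sub>R (of_real t - q /\<^sub>R sqrt 2)\<^sup>2) * slice_embed I (\<phi> (vec t)))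
    (slice_ext I (\<lambda>z. of_real (1 / c) * h z) q)"
    unfolding ex slice_embed_mult_ext[OF J I] cE unfolding q slice_ext_slice_embed[OF J]
    by (rule slice_ext_integral[OF hE hE])
  then have "quat_segal_bargmann \<nu> (slice_embed I \<circ> (\<lambda>t. \<phi> (vec t))) q = c *\<^sub>R slice_ext I (\<lambda>z. of_real (1 / c) * h z) q"
    by (simp add: quat_segal_bargmann_def c_def has_bochner_integral_iff)
  also have "\<dots> = slice_ext I h q" unfolding slice_ext_cmult using c by simp
  finally show ?thesis .
qed

text \<open>Since q and the conjugate of p lie in different slices and need not commute, the series
  is not the exponential of their product. Each term is an extension of a complex term, and the
  complex series at z and at cnj z sum to exponentials.\<close>

lemma slice_kernel_eq:
  assumes J: "J \<in> imag_units" and I: "I \<in> imag_units"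
  shows "slice_kernel \<nu> (slice_embed J z) (slice_embed I \<xi>) * slice_embed I v = (\<nu> / pi) *\<^sub>R
    ((1/2) *\<^sub>R (slice_embed I (exp (of_real \<nu> * z * cnj \<xi>) * v) + slice_embed I (exp (of_real \<nu> * cnj z * cnj \<xi>) * v)) +
    (1/2) *\<^sub>R (J * I * (slice_embed I (exp (of_real \<nu> * cnj z * cnj \<xi>) * v) - slice_embed I (exp (of_real \<nu> * z * cnj \<xi>) * v))))"
proof -
  define t where "t z m = (\<nu> ^ m / fact m) *\<^sub>R (z ^ m * cnj \<xi> ^ m)" for z and m
  have c: "qcnj (slice_embed I \<xi>) = slice_embed I (cnj \<xi>)"
    using I by (simp add: imag_units_iff quat_eq_iff qcnj_def slice_embed_def)
  have sums: "t z sums exp (of_real \<nu> * z * cnj \<xi>)" for z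
  proof -
    have "t z = (\<lambda>m. (of_real \<nu> * z * cnj \<xi>) ^ m /\<^sub>R fact m)"
      by (auto simp: t_def fun_eq_iff power_mult_distrib scaleR_conv_of_real divide_inverse)
    then show ?thesis by (simp add: exp_converges)
  qed
  have "(\<nu> ^ m / fact m) *\<^sub>R (slice_embed J z ^ m * qcnj (slice_embed I \<xi>) ^ m) =
    (1/2) *\<^sub>R (slice_embed I (t z m) + slice_embed I (t (cnj z) m)) +
    (1/2) *\<^sub>R (J * I * (slice_embed I (t (cnj z) m) - slice_embed I (t z m)))" for m
    unfolding c slice_embed_power[OF I, symmetric] slice_embed_power[OF J, symmetric] slice_embed_mult_ext[OF J I] t_def slice_embed_linear(3)
    by (simp add: scaleR_add_right scaleR_diff_right right_diff_distrib mult.commute)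
  moreover have "(\<lambda>m. (1/2) *\<^sub>R (slice_embed I (t z m) + slice_embed I (t (cnj z) m)) +
    (1/2) *\<^sub>R (J * I * (slice_embed I (t (cnj z) m) - slice_embed I (t z m)))) sums
    ((1/2) *\<^sub>R (slice_embed I (exp (of_real \<nu> * z * cnj \<xi>)) + slice_embed I (exp (of_real \<nu> * cnj z * cnj \<xi>))) +
    (1/2) *\<^sub>R (J * I * (slice_embed I (exp (of_real \<nu> * cnj z * cnj \<xi>)) - slice_embed I (exp (of_real \<nu> * z * cnj \<xi>)))))"
    by (intro sums_add sums_diff sums_scaleR_right sums_mult bounded_linear.sums[OF bounded_linear_slice_embed] sums)
  ultimately have k: "slice_kernel \<nu> (slice_embed J z) (slice_embed I \<xi>) = (\<nu> / pi) *\<^sub>R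
    ((1/2) *\<^sub>R (slice_embed I (exp (of_real \<nu> * z * cnj \<xi>)) + slice_embed I (exp (of_real \<nu> * cnj z * cnj \<xi>))) +
    (1/2) *\<^sub>R (J * I * (slice_embed I (exp (of_real \<nu> * cnj z * cnj \<xi>)) - slice_embed I (exp (of_real \<nu> * z * cnj \<xi>)))))"
    unfolding slice_kernel_def by (simp only: sums_unique[symmetric])
  show ?thesis
    unfolding k slice_embed_mult[OF I] by (simp add: distrib_right left_diff_distrib mult.assoc right_diff_distrib)
qed

text \<open>The factor \<nu> / pi inside \<open>slice_kernel\<close> cancels the pi / \<nu> of
  \<open>plane_reproducing\<close>, so the integral stands without a constant in front.\<close>

lemma slice_kernel_reproducing:
  assumes \<nu>: "\<nu> > 0" and I: "I \<in> imag_units" and f: "f \<in> bargmann_fock_plane \<nu>"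
  shows "(LINT \<xi>|lborel. exp (- \<nu> * (norm \<xi>)\<^sup>2) *\<^sub>R (slice_kernel \<nu> q (slice_embed I \<xi>) * slice_embed I (f \<xi>))) =
    slice_ext I f q"
proof -
  obtain J z where J: "J \<in> imag_units" and q: "q = slice_embed J z"
    using quat_slice_cases[OF I] by blast
  have [measurable]: "f \<in> borel_measurable borel"
    using f by (auto simp: bargmann_fock_plane_iff intro: sq_integrable_gauss_measurable)
  define a where "a w \<xi> = exp (- \<nu> * (norm \<xi>)\<^sup>2) *\<^sub>R (exp (of_real \<nu> * w * cnj \<xi>) * f \<xi>)" for w \<xi>
  have km: "(\<lambda>\<xi>. exp (of_real \<nu> * w * cnj \<xi>) * f \<xi>) \<in> borel_measurable borel" for w
    using plane_reproducing(1)[OF \<nu> f, of w] by (auto dest: borel_measurable_integrable simp: measurable_cong_sets[OF sets_gauss_measure refl])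
  have a: "has_bochner_integral lborel (a w) (of_real (pi / \<nu>) * f w)" for w
    using plane_reproducing[OF \<nu> f, of w] unfolding a_def[abs_def]
    by (simp add: has_bochner_integral_iff integrable_gauss_measure[OF km] integral_gauss_measure[OF km])
  have s: "exp (- \<nu> * (norm \<xi>)\<^sup>2) *\<^sub>R (slice_kernel \<nu> q (slice_embed I \<xi>) * slice_embed I (f \<xi>)) =
     (\<nu> / pi) *\<^sub>R ((1/2) *\<^sub>R (slice_embed I (a z \<xi>) + slice_embed I (a (cnj z) \<xi>)) +
    (1/2) *\<^sub>R (J * I * (slice_embed I (a (cnj z) \<xi>) - slice_embed I (a z \<xi>))))" for \<xi>
    unfolding q slice_kernel_eq[OF J I] a_def slice_embed_linear(3)
    by (simp add: scaleR_add_right scaleR_diff_right right_diff_distrib mult.commute)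
  have "has_bochner_integral lborel
     (\<lambda>\<xi>. exp (- \<nu> * (norm \<xi>)\<^sup>2) *\<^sub>R (slice_kernel \<nu> q (slice_embed I \<xi>) * slice_embed I (f \<xi>)))
     ((\<nu> / pi) *\<^sub>R slice_ext I (\<lambda>w. of_real (pi / \<nu>) * f w) q)"
    unfolding s unfolding q slice_ext_slice_embed[OF J]
    by (rule has_bochner_integral_scaleR_right) (rule slice_ext_integral[OF a a])
  then show ?thesis
    unfolding slice_ext_cmult using \<nu> by (simp add: has_bochner_integral_iff)
qed

theorem theorem3p2:
  fixes \<nu> :: real and I :: quat
  assumes "\<nu> > 0" and "I \<in> imag_units"
  shows "\<forall>F \<in> bargmann_fock \<nu>.
      quat_segal_bargmann \<nu> (slice_embed I \<circ> R_transform \<nu> F)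
        = (\<lambda>q. sqrt (pi / \<nu>) *\<^sub>R I_transform I F q) \<and>
      (\<forall>q. quat_segal_bargmann \<nu> (slice_embed I \<circ> R_transform \<nu> F) q
        = sqrt (pi / \<nu>) *\<^sub>R (LINT \<xi>|lborel.
            exp (- \<nu> * (norm \<xi>)\<^sup>2) *\<^sub>R
              (slice_kernel \<nu> q (slice_embed I \<xi>) * slice_embed I (F (psi2 \<xi>)))))"
proof
  fix F :: "complex^2 \<Rightarrow> complex"
  assume F: "F \<in> bargmann_fock \<nu>"
  define c where "c = sqrt (pi / \<nu>)"
  have c: "c > 0" using assms(1) by (simp add: c_def)
  note R = R_transform_preimage[OF assms(1) F, folded c_def]
  obtain \<phi> where \<phi>: "\<phi> \<in> gauss_L2 \<nu>"
    "segal_bargmann \<nu> \<phi> = (\<lambda>z :: complex^1. of_real c * F (psi2 (z $ 1)))" "R_transform \<nu> F = (\<lambda>t. \<phi> (vec t))"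
    using R(2) by blast
  have 1: "quat_segal_bargmann \<nu> (slice_embed I \<circ> R_transform \<nu> F) q = c *\<^sub>R slice_ext I (\<lambda>\<xi>. F (psi2 \<xi>)) q" for q
    unfolding \<phi>(3) slice_ext_cmult[symmetric] by (rule quat_segal_bargmann_slice[OF assms \<phi>(1,2)])
  \<comment> \<open>Dividing out the normalisation puts F o \<open>psi2\<close> itself into the Fock
    space of the plane, where the kernel reproduces it.\<close>
  have "(\<lambda>\<xi>. of_real (1 / c) * (of_real c * F (psi2 \<xi>))) \<in> bargmann_fock_plane \<nu>"
    by (rule bargmann_fock_plane_cmult[OF R(1)])
  then have P: "(\<lambda>\<xi>. F (psi2 \<xi>)) \<in> bargmann_fock_plane \<nu>" using c by simp
  show "quat_segal_bargmann \<nu> (slice_embed I \<circ> R_transform \<nu> F)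
        = (\<lambda>q. sqrt (pi / \<nu>) *\<^sub>R I_transform I F q) \<and>
      (\<forall>q. quat_segal_bargmann \<nu> (slice_embed I \<circ> R_transform \<nu> F) q
        = sqrt (pi / \<nu>) *\<^sub>R (LINT \<xi>|lborel.
            exp (- \<nu> * (norm \<xi>)\<^sup>2) *\<^sub>R
              (slice_kernel \<nu> q (slice_embed I \<xi>) * slice_embed I (F (psi2 \<xi>)))))"
    unfolding slice_kernel_reproducing[OF assms P] c_def[symmetric] fun_eq_iff 1
    by (simp add: I_transform_def comp_def)
qed

end
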